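(* The capacity region of the injective deterministic Z-interference channel with unidirectional partial cribbing (defined in the context) is given by the convex closure of the rate pairs $(R_1,R_2)$ satisfying $$\begin{aligned} R_1 & \leq H(Y_1|W),\\ R_2 & \leq \min\big(H(Y_2), H(Y_2,Z_2|T_1,W)\big),\\ R_1 + R_2 & \leq H(Y_1|T_1,W)+\min\big(H(Y_2), H(Y_2,Z_2|W)\big), \end{aligned}$$ for some pmf $p(w)\,p(x_1|w)\,p(x_2|w)$, where $T_1=t_1(X_1)$, $Y_1=y_1(X_1)$, $Y_2=y_2(X_2,T_1)$, $Z_2=z_2(X_2)$, and $W$ is an auxiliary random variable whose cardinality can be bounded as $|\mathcal{W}|\leq |\mathcal{Y}_2|+3$.
   Context: Channel: finite alphabets. Receiver 1 observes $Y_1=y_1(X_1)$, a deterministic function of the input $X_1$. The interference is $T_1=t_1(X_1)$, a deterministic function, and receiver 2 observes $Y_2=y_2(X_2,T_1)$, a deterministic function. Injectivity: for each fixed $x_2$, $t_1\mapsto y_2(x_2,t_1)$ is injective, i.e. there is a function $g$ with $t_1=g(y_2,x_2)$. The partial cribbing signal is $Z_2=z_2(X_2)\in\mathcal{Z}_2$, a deterministic function of $X_2$, observed strictly causally by encoder 1. All functions act letter by letter over $n$ channel uses. Codes: $[1:2^{nR}]$ denotes $\{1,\dots,\lceil 2^{nR}\rceil\}$. The messages $M_1,M_2$ are independent, uniform on $[1:2^{nR_1}]$ and $[1:2^{nR_2}]$; sender $j$ communicates $M_j$ to receiver $j$. An $(n,2^{nR_1},2^{nR_2},\epsilon)$ code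 consists of encoding functions $f_{1,i}:[1:2^{nR_1}]\times\mathcal{Z}_2^{i-1}\to\mathcal{X}_1$ (so $X_{1i}$ is a function of $(M_1,Z_2^{i-1})$) and $f_{2,i}:[1:2^{nR_2}]\to\mathcal{X}_2$, $1\le i\le n$, and decoding functions $g_j:\mathcal{Y}_j^n\to[1:2^{nR_j}]$, with $\Pr\{g_j(Y_j^n)\ne M_j\}\le\epsilon$ for $j\in\{1,2\}$. A pair $(R_1,R_2)$ of nonnegative reals is achievable if for every $\epsilon>0$ there exists such a code for all sufficiently large $n$. The capacity region is the closure of the set of achievable rate pairs. "Convex closure" means closure of the convex hull; rate pairs are pairs of nonnegative reals. *)

theory Defs
  imports "HOL-Probability.Probability"
begin

section \<open>Entropies in bits\<close>

definition entropy_pmf :: "'s pmf \<Rightarrow> ('s \<Rightarrow> 'a) \<Rightarrow> real" where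
  "entropy_pmf p X = prob_space.entropy (measure_pmf p) 2 (count_space UNIV) X"

definition cond_entropy_pmf :: "'s pmf \<Rightarrow> ('s \<Rightarrow> 'a) \<Rightarrow> ('s \<Rightarrow> 'b) \<Rightarrow> real" where
  "cond_entropy_pmf p X Y =
     prob_space.conditional_entropy (measure_pmf p) 2 (count_space UNIV) (count_space UNIV) X Y"

text \<open>The library entropies, taken with respect to counting measure, are the usual Shannon
  entropies when the underlying distribution has finite support.\<close>

lemma information_space_pmf: "information_space (measure_pmf p) 2"
  by (simp add: information_space_def information_space_axioms_def prob_space_measure_pmf)

lemma distributed_pmf:
  "distributed (measure_pmf p) (count_space UNIV) X (\<lambda>x. ennreal (pmf (map_pmf X p) x))"
  unfolding distributed_def
  by (simp add: map_pmf_rep_eq[symmetric] measure_pmf_eq_density[symmetric])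

lemma integrable_pmf_mult:
  fixes g :: "'a \<Rightarrow> real"
  assumes "finite (set_pmf q)"
  shows "integrable (count_space UNIV) (\<lambda>x. pmf q x * g x)"
proof -
  have "Infinite_Set_Sum.abs_summable_on (\<lambda>x. pmf q x * g x) (set_pmf q)"
    using assms by simp
  also have "?this \<longleftrightarrow> Infinite_Set_Sum.abs_summable_on (\<lambda>x. pmf q x * g x) UNIV"
    by (intro Infinite_Set_Sum.abs_summable_on_cong_neutral) (auto simp: set_pmf_iff)
  finally show ?thesis by (simp add: Infinite_Set_Sum.abs_summable_on_def)
qed

lemma entropy_pmf_eq_sum:
  assumes "finite (set_pmf p)"
  shows "entropy_pmf p X = - (\<Sum>x\<in>X ` set_pmf p. pmf (map_pmf X p) x * log 2 (pmf (map_pmf X p) x))"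
proof -
  interpret information_space "measure_pmf p" 2 by (rule information_space_pmf)
  have "entropy_pmf p X = - (\<integral>x. pmf (map_pmf X p) x * log 2 (pmf (map_pmf X p) x) \<partial>count_space UNIV)"
    unfolding entropy_pmf_def by (rule entropy_distr[OF distributed_pmf]) simp
  also have "(\<integral>x. pmf (map_pmf X p) x * log 2 (pmf (map_pmf X p) x) \<partial>count_space UNIV) =
      (\<Sum>x\<in>X ` set_pmf p. pmf (map_pmf X p) x * log 2 (pmf (map_pmf X p) x))"
  proof -
    have sub: "{x. pmf (map_pmf X p) x * log 2 (pmf (map_pmf X p) x) \<noteq> 0} \<subseteq> X ` set_pmf p"
      by (metis (mono_tags, lifting) mem_Collect_eq mult_zero_left set_map_pmf set_pmf_iff subsetI)
    with assms show ?thesis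
      by (subst lebesgue_integral_count_space_finite_support)
         (auto intro!: sum.mono_neutral_left intro: finite_subset)
  qed
  finally show ?thesis .
qed

lemma cond_entropy_pmf_eq_diff:
  fixes X :: "'s \<Rightarrow> 'a::countable" and Y :: "'s \<Rightarrow> 'b::countable"
  assumes "finite (set_pmf p)"
  shows "cond_entropy_pmf p X Y = entropy_pmf p (\<lambda>s. (X s, Y s)) - entropy_pmf p Y"
proof -
  interpret information_space "measure_pmf p" 2 by (rule information_space_pmf)
  have prod: "count_space UNIV \<Otimes>\<^sub>M count_space UNIV = (count_space UNIV :: ('a \<times> 'b) measure)"
    by (subst pair_measure_countable) auto
  have fin: "finite (set_pmf (map_pmf (\<lambda>s. (X s, Y s)) p))"
    using assms by simp
  show ?thesis
    unfolding cond_entropy_pmf_def entropy_pmf_def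
    by (subst conditional_entropy_eq_entropy
          [where Py = "pmf (map_pmf Y p)" and
                 Pxy = "pmf (map_pmf (\<lambda>s. (X s, Y s)) p)"])
       (auto simp: prod distributed_pmf sigma_finite_measure_count_space
             intro: integrable_pmf_mult[OF fin])
qed


section \<open>Codes and the capacity region\<close>

text \<open>The channel is given by the deterministic maps \<open>y1\<close>, \<open>t1\<close>, \<open>y2\<close>, \<open>z2\<close> between finite
  alphabets.  Channel uses are numbered from 1, so \<open>[1..<i]\<close> is the strict past of time \<open>i\<close>
  and \<open>[1..<Suc n]\<close> is the whole block.\<close>

definition messages :: "nat \<Rightarrow> real \<Rightarrow> nat set" where
  "messages n R = {1..nat \<lceil>2 powr (real n * R)\<rceil>}"

definition input1 ::
  "('x2 \<Rightarrow> 'z2) \<Rightarrow> (nat \<Rightarrow> nat \<Rightarrow> 'z2 list \<Rightarrow> 'x1) \<Rightarrow> (nat \<Rightarrow> nat \<Rightarrow> 'x2)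
     \<Rightarrow> nat \<times> nat \<Rightarrow> nat \<Rightarrow> 'x1" where
  "input1 z2 f1 f2 m i = f1 i (fst m) (map (\<lambda>j. z2 (f2 j (snd m))) [1..<i])"

definition output1 ::
  "('x1 \<Rightarrow> 'y1) \<Rightarrow> ('x2 \<Rightarrow> 'z2) \<Rightarrow> (nat \<Rightarrow> nat \<Rightarrow> 'z2 list \<Rightarrow> 'x1) \<Rightarrow> (nat \<Rightarrow> nat \<Rightarrow> 'x2)
     \<Rightarrow> nat \<Rightarrow> nat \<times> nat \<Rightarrow> 'y1 list" where
  "output1 y1 z2 f1 f2 n m = map (\<lambda>i. y1 (input1 z2 f1 f2 m i)) [1..<Suc n]"

definition output2 ::
  "('x1 \<Rightarrow> 't1) \<Rightarrow> ('x2 \<Rightarrow> 't1 \<Rightarrow> 'y2) \<Rightarrow> ('x2 \<Rightarrow> 'z2)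
     \<Rightarrow> (nat \<Rightarrow> nat \<Rightarrow> 'z2 list \<Rightarrow> 'x1) \<Rightarrow> (nat \<Rightarrow> nat \<Rightarrow> 'x2)
     \<Rightarrow> nat \<Rightarrow> nat \<times> nat \<Rightarrow> 'y2 list" where
  "output2 t1 y2 z2 f1 f2 n m =
     map (\<lambda>i. y2 (f2 i (snd m)) (t1 (input1 z2 f1 f2 m i))) [1..<Suc n]"

definition message_pmf :: "nat \<Rightarrow> real \<Rightarrow> real \<Rightarrow> (nat \<times> nat) pmf" where
  "message_pmf n R1 R2 = pair_pmf (pmf_of_set (messages n R1)) (pmf_of_set (messages n R2))"

definition is_code ::
  "('x1 \<Rightarrow> 'y1) \<Rightarrow> ('x1 \<Rightarrow> 't1) \<Rightarrow> ('x2 \<Rightarrow> 't1 \<Rightarrow> 'y2) \<Rightarrow> ('x2 \<Rightarrow> 'z2)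
     \<Rightarrow> nat \<Rightarrow> real \<Rightarrow> real \<Rightarrow> real
     \<Rightarrow> (nat \<Rightarrow> nat \<Rightarrow> 'z2 list \<Rightarrow> 'x1) \<Rightarrow> (nat \<Rightarrow> nat \<Rightarrow> 'x2)
     \<Rightarrow> ('y1 list \<Rightarrow> nat) \<Rightarrow> ('y2 list \<Rightarrow> nat) \<Rightarrow> bool" where
  "is_code y1 t1 y2 z2 n R1 R2 \<epsilon> f1 f2 g1 g2 \<longleftrightarrow>
     (\<forall>ys. length ys = n \<longrightarrow> g1 ys \<in> messages n R1) \<and>
     (\<forall>ys. length ys = n \<longrightarrow> g2 ys \<in> messages n R2) \<and>
     measure_pmf.prob (message_pmf n R1 R2)
       {m. g1 (output1 y1 z2 f1 f2 n m) \<noteq> fst m} \<le> \<epsilon> \<and>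
     measure_pmf.prob (message_pmf n R1 R2)
       {m. g2 (output2 t1 y2 z2 f1 f2 n m) \<noteq> snd m} \<le> \<epsilon>"

definition achievable ::
  "('x1 \<Rightarrow> 'y1) \<Rightarrow> ('x1 \<Rightarrow> 't1) \<Rightarrow> ('x2 \<Rightarrow> 't1 \<Rightarrow> 'y2) \<Rightarrow> ('x2 \<Rightarrow> 'z2)
     \<Rightarrow> real \<times> real \<Rightarrow> bool" where
  "achievable y1 t1 y2 z2 = (\<lambda>(R1, R2). 0 \<le> R1 \<and> 0 \<le> R2 \<and>
     (\<forall>\<epsilon>>0. \<forall>\<^sub>F n in sequentially.
        \<exists>f1 f2 g1 g2. is_code y1 t1 y2 z2 n R1 R2 \<epsilon> f1 f2 g1 g2))"

definition capacity_region ::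
  "('x1 \<Rightarrow> 'y1) \<Rightarrow> ('x1 \<Rightarrow> 't1) \<Rightarrow> ('x2 \<Rightarrow> 't1 \<Rightarrow> 'y2) \<Rightarrow> ('x2 \<Rightarrow> 'z2)
     \<Rightarrow> (real \<times> real) set" where
  "capacity_region y1 t1 y2 z2 = closure {R. achievable y1 t1 y2 z2 R}"


section \<open>The single-letter region\<close>

definition joint_pmf ::
  "'w pmf \<Rightarrow> ('w \<Rightarrow> 'x1 pmf) \<Rightarrow> ('w \<Rightarrow> 'x2 pmf) \<Rightarrow> ('w \<times> 'x1 \<times> 'x2) pmf" where
  "joint_pmf pW p1 p2 =
     bind_pmf pW (\<lambda>w. map_pmf (\<lambda>x. (w, x)) (pair_pmf (p1 w) (p2 w)))"

definition satisfies_bounds ::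
  "('x1 \<Rightarrow> 'y1) \<Rightarrow> ('x1 \<Rightarrow> 't1) \<Rightarrow> ('x2 \<Rightarrow> 't1 \<Rightarrow> 'y2) \<Rightarrow> ('x2 \<Rightarrow> 'z2)
     \<Rightarrow> ('w \<times> 'x1 \<times> 'x2) pmf \<Rightarrow> real \<times> real \<Rightarrow> bool" where
  "satisfies_bounds y1 t1 y2 z2 p = (\<lambda>(R1, R2).
     let W = (\<lambda>(w, x1, x2). w);
         T1 = (\<lambda>(w, x1, x2). t1 x1);
         Y1 = (\<lambda>(w, x1, x2). y1 x1);
         Y2 = (\<lambda>(w, x1, x2). y2 x2 (t1 x1));
         Z2 = (\<lambda>(w, x1, x2). z2 x2);
         T1W = (\<lambda>s. (T1 s, W s));
         Y2Z2 = (\<lambda>s. (Y2 s, Z2 s))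
     in R1 \<le> cond_entropy_pmf p Y1 W \<and>
        R2 \<le> min (entropy_pmf p Y2) (cond_entropy_pmf p Y2Z2 T1W) \<and>
        R1 + R2 \<le> cond_entropy_pmf p Y1 T1W + min (entropy_pmf p Y2) (cond_entropy_pmf p Y2Z2 W))"

text \<open>The alphabet of the auxiliary variable is a set \<open>A\<close> of natural numbers; only its
  cardinality matters.\<close>

definition rate_region ::
  "('x1 \<Rightarrow> 'y1) \<Rightarrow> ('x1 \<Rightarrow> 't1) \<Rightarrow> ('x2 \<Rightarrow> 't1 \<Rightarrow> 'y2) \<Rightarrow> ('x2 \<Rightarrow> 'z2)
     \<Rightarrow> nat set \<Rightarrow> (real \<times> real) set" where
  "rate_region y1 t1 y2 z2 A = {(R1, R2). 0 \<le> R1 \<and> 0 \<le> R2 \<and>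
     (\<exists>pW p1 p2. set_pmf pW \<subseteq> A \<and>
        satisfies_bounds y1 t1 y2 z2 (joint_pmf pW p1 p2) (R1, R2))}"

end

theory Submission
  imports Defs "HOL-Real_Asymp.Real_Asymp"
begin

text \<open>
  Converse: with \<open>W = (Q, Z\<^sub>2\<^sup>Q\<^sup>-\<^sup>1)\<close>, where \<open>Q\<close> is a uniformly distributed time, Fano's inequality
  and the chain rule give all five bounds at once.  Injectivity enters through
  \<open>H(Y\<^sub>2 | M\<^sub>2) = H(T\<^sub>1 | M\<^sub>2)\<close>.  Only \<open>H(Y\<^sub>2)\<close> is not linear in the law of \<open>W\<close>, and it is concave, so the
  region is convex.  The law of \<open>Y\<^sub>2\<close> and three of the four conditional entropies, at most
  \<open>|Y\<^sub>2| + 3\<close> linear constraints with the normalisation included, are kept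
  while the fourth entropy is maximised; an extreme point gives the cardinality bound.

  Direct part: block Markov coding with backward decoding.  In each block both encoders know a hash
  \<open>k\<close> of the cribbing signal of the previous block; it selects \<open>w\<close>, the codewords
  \<open>x\<^sub>2(m\<^sub>2)\<close> drawn from \<open>p(x\<^sub>2|w)\<close>, and a list of interference words \<open>t\<close> drawn from \<open>p(t\<^sub>1|w)\<close>.
  Receiver 1 does not know \<open>w\<close>; its messages are random bins of the sequences \<open>y\<^sub>1\<close>, as for a channel
  with state known at the encoder, so that it errs only on an empty bin.  The bin index is nearly uniform given \<open>w\<close> as soon as
  \<open>R\<^sub>1 < H(Y\<^sub>1|W)\<close> and \<open>R\<^sub>1 < R\<^sub>t + H(Y\<^sub>1|T\<^sub>1,W)\<close>, with \<open>R\<^sub>t\<close> the rate of the list.  Receiver 2, who knows the hash of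
  the present block from the block after it, finds \<open>(k, m\<^sub>2)\<close> if \<open>R\<^sub>2 + R\<^sub>t < min(H(Y\<^sub>2), H(Y\<^sub>2,Z\<^sub>2|W))\<close> and
  \<open>R\<^sub>2 < H(Y\<^sub>2,Z\<^sub>2|T\<^sub>1,W)\<close>.  Instead of typical sets the estimates use
  \<open>min(1, x) \<le> x\<^sup>\<rho>\<close>, under which all error terms become products over the letters.\<close>

text \<open>The sum bound comes from the free rate R_t of the list. It has to lie above max(0, R_1 -
  H(Y_1|T_1,W)) and below min(H(Y_2), H(Y_2,Z_2|W)) - R_2; eliminating it leaves R_2 < min(H(Y_2),
  H(Y_2,Z_2|W)) and the strict form of the bound on R_1 + R_2. The index is a uniform hash of the
  cribbing signal and not the signal itself, because a wrong cloud then agrees with the known hash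
  with probability 1/K, which cancels the number K of clouds and leaves only H(Y_2) as the limit.
  Inside the right cloud a hash into slightly more than M_2 values still identifies the cribbing
  signal, so receiver 2 decodes as if it observed Z_2. The index of a block is produced by earlier
  messages and has no prescribed law. Each block must therefore work on average under every law of
  the index. Scaling a rate pair by a factor below one makes bounds strict only at positive rates.
  Rate zero is treated apart: a single bin if R_1 = 0, an uncoded scheme without error if R_2 =
  0.\<close>

abbreviation EV :: "'a pmf \<Rightarrow> ('a \<Rightarrow> real) \<Rightarrow> real" where
  "EV p \<equiv> measure_pmf.expectation p"

abbreviation PR :: "'a pmf \<Rightarrow> 'a set \<Rightarrow> real" where
  "PR p \<equiv> measure_pmf.prob p"

section \<open>Expectations under finitely supported distributions\<close>

lemma integrable_finite_pmf [simp, intro]: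
  "finite (set_pmf p) \<Longrightarrow> integrable (measure_pmf p) (f :: _ \<Rightarrow> real)"
  by (rule integrable_measure_pmf_finite)

lemma EV_finite:
  "finite (set_pmf p) \<Longrightarrow> EV p f = (\<Sum>x\<in>set_pmf p. pmf p x * (f x :: real))"
  by (subst integral_measure_pmf[of "set_pmf p"]) auto

lemma EV_mono:
  fixes f g :: "_ \<Rightarrow> real"
  assumes "finite (set_pmf p)" "\<And>x. x \<in> set_pmf p \<Longrightarrow> f x \<le> g x"
  shows "EV p f \<le> EV p g"
  using assms by (auto simp: EV_finite intro!: sum_mono mult_left_mono)

lemma EV_cong:
  fixes f g :: "_ \<Rightarrow> real"
  assumes "p = q" "\<And>x. x \<in> set_pmf q \<Longrightarrow> f x = g x"
  shows "EV p f = EV q g"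
  using assms by (auto intro!: integral_cong_AE AE_pmfI)

lemma EV_bind:
  fixes h :: "_ \<Rightarrow> real"
  assumes "finite (set_pmf p)" "\<And>x. x \<in> set_pmf p \<Longrightarrow> finite (set_pmf (f x))"
  shows "EV (bind_pmf p f) h
    = EV p (\<lambda>x. EV (f x) h)"
  using assms by (subst pmf_expectation_bind[of "set_pmf p"]) (auto simp: EV_finite)

lemma EV_pair:
  fixes h :: "_ \<Rightarrow> real"
  assumes "finite (set_pmf p)" "finite (set_pmf q)"
  shows "EV (pair_pmf p q) h
    = EV p (\<lambda>x. EV q (\<lambda>y. h (x, y)))"
  using assms unfolding pair_pmf_def
  by (simp add: EV_bind)

lemma EV_swap:
  fixes h :: "_ \<Rightarrow> _ \<Rightarrow> real"
  assumes "finite (set_pmf p)" "finite (set_pmf q)"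
  shows "EV p (\<lambda>x. EV q (h x))
    = EV q (\<lambda>y. EV p (\<lambda>x. h x y))"
  using assms unfolding EV_finite[OF assms(1)] EV_finite[OF assms(2)] sum_distrib_left
  by (subst sum.swap) (simp add: mult.left_commute)

lemma EV_le_const:
  fixes f :: "_ \<Rightarrow> real"
  assumes "finite (set_pmf p)" "\<And>x. x \<in> set_pmf p \<Longrightarrow> f x \<le> c"
  shows "EV p f \<le> c"
  using assms EV_mono[of p f "\<lambda>_. c"] by simp

lemma EV_nonneg:
  fixes f :: "_ \<Rightarrow> real"
  assumes "\<And>x. x \<in> set_pmf p \<Longrightarrow> 0 \<le> f x"
  shows "0 \<le> EV p f"
  using assms by (intro integral_nonneg_AE AE_pmfI)

lemma ex_le_expectation:
  fixes f :: "_ \<Rightarrow> real"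
  assumes "finite (set_pmf p)" "EV p f \<le> c"
  shows "\<exists>x\<in>set_pmf p. f x \<le> c"
proof (rule ccontr)
  assume "\<not> ?thesis"
  then have gt: "\<And>x. x \<in> set_pmf p \<Longrightarrow> c < f x" by (auto simp: not_le)
  have "(\<Sum>x\<in>set_pmf p. pmf p x * c) < (\<Sum>x\<in>set_pmf p. pmf p x * f x)"
    using assms(1) gt set_pmf_not_empty[of p] by (intro sum_strict_mono) (auto simp: pmf_positive)
  then show False using assms
    by (simp add: EV_finite flip: sum_distrib_right) (simp add: sum_pmf_eq_1)
qed

section \<open>Entropy\<close>

lemma entropy_pmf_expectation:
  assumes "finite (set_pmf p)"
  shows "entropy_pmf p X = EV p (\<lambda>s. - log 2 (pmf (map_pmf X p) (X s)))"
proof -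
  have "EV p (\<lambda>s. - log 2 (pmf (map_pmf X p) (X s)))
    = EV (map_pmf X p) (\<lambda>x. - log 2 (pmf (map_pmf X p) x))" by simp
  also have "\<dots> = entropy_pmf p X"
    by (subst EV_finite) (use assms in \<open>simp_all add: entropy_pmf_eq_sum sum_negf\<close>)
  finally show ?thesis by simp
qed

lemma entropy_pmf_map:
  assumes "finite (set_pmf p)"
  shows "entropy_pmf (map_pmf f p) X = entropy_pmf p (\<lambda>s. X (f s))"
  using assms by (simp add: entropy_pmf_eq_sum map_pmf_comp image_image)

text \<open>The tangent bound \<open>ln x \<le> x - 1\<close> at \<open>x = r / p\<close>. Total
  mass at most one suffices for \<open>r\<close>, so comparison weights never have to be
  normalised.\<close>

lemma gibbs_inequality:
  assumes fin: "finite (set_pmf p)" and pos: "\<And>x. x \<in> set_pmf p \<Longrightarrow> 0 < r x"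
    and le: "(\<Sum>x\<in>set_pmf p. r x) \<le> 1"
  shows "EV p (\<lambda>x. - log 2 (pmf p x))
    \<le> EV p (\<lambda>x. - log 2 (r x))"
proof -
  have "(\<Sum>x\<in>set_pmf p. pmf p x * (ln (r x) - ln (pmf p x))) \<le> (\<Sum>x\<in>set_pmf p. r x - pmf p x)"
  proof (rule sum_mono)
    fix x assume x: "x \<in> set_pmf p"
    have pp: "0 < pmf p x" using x by (rule pmf_positive)
    have "ln (r x) - ln (pmf p x) = ln (r x / pmf p x)" using pos[OF x] pp by (simp add: ln_div)
    also have "\<dots> \<le> r x / pmf p x - 1" using pos[OF x] pp by (intro ln_le_minus_one) simp
    finally have "pmf p x * (ln (r x) - ln (pmf p x)) \<le> pmf p x * (r x / pmf p x - 1)"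
      using pp by (intro mult_left_mono) auto
    also have "\<dots> = r x - pmf p x" using pp by (simp add: field_simps)
    finally show "pmf p x * (ln (r x) - ln (pmf p x)) \<le> r x - pmf p x" .
  qed
  also have "\<dots> \<le> 0" using le fin by (simp add: sum_subtractf sum_pmf_eq_1)
  finally have "(\<Sum>x\<in>set_pmf p. pmf p x * ln (r x)) \<le> (\<Sum>x\<in>set_pmf p. pmf p x * ln (pmf p x))"
    by (simp add: right_diff_distrib sum_subtractf)
  then show ?thesis
    using fin by (simp add: EV_finite sum_negf log_def divide_right_mono flip: sum_divide_distrib)
qed

lemma entropy_le_cross:
  assumes fin: "finite (set_pmf p)" and pos: "\<And>s. s \<in> set_pmf p \<Longrightarrow> 0 < r (X s)"
    and le: "(\<Sum>x\<in>X ` set_pmf p. r x) \<le> 1"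
  shows "entropy_pmf p X \<le> EV p (\<lambda>s. - log 2 (r (X s)))"
  using gibbs_inequality[of "map_pmf X p" r] assms
  by (auto simp: entropy_pmf_expectation)

text \<open>The conditional form of Gibbs' inequality, from which all conditional inequalities
  below follow by the choice of the comparison kernel \<open>r\<close>.\<close>

lemma cond_entropy_le_cross:
  assumes fin: "finite (set_pmf p)" and pos: "\<And>s. s \<in> set_pmf p \<Longrightarrow> 0 < r (X s) (Y s)"
    and le: "\<And>y. y \<in> Y ` set_pmf p \<Longrightarrow> (\<Sum>x\<in>X ` set_pmf p. r x y) \<le> 1"
    and nonneg: "\<And>x y. 0 \<le> r x y"
  shows "entropy_pmf p (\<lambda>s. (X s, Y s)) - entropy_pmf p Y
    \<le> EV p (\<lambda>s. - log 2 (r (X s) (Y s)))"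
proof -
  let ?q = "pmf (map_pmf Y p)"
  have qpos: "0 < ?q (Y s)" if "s \<in> set_pmf p" for s
    using that by (intro pmf_positive) auto
  have "entropy_pmf p (\<lambda>s. (X s, Y s))
      \<le> EV p (\<lambda>s. - log 2 ((\<lambda>(x, y). r x y * ?q y) (X s, Y s)))"
  proof (rule entropy_le_cross[OF fin])
    show "0 < (\<lambda>(x, y). r x y * ?q y) (X s, Y s)" if "s \<in> set_pmf p" for s
      using pos[OF that] qpos[OF that] by simp
    have "(\<Sum>z\<in>(\<lambda>s. (X s, Y s)) ` set_pmf p. (\<lambda>(x, y). r x y * ?q y) z)
      \<le> (\<Sum>z\<in>X ` set_pmf p \<times> Y ` set_pmf p. (\<lambda>(x, y). r x y * ?q y) z)"
      using fin nonneg by (intro sum_mono2) auto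
    also have "\<dots> = (\<Sum>x\<in>X ` set_pmf p. \<Sum>y\<in>Y ` set_pmf p. r x y * ?q y)"
      by (simp add: sum.cartesian_product)
    also have "\<dots> = (\<Sum>y\<in>Y ` set_pmf p. (\<Sum>x\<in>X ` set_pmf p. r x y) * ?q y)"
      by (subst sum.swap) (simp add: sum_distrib_right)
    also have "\<dots> \<le> (\<Sum>y\<in>Y ` set_pmf p. 1 * ?q y)"
      using le by (intro sum_mono mult_right_mono) auto
    also have "\<dots> = 1" using fin by (simp add: sum_pmf_eq_1)
    finally show "(\<Sum>z\<in>(\<lambda>s. (X s, Y s)) ` set_pmf p. (\<lambda>(x, y). r x y * ?q y) z) \<le> 1" .
  qed
  also have "\<dots> = EV p (\<lambda>s. - log 2 (r (X s) (Y s)) + - log 2 (?q (Y s)))"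
    by (intro EV_cong refl) (use pos qpos in \<open>auto simp: log_mult_pos\<close>)
  also have "\<dots> = EV p (\<lambda>s. - log 2 (r (X s) (Y s))) + entropy_pmf p Y"
    using fin by (subst Bochner_Integration.integral_add) (auto simp: entropy_pmf_expectation)
  finally show ?thesis by simp
qed

lemma pmf_map_mono:
  assumes "\<And>s'. s' \<in> set_pmf p \<Longrightarrow> X s' = X s \<Longrightarrow> Y s' = Y s"
  shows "pmf (map_pmf X p) (X s) \<le> pmf (map_pmf Y p) (Y s)"
proof -
  have "measure p (X -` {X s}) = measure p (X -` {X s} \<inter> set_pmf p)" by (simp add: measure_Int_set_pmf)
  also have "\<dots> \<le> measure p (Y -` {Y s})"
    using assms by (intro measure_pmf.finite_measure_mono) auto
  finally show ?thesis by (simp add: pmf_map)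
qed

text \<open>Functional dependence without a named function, so that dependences between nested
  tuples of random variables are mostly settled by \<open>auto\<close>. It is demanded everywhere
  and not only on a support.\<close>

definition determines :: "('s \<Rightarrow> 'a) \<Rightarrow> ('s \<Rightarrow> 'b) \<Rightarrow> bool" where
  "determines X Y \<longleftrightarrow> (\<forall>s s'. X s = X s' \<longrightarrow> Y s = Y s')"

lemma entropy_mono:
  assumes fin: "finite (set_pmf p)" and f: "determines X Y"
  shows "entropy_pmf p Y \<le> entropy_pmf p X"
  unfolding entropy_pmf_expectation[OF fin]
proof (intro EV_mono fin)
  fix s assume s: "s \<in> set_pmf p"
  have "pmf (map_pmf X p) (X s) \<le> pmf (map_pmf Y p) (Y s)"
    using f unfolding determines_def by (intro pmf_map_mono) blast
  moreover have "0 < pmf (map_pmf X p) (X s)" using s by (intro pmf_positive) auto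
  ultimately show "- log 2 (pmf (map_pmf Y p) (Y s)) \<le> - log 2 (pmf (map_pmf X p) (X s))" by simp
qed

lemma entropy_eq:
  assumes "finite (set_pmf p)" "determines X Y" "determines Y X"
  shows "entropy_pmf p Y = entropy_pmf p X"
  using entropy_mono assms by (meson order_antisym)

lemma cond_entropy_reduces:
  assumes fin: "finite (set_pmf p)" and f: "determines Y D"
  shows "entropy_pmf p (\<lambda>s. (X s, Y s)) - entropy_pmf p Y
    \<le> entropy_pmf p (\<lambda>s. (X s, D s)) - entropy_pmf p D"
proof -
  obtain g where g: "\<And>s. D s = g (Y s)"
  proof
    show "D s = D (SOME s'. Y s' = Y s)" for s
      using f someI[of "\<lambda>s'. Y s' = Y s" s] unfolding determines_def by metis
  qed
  \<comment> \<open>The comparison kernel is the conditional law of \<open>X\<close> given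
    \<open>D\<close>; it is a kernel from \<open>Y\<close> because \<open>D\<close> is
    \<open>g\<close> of \<open>Y\<close>.\<close>
  let ?XD = "pmf (map_pmf (\<lambda>s. (X s, D s)) p)" and ?D = "pmf (map_pmf D p)"
  have 1: "0 < ?XD (X s, D s)" "0 < ?D (D s)" if "s \<in> set_pmf p" for s
    using that by (auto intro!: pmf_positive)
  have "entropy_pmf p (\<lambda>s. (X s, Y s)) - entropy_pmf p Y
    \<le> EV p (\<lambda>s. - log 2 ((\<lambda>x y. ?XD (x, g y) / ?D (g y)) (X s) (Y s)))"
  proof (rule cond_entropy_le_cross[OF fin])
    show "0 < ?XD (X s, g (Y s)) / ?D (g (Y s))" if "s \<in> set_pmf p" for s
      using 1[OF that] by (simp add: g)
    fix y assume y: "y \<in> Y ` set_pmf p"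
    then have Dpos: "0 < ?D (g y)" using 1 g by auto
    have "(\<Sum>x\<in>X ` set_pmf p. ?XD (x, g y)) = measure (map_pmf (\<lambda>s. (X s, D s)) p) (X ` set_pmf p \<times> {g y})"
    proof -
      have "X ` set_pmf p \<times> {g y} = (\<lambda>x. (x, g y)) ` (X ` set_pmf p)" by auto
      then show ?thesis using fin by (subst measure_measure_pmf_finite) (auto simp: sum.reindex inj_on_def)
    qed
    also have "\<dots> \<le> measure p (D -` {g y})"
      unfolding measure_map_pmf by (intro measure_pmf.finite_measure_mono) auto
    finally show "(\<Sum>x\<in>X ` set_pmf p. ?XD (x, g y) / ?D (g y)) \<le> 1"
      using Dpos by (simp add: pmf_map flip: sum_divide_distrib)
  qed auto
  also have "\<dots> = EV p (\<lambda>s. - log 2 (?XD (X s, D s)) - - log 2 (?D (D s)))"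
    by (intro EV_cong refl) (use 1 in \<open>simp add: log_divide_pos flip: g\<close>)
  also have "\<dots> = entropy_pmf p (\<lambda>s. (X s, D s)) - entropy_pmf p D"
    using fin by (subst Bochner_Integration.integral_diff) (auto simp: entropy_pmf_expectation)
  finally show ?thesis .
qed

lemma entropy_le_log_card:
  assumes fin: "finite (set_pmf p)" and "finite A" "X ` set_pmf p \<subseteq> A"
  shows "entropy_pmf p X \<le> log 2 (card A)"
proof -
  have ne: "0 < card A" using assms set_pmf_not_empty[of p] by (auto simp: card_gt_0_iff)
  have "entropy_pmf p X \<le> EV p (\<lambda>s. - log 2 ((\<lambda>_. 1 / card A) (X s)))"
  proof (rule entropy_le_cross[OF fin])
    have "(\<Sum>x\<in>X ` set_pmf p. 1 / real (card A)) \<le> (\<Sum>x\<in>A. 1 / real (card A))"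
      using assms by (intro sum_mono2) auto
    then show "(\<Sum>x\<in>X ` set_pmf p. 1 / real (card A)) \<le> 1" using ne by simp
  qed (use ne in auto)
  also have "\<dots> = log 2 (card A)" using ne by (simp add: log_divide)
  finally show ?thesis .
qed

lemma entropy_pmf_nonneg:
  assumes fin: "finite (set_pmf p)"
  shows "0 \<le> entropy_pmf p X"
  unfolding entropy_pmf_expectation[OF fin]
proof (rule EV_nonneg)
  fix s assume "s \<in> set_pmf p"
  then have "0 < pmf (map_pmf X p) (X s)" by (intro pmf_positive) auto
  then show "0 \<le> - log 2 (pmf (map_pmf X p) (X s))" using pmf_le_1 by simp
qed

text \<open>The chain rule \<open>H(V,W) = H(W) + H(V|W)\<close> for a variable \<open>V\<close>
  whose definition may depend on the value \<open>w\<close>. Time sharing over letter positions uses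
  this freedom.\<close>

lemma entropy_mixture:
  assumes fq: "finite (set_pmf q)" and fk: "\<And>w. w \<in> set_pmf q \<Longrightarrow> finite (set_pmf (\<kappa> w))"
  shows "entropy_pmf (bind_pmf q (\<lambda>w. map_pmf (Pair w) (\<kappa> w))) (\<lambda>(w, x). (V w x, w))
    = entropy_pmf q (\<lambda>w. w) + EV q (\<lambda>w. entropy_pmf (\<kappa> w) (V w))"
    (is "entropy_pmf ?j _ = _")
proof -
  have fj: "finite (set_pmf ?j)" using fq fk by auto
  have pm: "pmf (map_pmf (\<lambda>(w, x). (V w x, w)) ?j) (v, w) = pmf q w * pmf (map_pmf (V w) (\<kappa> w)) v"
    if "w \<in> set_pmf q" for v w
  proof -
    have "map_pmf (\<lambda>(w, x). (V w x, w)) ?j = bind_pmf q (\<lambda>w. map_pmf (\<lambda>v. (v, w)) (map_pmf (V w) (\<kappa> w)))"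
      by (simp add: map_bind_pmf map_pmf_comp)
    also have "pmf \<dots> (v, w) = EV q (\<lambda>w'. if w' = w then pmf (map_pmf (V w) (\<kappa> w)) v else 0)"
      unfolding pmf_bind
      by (intro EV_cong refl) (auto simp: pmf_map vimage_def intro!: arg_cong2[where f=measure])
    also have "\<dots> = pmf q w * pmf (map_pmf (V w) (\<kappa> w)) v"
      using fq that by (subst EV_finite) (auto simp: if_distrib cong: if_cong)
    finally show ?thesis .
  qed
  have "entropy_pmf ?j (\<lambda>(w, x). (V w x, w)) = EV q (\<lambda>w.
     EV (\<kappa> w) (\<lambda>x. - log 2 (pmf (map_pmf (\<lambda>(w, x). (V w x, w)) ?j) (V w x, w))))"
    unfolding entropy_pmf_expectation[OF fj] using fq fk by (subst EV_bind) auto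
  also have "\<dots> = EV q (\<lambda>w.
     EV (\<kappa> w) (\<lambda>x. - log 2 (pmf q w) + - log 2 (pmf (map_pmf (V w) (\<kappa> w)) (V w x))))"
  proof (intro EV_cong refl)
    fix w x assume w: "w \<in> set_pmf q" and x: "x \<in> set_pmf (\<kappa> w)"
    have "0 < pmf q w" "0 < pmf (map_pmf (V w) (\<kappa> w)) (V w x)"
      using w x by (auto intro!: pmf_positive)
    then show "- log 2 (pmf (map_pmf (\<lambda>(w, x). (V w x, w)) ?j) (V w x, w)) =
      - log 2 (pmf q w) + - log 2 (pmf (map_pmf (V w) (\<kappa> w)) (V w x))"
      unfolding pm[OF w] by (simp add: log_mult)
  qed
  also have "\<dots> = EV q (\<lambda>w. - log 2 (pmf q w) + entropy_pmf (\<kappa> w) (V w))"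
    by (intro EV_cong refl, subst Bochner_Integration.integral_add)
       (use fk in \<open>auto simp: entropy_pmf_expectation\<close>)
  also have "\<dots> = entropy_pmf q (\<lambda>w. w) + EV q (\<lambda>w. entropy_pmf (\<kappa> w) (V w))"
    by (subst Bochner_Integration.integral_add) (use fq in \<open>auto simp: entropy_pmf_expectation\<close>)
  finally show ?thesis .
qed

lemma entropy_mixture':
  assumes "finite (set_pmf q)" "\<And>w. w \<in> set_pmf q \<Longrightarrow> finite (set_pmf (\<kappa> w))"
  shows "entropy_pmf (bind_pmf q (\<lambda>w. map_pmf (Pair w) (\<kappa> w))) (\<lambda>s. (V (fst s) (snd s), fst s))
    = entropy_pmf (bind_pmf q (\<lambda>w. map_pmf (Pair w) (\<kappa> w))) fst
      + EV q (\<lambda>w. entropy_pmf (\<kappa> w) (V w))"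
proof -
  let ?j = "bind_pmf q (\<lambda>w. map_pmf (Pair w) (\<kappa> w))"
  have "map_pmf fst ?j = q"
    by (simp add: map_bind_pmf map_pmf_comp bind_return_pmf')
  moreover have "finite (set_pmf ?j)" using assms by auto
  ultimately have "entropy_pmf q (\<lambda>w. w) = entropy_pmf ?j fst"
    using entropy_pmf_map[of ?j fst "\<lambda>w. w"] by simp
  then show ?thesis using entropy_mixture[of q \<kappa> V, OF assms] by (simp add: case_prod_beta')
qed

text \<open>Every conditional entropy given \<open>W\<close> is an average of entropies under the
  product laws, hence linear in the law of \<open>W\<close>. Convexity and the cardinality bound
  rest on this.\<close>

lemma cond_entropy_joint:
  fixes V :: "'x1 \<times> 'x2 \<Rightarrow> 'v" and U :: "'x1 \<times> 'x2 \<Rightarrow> 'u"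
  assumes "finite (set_pmf pW)" "\<And>w. w \<in> set_pmf pW \<Longrightarrow> finite (set_pmf (pair_pmf (p1 w) (p2 w)))"
  shows "entropy_pmf (joint_pmf pW p1 p2) (\<lambda>s. (V (snd s), fst s)) - entropy_pmf (joint_pmf pW p1 p2) fst
      = EV pW (\<lambda>w. entropy_pmf (pair_pmf (p1 w) (p2 w)) V)" (is ?t1)
    and "entropy_pmf (joint_pmf pW p1 p2) (\<lambda>s. (V (snd s), (U (snd s), fst s)))
         - entropy_pmf (joint_pmf pW p1 p2) (\<lambda>s. (U (snd s), fst s))
      = EV pW (\<lambda>w. entropy_pmf (pair_pmf (p1 w) (p2 w)) (\<lambda>x. (V x, U x))
           - entropy_pmf (pair_pmf (p1 w) (p2 w)) U)" (is ?t2)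
proof -
  let ?j = "joint_pmf pW p1 p2"
  have fj: "finite (set_pmf ?j)" using assms by (auto simp: joint_pmf_def simp del: set_pair_pmf)
  note m = entropy_mixture'[of pW "\<lambda>w. pair_pmf (p1 w) (p2 w)", OF assms, folded joint_pmf_def]
  show ?t1 using m[of "\<lambda>_. V"] by simp
  have "entropy_pmf ?j (\<lambda>s. (V (snd s), (U (snd s), fst s))) = entropy_pmf ?j (\<lambda>s. ((V (snd s), U (snd s)), fst s))"
    by (rule entropy_eq[OF fj]) (auto simp: determines_def)
  then show ?t2 using m[of "\<lambda>_ x. (V x, U x)"] m[of "\<lambda>_. U"] assms(1)
    by (subst Bochner_Integration.integral_diff) auto
qed

text \<open>Concavity is \<open>H(V|W) \<le> H(V)\<close> with the mixture index as
  \<open>W\<close>; dropping \<open>W\<close> is \<open>cond_entropy_reduces\<close> with the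
  trivial variable \<open>()\<close>.\<close>

lemma entropy_concave:
  assumes fq: "finite (set_pmf q)" and fk: "\<And>w. w \<in> set_pmf q \<Longrightarrow> finite (set_pmf (\<kappa> w))"
  shows "EV q (\<lambda>w. entropy_pmf (\<kappa> w) V) \<le> entropy_pmf (bind_pmf q \<kappa>) V"
proof -
  let ?j = "bind_pmf q (\<lambda>w. map_pmf (Pair w) (\<kappa> w))"
  have fj: "finite (set_pmf ?j)" using assms by auto
  have "EV q (\<lambda>w. entropy_pmf (\<kappa> w) V)
      = entropy_pmf ?j (\<lambda>s. (V (snd s), fst s)) - entropy_pmf ?j fst"
    using entropy_mixture'[of q \<kappa> "\<lambda>_. V", OF assms] by simp
  also have "\<dots> \<le> entropy_pmf ?j (\<lambda>s. (V (snd s), ())) - entropy_pmf ?j (\<lambda>s. ())"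
    by (rule cond_entropy_reduces[OF fj]) (simp add: determines_def)
  also have "\<dots> \<le> entropy_pmf ?j (\<lambda>s. V (snd s))"
    using entropy_eq[OF fj, of "\<lambda>s. V (snd s)" "\<lambda>s. (V (snd s), ())"] entropy_pmf_nonneg[OF fj, of "\<lambda>s. ()"]
    by (simp add: determines_def)
  also have "\<dots> = entropy_pmf (map_pmf snd ?j) V"
    using fj by (simp add: entropy_pmf_map)
  also have "map_pmf snd ?j = bind_pmf q \<kappa>" by (simp add: map_bind_pmf map_pmf_comp)
  finally show ?thesis .
qed

lemma entropy_cong_map:
  assumes "finite (set_pmf p)" "finite (set_pmf q)" "map_pmf X p = map_pmf Y q"
  shows "entropy_pmf p X = entropy_pmf q Y"
  using assms entropy_pmf_map[of p X "\<lambda>x. x"] entropy_pmf_map[of q Y "\<lambda>x. x"] by simp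

text \<open>A linear programme in standard form has an optimal solution supported on at most as many
  indices as there are equality constraints.  The functional \<open>s\<close> expresses that the
  normalisation of the weights is among the constraints, which makes the feasible set bounded.\<close>

lemma support_reduction:
  fixes v :: "'w \<Rightarrow> 'e::euclidean_space" and a :: "'w \<Rightarrow> real"
  assumes fin: "finite S" and lin: "linear s" and s1: "\<And>w. s (v w) = (1::real)"
    and q0: "\<And>w. 0 \<le> q w" and supp: "{w. q w \<noteq> 0} \<subseteq> S"
  shows "\<exists>q'. (\<forall>w. 0 \<le> q' w) \<and> {w. q' w \<noteq> 0} \<subseteq> S \<and> card {w. q' w \<noteq> 0} \<le> DIM('e) \<and>
    (\<Sum>w\<in>S. q' w *\<^sub>R v w) = (\<Sum>w\<in>S. q w *\<^sub>R v w) \<and> (\<Sum>w\<in>S. q w * a w) \<le> (\<Sum>w\<in>S. q' w * a w)"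
  using q0 supp
proof (induction "card {w. q w \<noteq> 0}" arbitrary: q rule: less_induct)
  case less
  let ?Q = "{w. q w \<noteq> 0}"
  have fQ: "finite ?Q" using less.prems(2) fin by (rule finite_subset)
  show ?case
  proof (cases "card ?Q \<le> DIM('e)")
    case True
    then show ?thesis using less.prems by (intro exI[of _ q]) auto
  next
    case False
    \<comment> \<open>A linear relation among the vectors. If two indices carry the same vector, the
      set of vectors may be too small to be dependent, so the relation is taken between these two
      indices.\<close>
    obtain u where u0: "\<And>w. w \<notin> ?Q \<Longrightarrow> u w = 0" and uv: "(\<Sum>w\<in>?Q. u w *\<^sub>R v w) = 0" and une: "\<exists>w\<in>?Q. u w \<noteq> (0::real)"
    proof (cases "inj_on v ?Q")
      case True
      then have "card (v ` ?Q) > DIM('e)" using False by (simp add: card_image)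
      then have "dependent (v ` ?Q)" using independent_bound[of "v ` ?Q"] by auto
      then obtain c where c: "\<exists>x\<in>v ` ?Q. c x \<noteq> 0" "(\<Sum>x\<in>v ` ?Q. c x *\<^sub>R x) = 0"
        using fQ by (auto simp: dependent_finite)
      show thesis
      proof (rule that[of "\<lambda>w. if w \<in> ?Q then c (v w) else 0"])
        show "(\<Sum>w\<in>?Q. (if w \<in> ?Q then c (v w) else 0) *\<^sub>R v w) = 0"
          using c(2) True by (simp add: sum.reindex)
      qed (use c(1) in auto)
    next
      case False
      then obtain w1 w2 where w: "w1 \<in> ?Q" "w2 \<in> ?Q" "w1 \<noteq> w2" "v w1 = v w2" by (auto simp: inj_on_def)
      show thesis
      proof (rule that[of "\<lambda>w. if w = w1 then 1 else if w = w2 then - 1 else 0"])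
        have "(\<Sum>w\<in>?Q. (if w = w1 then 1 else if w = w2 then - 1 else 0) *\<^sub>R v w)
          = (\<Sum>w\<in>{w1, w2}. (if w = w1 then 1 else if w = w2 then - 1 else 0) *\<^sub>R v w)"
          using w fQ by (intro sum.mono_neutral_right) auto
        then show "(\<Sum>w\<in>?Q. (if w = w1 then 1 else if w = w2 then - 1 else 0) *\<^sub>R v w) = 0" using w by simp
      qed (use w in auto)
    qed
    \<comment> \<open>The relation is given the sign that does not decrease the objective.\<close>
    obtain c where c0: "\<And>w. w \<notin> ?Q \<Longrightarrow> c w = 0" and cv: "(\<Sum>w\<in>?Q. c w *\<^sub>R v w) = 0" and cne: "\<exists>w\<in>?Q. c w \<noteq> (0::real)"
      and ca: "0 \<le> (\<Sum>w\<in>?Q. c w * a w)"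
    proof (cases "0 \<le> (\<Sum>w\<in>?Q. u w * a w)")
      case True then show thesis using that[of u] u0 uv une by blast
    next
      case False
      then show thesis using that[of "\<lambda>w. - u w"] u0 uv une by (simp add: sum_negf)
    qed
    have "s (\<Sum>w\<in>?Q. c w *\<^sub>R v w) = (\<Sum>w\<in>?Q. c w)" using lin s1 by (simp add: linear_sum linear_scale)
    then have c_sum: "(\<Sum>w\<in>?Q. c w) = 0" using cv lin by (simp add: linear_0)
    \<comment> \<open>The coefficients add up to zero without all vanishing, so the move along
      \<open>c\<close> must meet the boundary.\<close>
    have neg: "\<exists>w\<in>?Q. c w < 0"
    proof (rule ccontr)
      assume "\<not> ?thesis"
      then have "\<forall>w\<in>?Q. 0 \<le> c w" by (auto simp: not_less)
      then have "\<forall>w\<in>?Q. c w = 0" using sum_nonneg_eq_0_iff[OF fQ, of c] c_sum by blast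
      then show False using cne by blast
    qed
    let ?N = "{w\<in>?Q. c w < 0}"
    \<comment> \<open>The largest step that keeps all weights nonnegative. At the minimiser
      \<open>w0\<close> the weight drops to zero, so the support shrinks.\<close>
    define \<theta> where "\<theta> = Min ((\<lambda>w. q w / - c w) ` ?N)"
    have fN: "finite ?N" "?N \<noteq> {}" using fQ neg by auto
    have th_le: "\<theta> \<le> q w / - c w" if "w \<in> ?N" for w
      unfolding \<theta>_def using fN that by (intro Min_le) auto
    have "\<theta> \<in> (\<lambda>w. q w / - c w) ` ?N" unfolding \<theta>_def using fN by (intro Min_in) auto
    then obtain w0 where w0: "w0 \<in> ?N" "\<theta> = q w0 / - c w0" by blast
    have th0: "0 \<le> \<theta>" using w0 less.prems(1)[of w0] by (auto simp: divide_nonneg_neg intro!: divide_nonneg_neg)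
    define q1 where "q1 = (\<lambda>w. q w + \<theta> * c w)"
    have q1n: "0 \<le> q1 w" for w
    proof (cases "c w < 0")
      case True
      then have "w \<in> ?N" using c0 by force
      then show ?thesis using th_le[of w] True by (simp add: q1_def field_simps)
    next
      case False then show ?thesis using less.prems(1) th0 by (simp add: q1_def)
    qed
    have z: "q1 w0 = 0" using w0 by (simp add: q1_def)
    have "{w. q1 w \<noteq> 0} \<subseteq> ?Q" using c0 by (force simp: q1_def)
    moreover have "w0 \<in> ?Q" "w0 \<notin> {w. q1 w \<noteq> 0}" using w0(1) z by auto
    ultimately have sub: "{w. q1 w \<noteq> 0} \<subset> ?Q" by blast
    have QS: "(\<Sum>w\<in>S. c w *\<^sub>R v w) = 0" "0 \<le> (\<Sum>w\<in>S. c w * a w)"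
      using cv ca c0 less.prems(2) fin
        sum.mono_neutral_right[of S ?Q "\<lambda>w. c w *\<^sub>R v w"] sum.mono_neutral_right[of S ?Q "\<lambda>w. c w * a w"] by auto
    obtain q' where q': "\<forall>w. 0 \<le> q' w" "{w. q' w \<noteq> 0} \<subseteq> S" "card {w. q' w \<noteq> 0} \<le> DIM('e)"
      "(\<Sum>w\<in>S. q' w *\<^sub>R v w) = (\<Sum>w\<in>S. q1 w *\<^sub>R v w)" "(\<Sum>w\<in>S. q1 w * a w) \<le> (\<Sum>w\<in>S. q' w * a w)"
      using less.hyps[OF psubset_card_mono[OF fQ sub] q1n] sub less.prems(2) by blast
    have "(\<Sum>w\<in>S. q1 w *\<^sub>R v w) = (\<Sum>w\<in>S. q w *\<^sub>R v w) + \<theta> *\<^sub>R (\<Sum>w\<in>S. c w *\<^sub>R v w)"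
      by (simp add: q1_def scaleR_add_left sum.distrib scaleR_sum_right)
    then have "(\<Sum>w\<in>S. q' w *\<^sub>R v w) = (\<Sum>w\<in>S. q w *\<^sub>R v w)" using q'(4) QS(1) by simp
    moreover have "(\<Sum>w\<in>S. q1 w * a w) = (\<Sum>w\<in>S. q w * a w) + \<theta> * (\<Sum>w\<in>S. c w * a w)"
      by (simp add: q1_def distrib_right sum.distrib sum_distrib_left mult.assoc)
    then have "(\<Sum>w\<in>S. q w * a w) \<le> (\<Sum>w\<in>S. q' w * a w)"
      using q'(5) mult_nonneg_nonneg[OF th0 QS(2)] by linarith
    ultimately show ?thesis using q'(1-3) by blast
  qed
qed

section \<open>The single-letter region\<close>

abbreviation law :: "('w \<Rightarrow> 'a pmf) \<Rightarrow> ('w \<Rightarrow> 'b pmf) \<Rightarrow> 'w \<Rightarrow> ('a \<times> 'b) pmf" where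
  "law p1 p2 \<equiv> (\<lambda>w. pair_pmf (p1 w) (p2 w))"

abbreviation mean :: "(('a \<times> 'b) pmf \<Rightarrow> real) \<Rightarrow> 'w pmf \<Rightarrow> ('w \<Rightarrow> 'a pmf) \<Rightarrow> ('w \<Rightarrow> 'b pmf) \<Rightarrow> real" where
  "mean h pW p1 p2 \<equiv> EV pW (\<lambda>w. h (pair_pmf (p1 w) (p2 w)))"

locale z_channel =
  fixes y1 :: "'x1::finite \<Rightarrow> 'y1::finite"
    and t1 :: "'x1 \<Rightarrow> 't1::finite"
    and y2 :: "'x2::finite \<Rightarrow> 't1 \<Rightarrow> 'y2::finite"
    and z2 :: "'x2 \<Rightarrow> 'z2::finite"
begin

definition Y1 :: "'x1 \<times> 'x2 \<Rightarrow> 'y1" where "Y1 = (\<lambda>(a, b). y1 a)"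
definition T1 :: "'x1 \<times> 'x2 \<Rightarrow> 't1" where "T1 = (\<lambda>(a, b). t1 a)"
definition Y2 :: "'x1 \<times> 'x2 \<Rightarrow> 'y2" where "Y2 = (\<lambda>(a, b). y2 b (t1 a))"
definition Z2 :: "'x1 \<times> 'x2 \<Rightarrow> 'z2" where "Z2 = (\<lambda>(a, b). z2 b)"
definition YZ :: "'x1 \<times> 'x2 \<Rightarrow> 'y2 \<times> 'z2" where "YZ = (\<lambda>s. (Y2 s, Z2 s))"

text \<open>For the law \<open>r\<close> of \<open>(X1, X2)\<close> given a value of \<open>W\<close>:
  \<open>hA\<close>, \<open>hB\<close>, \<open>hC\<close>, \<open>hD\<close> are the contributions of this value to
  \<open>H(Y1|W)\<close>, \<open>H(Y2,Z2|T1,W)\<close>, \<open>H(Y1|T1,W)\<close> and \<open>H(Y2,Z2|W)\<close>.\<close>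

definition hA :: "('x1 \<times> 'x2) pmf \<Rightarrow> real" where
  "hA r = entropy_pmf r Y1"
definition hB :: "('x1 \<times> 'x2) pmf \<Rightarrow> real" where
  "hB r = entropy_pmf r (\<lambda>s. (YZ s, T1 s)) - entropy_pmf r T1"
definition hC :: "('x1 \<times> 'x2) pmf \<Rightarrow> real" where
  "hC r = entropy_pmf r (\<lambda>s. (Y1 s, T1 s)) - entropy_pmf r T1"
definition hD :: "('x1 \<times> 'x2) pmf \<Rightarrow> real" where
  "hD r = entropy_pmf r YZ"

abbreviation H2 :: "'w pmf \<Rightarrow> ('w \<Rightarrow> 'x1 pmf) \<Rightarrow> ('w \<Rightarrow> 'x2 pmf) \<Rightarrow> real" where
  "H2 pW p1 p2 \<equiv> entropy_pmf (bind_pmf pW (law p1 p2)) Y2"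

definition in_bounds :: "'w pmf \<Rightarrow> ('w \<Rightarrow> ('x1 \<times> 'x2) pmf) \<Rightarrow> real \<Rightarrow> real \<Rightarrow> bool" where
  "in_bounds pW r R1 R2 \<longleftrightarrow>
     R1 \<le> EV pW (\<lambda>w. hA (r w)) \<and>
     R2 \<le> min (entropy_pmf (bind_pmf pW r) Y2) (EV pW (\<lambda>w. hB (r w))) \<and>
     R1 + R2 \<le> EV pW (\<lambda>w. hC (r w)) +
       min (entropy_pmf (bind_pmf pW r) Y2) (EV pW (\<lambda>w. hD (r w)))"

lemma in_bounds_iff:
  "in_bounds pW r R1 R2 \<longleftrightarrow>
     R1 \<le> EV pW (\<lambda>w. hA (r w)) \<and>
     R2 \<le> entropy_pmf (bind_pmf pW r) Y2 \<and>
     R2 \<le> EV pW (\<lambda>w. hB (r w)) \<and>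
     R1 + R2 \<le> EV pW (\<lambda>w. hC (r w)) + entropy_pmf (bind_pmf pW r) Y2 \<and>
     R1 + R2 \<le> EV pW (\<lambda>w. hC (r w)) + EV pW (\<lambda>w. hD (r w))"
  unfolding in_bounds_def by auto

lemma finite_supp: "finite (set_pmf (p :: 'a::finite pmf))"
  by (rule finite_subset[OF subset_UNIV]) simp

lemma satisfies_bounds_iff:
  fixes pW :: "'w::countable pmf"
  assumes fin: "finite (set_pmf pW)"
  shows "satisfies_bounds y1 t1 y2 z2 (joint_pmf pW p1 p2) (R1, R2)
    \<longleftrightarrow> in_bounds pW (law p1 p2) R1 R2"
proof -
  let ?j = "joint_pmf pW p1 p2"
  have fj: "finite (set_pmf ?j)" using fin finite_supp by (auto simp: joint_pmf_def)
  have maps: "(\<lambda>(w, x1, x2). w) = (fst :: 'w \<times> 'x1 \<times> 'x2 \<Rightarrow> 'w)"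
    "(\<lambda>(w, x1, x2). t1 x1) = (\<lambda>s :: 'w \<times> 'x1 \<times> 'x2. T1 (snd s))"
    "(\<lambda>(w, x1, x2). y1 x1) = (\<lambda>s :: 'w \<times> 'x1 \<times> 'x2. Y1 (snd s))"
    "(\<lambda>(w, x1, x2). y2 x2 (t1 x1)) = (\<lambda>s :: 'w \<times> 'x1 \<times> 'x2. Y2 (snd s))"
    "(\<lambda>(w, x1, x2). z2 x2) = (\<lambda>s :: 'w \<times> 'x1 \<times> 'x2. Z2 (snd s))"
    by (auto simp: fun_eq_iff T1_def Y1_def Y2_def Z2_def)
  have j: "map_pmf snd ?j = bind_pmf pW (law p1 p2)"
    by (simp add: joint_pmf_def map_bind_pmf map_pmf_comp)
  have "entropy_pmf ?j (\<lambda>s. Y2 (snd s)) = H2 pW p1 p2"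
    unfolding j[symmetric] using fj by (simp add: entropy_pmf_map)
  then show ?thesis
    unfolding satisfies_bounds_def Let_def prod.case maps in_bounds_def hA_def hB_def hC_def hD_def
    by (simp add: cond_entropy_pmf_eq_diff[OF fj] cond_entropy_joint fin finite_supp YZ_def
          cond_entropy_joint(1)[where V="\<lambda>s. (Y2 s, Z2 s)"] cond_entropy_joint(2)[where V="\<lambda>s. (Y2 s, Z2 s)"])
qed

section \<open>The region over all finite alphabets, its convexity and the cardinality bound\<close>

lemma rate_region_iff:
  assumes "finite A"
  shows "(R1, R2) \<in> rate_region y1 t1 y2 z2 A \<longleftrightarrow> 0 \<le> R1 \<and> 0 \<le> R2 \<and>
    (\<exists>pW p1 p2. set_pmf pW \<subseteq> A \<and> in_bounds pW (law p1 p2) R1 R2)"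
proof -
  have "satisfies_bounds y1 t1 y2 z2 (joint_pmf pW p1 p2) (R1, R2)
    \<longleftrightarrow> in_bounds pW (law p1 p2) R1 R2" if "set_pmf pW \<subseteq> A" for pW p1 p2
    using finite_subset[OF that assms] by (rule satisfies_bounds_iff)
  then show ?thesis unfolding rate_region_def mem_Collect_eq prod.case by blast
qed

text \<open>Only the number of values of \<open>W\<close> matters: an injection of the support into
  \<open>{..<k}\<close> renames them. This admits auxiliary variables such as a pair of a time and a
  word.\<close>

lemma in_rate_regionI:
  fixes pW :: "'w pmf"
  assumes b: "in_bounds pW (law p1 p2) R1 R2" and "0 \<le> R1" "0 \<le> R2"
    and fin: "finite (set_pmf pW)" "card (set_pmf pW) \<le> k"
  shows "(R1, R2) \<in> rate_region y1 t1 y2 z2 {..<k}"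
proof -
  obtain f :: "'w \<Rightarrow> nat" where f: "f ` set_pmf pW \<subseteq> {..<k}" "inj_on f (set_pmf pW)"
    using fin card_le_inj[of "set_pmf pW" "{..<k}"] by auto
  let ?g = "inv_into (set_pmf pW) f"
  have E: "EV (map_pmf f pW) (\<lambda>w. h (pair_pmf (p1 (?g w)) (p2 (?g w))))
     = mean h pW p1 p2" for h :: "_ \<Rightarrow> real"
    unfolding integral_map_pmf by (intro EV_cong refl) (simp add: f)
  have B: "bind_pmf (map_pmf f pW) (\<lambda>w. pair_pmf (p1 (?g w)) (p2 (?g w))) = bind_pmf pW (law p1 p2)"
    unfolding bind_map_pmf by (intro bind_pmf_cong refl) (simp add: f)
  have "in_bounds (map_pmf f pW) (\<lambda>w. pair_pmf (p1 (?g w)) (p2 (?g w))) R1 R2"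
    using b unfolding in_bounds_def E B .
  then show ?thesis
    unfolding rate_region_iff[OF finite_lessThan] using f assms(2,3)
    by (intro conjI exI[of _ "map_pmf f pW"] exI[of _ "\<lambda>w. p1 (?g w)"] exI[of _ "\<lambda>w. p2 (?g w)"]) auto
qed

definition region :: "(real \<times> real) set" where
  "region = (\<Union>k. rate_region y1 t1 y2 z2 {..<k})"

lemma region_iff:
  "(R1, R2) \<in> region \<longleftrightarrow> 0 \<le> R1 \<and> 0 \<le> R2 \<and>
    (\<exists>(pW :: nat pmf) p1 p2. finite (set_pmf pW) \<and> in_bounds pW (law p1 p2) R1 R2)"
proof (intro iffI)
  assume "(R1, R2) \<in> region"
  then obtain k where "(R1, R2) \<in> rate_region y1 t1 y2 z2 {..<k}" unfolding region_def by blast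
  then have "0 \<le> R1 \<and> 0 \<le> R2 \<and> (\<exists>pW p1 p2. set_pmf pW \<subseteq> {..<k} \<and>
      in_bounds pW (law p1 p2) R1 R2)"
    by (simp only: rate_region_iff[OF finite_lessThan])
  then show "0 \<le> R1 \<and> 0 \<le> R2 \<and>
    (\<exists>(pW :: nat pmf) p1 p2. finite (set_pmf pW) \<and> in_bounds pW (law p1 p2) R1 R2)"
    by (meson finite_lessThan finite_subset)
next
  assume "0 \<le> R1 \<and> 0 \<le> R2 \<and>
    (\<exists>(pW :: nat pmf) p1 p2. finite (set_pmf pW) \<and> in_bounds pW (law p1 p2) R1 R2)"
  then obtain pW :: "nat pmf" and p1 p2 where "finite (set_pmf pW)"
    "in_bounds pW (law p1 p2) R1 R2" "0 \<le> R1" "0 \<le> R2" by (elim conjE exE)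
  then show "(R1, R2) \<in> region" unfolding region_def using in_rate_regionI[OF _ _ _ _ order_refl] by blast
qed

lemma regionI:
  fixes pW :: "'w pmf"
  assumes "in_bounds pW (law p1 p2) R1 R2" "0 \<le> R1" "0 \<le> R2" "finite (set_pmf pW)"
  shows "(R1, R2) \<in> region"
  unfolding region_def using in_rate_regionI[OF assms order_refl] by blast

text \<open>A coin with bias \<open>u\<close> is adjoined to \<open>W\<close>. The four conditional
  entropies become exact mixtures, and the entropy of \<open>Y2\<close> is at least the mixture by
  concavity, which is the favourable direction in every bound.\<close>

lemma convex_region: "convex region"
proof (rule convexI)
  fix x y :: "real \<times> real" and u v :: real
  assume x: "x \<in> region" and y: "y \<in> region" and uv: "0 \<le> u" "0 \<le> v" "u + v = 1"
  obtain R1 R2 S1 S2 where xy: "x = (R1, R2)" "y = (S1, S2)" by fastforce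
  obtain pW p1 p2 where p: "finite (set_pmf (pW :: nat pmf))" "in_bounds pW (law p1 p2) R1 R2"
    and R: "0 \<le> R1" "0 \<le> R2" using x by (auto simp: xy region_iff)
  obtain qW q1 q2 where q: "finite (set_pmf (qW :: nat pmf))" "in_bounds qW (law q1 q2) S1 S2"
    and S: "0 \<le> S1" "0 \<le> S2" using y by (auto simp: xy region_iff)
  define B where "B = bernoulli_pmf u"
  define r where "r = (\<lambda>b. if b then pW else qW)"
  define m1 where "m1 = (\<lambda>(b, w). if b then p1 w else q1 w)"
  define m2 where "m2 = (\<lambda>(b, w). if b then p2 w else q2 w)"
  define W where "W = bind_pmf B (\<lambda>b. map_pmf (Pair b) (r b))"
  have u1: "u \<le> 1" "v = 1 - u" using uv by auto
  have fr: "finite (set_pmf (r b))" for b using p q by (simp add: r_def)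
  have fB: "finite (set_pmf B)" by (rule finite_supp)
  have E: "mean h W m1 m2 =
     u * mean h pW p1 p2 +
     v * mean h qW q1 q2" for h :: "_ \<Rightarrow> real"
    unfolding W_def using fr fB uv(1) u1
    by (subst EV_bind) (auto simp: B_def r_def m1_def m2_def)
  let ?P = "bind_pmf pW (law p1 p2)" and ?Q = "bind_pmf qW (law q1 q2)"
  have bw: "bind_pmf W (law m1 m2) = bind_pmf B (\<lambda>b. if b then ?P else ?Q)"
    unfolding W_def bind_assoc_pmf bind_map_pmf r_def m1_def m2_def by (intro bind_pmf_cong) auto
  have "EV B (\<lambda>b. entropy_pmf (if b then ?P else ?Q) Y2) \<le>
     H2 W m1 m2" unfolding bw
    by (rule entropy_concave) (auto intro: finite_supp)
  then have H: "u * entropy_pmf ?P Y2 + v * entropy_pmf ?Q Y2 \<le> H2 W m1 m2"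
    using uv(1) u1 by (simp add: B_def mult.commute)
  have comb: "u * a + v * b \<le> u * a' + v * b'" if "a \<le> a'" "b \<le> b'" for a b a' b' :: real
    using that uv by (intro add_mono mult_left_mono)
  have "in_bounds W (law m1 m2) (u * R1 + v * S1) (u * R2 + v * S2)"
    unfolding in_bounds_iff E
  proof (intro conjI)
    note pb = p(2)[unfolded in_bounds_iff] and qb = q(2)[unfolded in_bounds_iff]
    let ?e = "\<lambda>h. u * mean h pW p1 p2 +
     v * mean h qW q1 q2"
    show "u * R1 + v * S1 \<le> ?e hA" "u * R2 + v * S2 \<le> ?e hB"
      using pb qb by (intro comb; simp)+
    have "u * R2 + v * S2 \<le> u * entropy_pmf ?P Y2 + v * entropy_pmf ?Q Y2"
      using pb qb by (intro comb) auto
    with H show "u * R2 + v * S2 \<le> H2 W m1 m2" by linarith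
    have *: "u * R1 + v * S1 + (u * R2 + v * S2) = u * (R1 + R2) + v * (S1 + S2)" by (simp add: algebra_simps)
    have "u * (R1 + R2) + v * (S1 + S2) \<le> u * (mean hC pW p1 p2 + entropy_pmf ?P Y2)
       + v * (mean hC qW q1 q2 + entropy_pmf ?Q Y2)"
      using pb qb by (intro comb) auto
    then show "u * R1 + v * S1 + (u * R2 + v * S2) \<le> ?e hC + H2 W m1 m2"
      using H unfolding * distrib_left by linarith
    have "u * (R1 + R2) + v * (S1 + S2) \<le> u * (mean hC pW p1 p2 + mean hD pW p1 p2)
       + v * (mean hC qW q1 q2 + mean hD qW q1 q2)"
      using pb qb by (intro comb) auto
    then show "u * R1 + v * S1 + (u * R2 + v * S2) \<le> ?e hC + ?e hD"
      unfolding * distrib_left by linarith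
  qed
  moreover have "finite (set_pmf W)" unfolding W_def using fB fr by auto
  ultimately show "u *\<^sub>R x + v *\<^sub>R y \<in> region"
    using R S uv unfolding xy by (auto intro!: regionI)
qed

text \<open>\<open>hA\<close> enters only as an upper bound on \<open>R1\<close>, so its average may
  increase while the law of \<open>Y2\<close> and the averages of \<open>hB\<close>,
  \<open>hC\<close> and \<open>hD\<close> stay fixed.\<close>

lemma region_eq_bounded:
  "region = rate_region y1 t1 y2 z2 {..<CARD('y2) + 3}"
proof (intro equalityI subsetI)
  fix x assume "x \<in> rate_region y1 t1 y2 z2 {..<CARD('y2) + 3}"
  then show "x \<in> region" unfolding region_def by blast
next
  fix x assume x: "x \<in> region"
  obtain R1 R2 where xR: "x = (R1, R2)" by fastforce
  obtain pW p1 p2 where fin: "finite (set_pmf (pW :: nat pmf))"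
    and p: "in_bounds pW (law p1 p2) R1 R2" and R: "0 \<le> R1" "0 \<le> R2"
    using x unfolding xR region_iff by blast
  let ?r = "\<lambda>w. pair_pmf (p1 w) (p2 w)"
  define v :: "nat \<Rightarrow> (real^'y2) \<times> real \<times> real \<times> real" where
    "v = (\<lambda>w. (\<chi> y. pmf (map_pmf Y2 (?r w)) y, hB (?r w), hC (?r w), hD (?r w)))"
  have E: "EV pW f = (\<Sum>w\<in>set_pmf pW. pmf pW w * f w)" for f :: "nat \<Rightarrow> real"
    using fin by (rule EV_finite)
  \<comment> \<open>The law of \<open>Y2\<close> sums to one, so its coordinates already contain the
    normalisation; with \<open>hB\<close>, \<open>hC\<close> and \<open>hD\<close> the dimension is
    \<open>CARD('y2) + 3\<close>.\<close>
  define s :: "(real^'y2) \<times> real \<times> real \<times> real \<Rightarrow> real" where "s = (\<lambda>e. \<Sum>y\<in>UNIV. fst e $ y)"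
  have lin: "linear s" unfolding s_def
    by (rule linearI) (simp_all add: sum.distrib sum_distrib_left)
  have s1: "s (v w) = 1" for w
    unfolding s_def v_def using sum_pmf_eq_1[of UNIV "map_pmf Y2 (?r w)"] by simp
  obtain q where q: "\<And>w. 0 \<le> q w" "{w. q w \<noteq> 0} \<subseteq> set_pmf pW"
      "card {w. q w \<noteq> 0} \<le> DIM((real^'y2) \<times> real \<times> real \<times> real)"
    and qv: "(\<Sum>w\<in>set_pmf pW. q w *\<^sub>R v w) = (\<Sum>w\<in>set_pmf pW. pmf pW w *\<^sub>R v w)"
    and qa: "(\<Sum>w\<in>set_pmf pW. pmf pW w * hA (?r w)) \<le> (\<Sum>w\<in>set_pmf pW. q w * hA (?r w))"
  proof -
    have *: "{w. pmf pW w \<noteq> 0} \<subseteq> set_pmf pW" by (auto simp: set_pmf_iff)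
    show thesis
      using support_reduction[where v=v and q="pmf pW" and a="\<lambda>w. hA (?r w)", OF fin lin s1 pmf_nonneg *]
      by (elim exE conjE) (rule that, erule spec, assumption+)
  qed
  have sq: "(\<Sum>w\<in>set_pmf pW. q w) = 1"
  proof -
    have "s (\<Sum>w\<in>set_pmf pW. q w *\<^sub>R v w) = (\<Sum>w\<in>set_pmf pW. q w)"
      using lin s1 by (simp add: linear_sum linear_scale)
    moreover have "s (\<Sum>w\<in>set_pmf pW. pmf pW w *\<^sub>R v w) = (\<Sum>w\<in>set_pmf pW. pmf pW w)"
      using lin s1 by (simp add: linear_sum linear_scale)
    ultimately show ?thesis using qv fin by (simp add: sum_pmf_eq_1)
  qed
  define qW where "qW = embed_pmf q"
  have pq: "pmf qW w = q w" for w unfolding qW_def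
  proof (rule pmf_embed_pmf)
    have "(\<integral>\<^sup>+ x. ennreal (q x) \<partial>count_space UNIV) = (\<Sum>x\<in>set_pmf pW. ennreal (q x))"
      using q by (subst nn_integral_count_space'[OF fin]) auto
    also have "\<dots> = 1" using q sq by (subst sum_ennreal) auto
    finally show "(\<integral>\<^sup>+ x. ennreal (q x) \<partial>count_space UNIV) = 1" .
  qed (use q in auto)
  have supp: "set_pmf qW = {w. q w \<noteq> 0}" by (auto simp: set_pmf_iff pq)
  have fq: "finite (set_pmf qW)" using q(2) fin unfolding supp by (rule finite_subset)
  have Eq: "EV qW f = (\<Sum>w\<in>set_pmf pW. q w * f w)" for f :: "nat \<Rightarrow> real"
    using q(2) fin fq by (subst integral_measure_pmf[of "set_pmf pW"]) (auto simp: pq set_pmf_iff)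
  have comp: "(\<Sum>w\<in>set_pmf pW. q w * f (v w)) = (\<Sum>w\<in>set_pmf pW. pmf pW w * f (v w))" if "linear f" for f
    using arg_cong[OF qv, of f] that by (simp add: linear_sum linear_scale)
  have B: "EV qW (\<lambda>w. hB (?r w)) = EV pW (\<lambda>w. hB (?r w))"
    unfolding E Eq using comp[of "\<lambda>e. fst (snd e)"] by (auto simp: v_def linear_iff)
  have C: "EV qW (\<lambda>w. hC (?r w)) = EV pW (\<lambda>w. hC (?r w))"
    unfolding E Eq using comp[of "\<lambda>e. fst (snd (snd e))"] by (auto simp: v_def linear_iff)
  have D: "EV qW (\<lambda>w. hD (?r w)) = EV pW (\<lambda>w. hD (?r w))"
    unfolding E Eq using comp[of "\<lambda>e. snd (snd (snd e))"] by (auto simp: v_def linear_iff)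
  have "map_pmf Y2 (bind_pmf qW ?r) = map_pmf Y2 (bind_pmf pW ?r)"
  proof (rule pmf_eqI)
    fix y
    show "pmf (map_pmf Y2 (bind_pmf qW ?r)) y = pmf (map_pmf Y2 (bind_pmf pW ?r)) y"
      unfolding map_bind_pmf pmf_bind E Eq using comp[of "\<lambda>e. fst e $ y"] by (auto simp: v_def linear_iff)
  qed
  then have Y: "entropy_pmf (bind_pmf qW ?r) Y2 = entropy_pmf (bind_pmf pW ?r) Y2"
    by (intro entropy_cong_map) (auto intro: finite_supp)
  have "in_bounds qW ?r R1 R2"
    using p qa unfolding in_bounds_iff B C D Y by (auto simp: E Eq)
  moreover have "card (set_pmf qW) \<le> CARD('y2) + 3" using q(3) by (simp add: supp)
  ultimately show "x \<in> rate_region y1 t1 y2 z2 {..<CARD('y2) + 3}"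
    unfolding xR using R fq by (intro in_rate_regionI)
qed

end

section \<open>Fano's inequality, chain rule and time sharing\<close>

lemma fano_inequality:
  assumes fin: "finite (set_pmf p)" and A: "finite A" "M ` set_pmf p \<subseteq> A"
    and err: "PR p {s. g (Y s) \<noteq> M s} \<le> \<epsilon>"
    and K: "card A = 1 \<or> 1 \<le> \<epsilon> * log 2 (card A)"
  shows "entropy_pmf p (\<lambda>s. (M s, Y s)) - entropy_pmf p Y \<le> 2 * \<epsilon> * log 2 (card A)"
proof -
  have K0: "0 < card A" using assms set_pmf_not_empty[of p] by (auto simp: card_gt_0_iff)
  show ?thesis
  proof (cases "card A = 1")
    case True
    have "card (M ` set_pmf p) \<le> 1" using card_mono[OF A] True by simp
    then have "entropy_pmf p (\<lambda>s. (M s, Y s)) - entropy_pmf p Y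
      \<le> EV p (\<lambda>s. - log 2 ((\<lambda>_ _. 1) (M s) (Y s)))"
      by (intro cond_entropy_le_cross[OF fin]) auto
    then show ?thesis using True by simp
  next
    case False
    define K where "K = real (card A)"
    have K1: "1 \<le> K" using K0 by (simp add: K_def)
    \<comment> \<open>Half of the mass sits on the decoded value and half is uniform over
      \<open>card A\<close> values: the cost is at most one bit for a right decision and
      \<open>1 + log 2 K\<close> bits for a wrong one. The assumption on \<open>card A\<close>
      absorbs the one bit into a second \<open>\<epsilon> * log 2 (card A)\<close>.\<close>
    define r where "r = (\<lambda>x y. (if x = g y then 1/2 else 0) + 1 / (2 * K))"
    have "entropy_pmf p (\<lambda>s. (M s, Y s)) - entropy_pmf p Y
      \<le> EV p (\<lambda>s. - log 2 (r (M s) (Y s)))"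
    proof (rule cond_entropy_le_cross[OF fin])
      fix y
      have f: "finite (M ` set_pmf p)" using fin by simp
      have "(\<Sum>x\<in>M ` set_pmf p. if x = g y then 1/2 else 0 :: real) \<le> 1/2"
        using f by (simp add: sum.delta)
      moreover have "(\<Sum>x\<in>M ` set_pmf p. 1 / (2 * K)) \<le> 1/2"
      proof -
        have "(\<Sum>x\<in>M ` set_pmf p. 1 / (2 * K)) = real (card (M ` set_pmf p)) / (2 * K)" by simp
        also have "\<dots> \<le> K / (2 * K)" using K1 card_mono[OF A] by (intro divide_right_mono) (auto simp: K_def)
        finally show ?thesis using K1 by simp
      qed
      ultimately show "(\<Sum>x\<in>M ` set_pmf p. r x y) \<le> 1" unfolding r_def sum.distrib by linarith
    qed (use K1 in \<open>auto simp: r_def add_pos_pos\<close>)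
    also have "\<dots> \<le> EV p (\<lambda>s. 1 + log 2 K * indicator {s. g (Y s) \<noteq> M s} s)"
    proof (rule EV_mono[OF fin])
      fix s
      show "- log 2 (r (M s) (Y s)) \<le> 1 + log 2 K * indicator {s. g (Y s) \<noteq> M s} s"
      proof (cases "M s = g (Y s)")
        case True
        have "log 2 (1/2) \<le> log 2 (r (M s) (Y s))" using True K1 by (intro iffD2[OF log_le_cancel_iff]) (auto simp: r_def add_pos_pos)
        then show ?thesis using True by (simp add: log_divide)
      next
        case False
        then show ?thesis using K1 by (auto simp: r_def log_divide log_mult)
      qed
    qed
    also have "\<dots> = 1 + log 2 K * PR p {s. g (Y s) \<noteq> M s}"
      using fin by (subst Bochner_Integration.integral_add) auto
    also have "\<dots> \<le> 1 + log 2 K * \<epsilon>" using err K1 by (intro add_left_mono mult_left_mono) auto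
    finally show ?thesis using K False by (simp add: K_def algebra_simps)
  qed
qed

text \<open>The chain rule over letters, where the conditioning on the past and on \<open>C\<close>
  is weakened at each step to \<open>D i\<close>, a variable that they determine. The bounds of the
  converse differ in the choice of \<open>D\<close>.\<close>

lemma entropy_chain_le:
  assumes fin: "finite (set_pmf p)"
    and D: "\<And>i. i \<in> {1..n} \<Longrightarrow> determines (\<lambda>s. (map (\<lambda>j. v j s) [1..<i], C s)) (D i)"
  shows "entropy_pmf p (\<lambda>s. (map (\<lambda>j. v j s) [1..<Suc n], C s)) - entropy_pmf p C
    \<le> (\<Sum>i=1..n. entropy_pmf p (\<lambda>s. (v i s, D i s)) - entropy_pmf p (D i))"
  using D
proof (induction n)
  case 0
  show ?case using entropy_mono[OF fin, of C "\<lambda>s. (map (\<lambda>j. v j s) [1..<Suc 0], C s)"]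
    by (simp add: determines_def)
next
  case (Suc n)
  let ?V = "\<lambda>s. (map (\<lambda>j. v j s) [1..<Suc n], C s)"
  have "entropy_pmf p (\<lambda>s. (map (\<lambda>j. v j s) [1..<Suc (Suc n)], C s)) = entropy_pmf p (\<lambda>s. (v (Suc n) s, ?V s))"
    by (rule entropy_eq[OF fin]) (auto simp: determines_def)
  moreover have "entropy_pmf p (\<lambda>s. (v (Suc n) s, ?V s)) - entropy_pmf p ?V
    \<le> entropy_pmf p (\<lambda>s. (v (Suc n) s, D (Suc n) s)) - entropy_pmf p (D (Suc n))"
    using Suc.prems[of "Suc n"] by (intro cond_entropy_reduces[OF fin]) simp
  moreover have "entropy_pmf p ?V - entropy_pmf p C
    \<le> (\<Sum>i=1..n. entropy_pmf p (\<lambda>s. (v i s, D i s)) - entropy_pmf p (D i))"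
    using Suc.prems by (intro Suc.IH) simp
  ultimately show ?case by (simp add: sum.atLeast_Suc_atMost)
qed

lemma bind_cond_pmf_fibers: "bind_pmf p (\<lambda>x. cond_pmf p {y. g y = g x}) = p"
proof (rule bind_cond_pmf_cancel)
  fix x y assume "g y = g x"
  then show "PR p {y. g y = g x} = PR p {x. g y = g x}"
    by (intro arg_cong2[where f=measure]) auto
qed auto

text \<open>Once \<open>g x\<close> is fixed, a fresh point of its fibre reproduces the joint law of
  \<open>g x\<close> and \<open>x\<close>. In the converse this realises \<open>X2\<close> by a
  kernel given the past cribbing signal, independently of \<open>X1\<close>.\<close>

lemma bind_bind_cond_pmf_fibers:
  "bind_pmf p (\<lambda>x. bind_pmf (cond_pmf p {y. g y = g x}) (\<lambda>y. G (g x) y)) = bind_pmf p (\<lambda>x. G (g x) x)"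
proof -
  have ne: "set_pmf p \<inter> {y. g y = g x} \<noteq> {}" if "x \<in> set_pmf p" for x using that by auto
  have "bind_pmf p (\<lambda>x. bind_pmf (cond_pmf p {y. g y = g x}) (\<lambda>y. G (g x) y))
     = bind_pmf p (\<lambda>x. bind_pmf (cond_pmf p {y. g y = g x}) (\<lambda>y. G (g y) y))"
    using ne by (intro bind_pmf_cong refl) (auto simp: set_cond_pmf)
  also have "\<dots> = bind_pmf (bind_pmf p (\<lambda>x. cond_pmf p {y. g y = g x})) (\<lambda>y. G (g y) y)"
    by (simp add: bind_assoc_pmf)
  finally show ?thesis unfolding bind_cond_pmf_fibers .
qed

text \<open>With a uniform index from \<open>I\<close>, averages over letters are conditional
  entropies given that index. Without the index in the conditioning, concavity gives an inequality,
  in the direction that the bounds with \<open>H(Y2)\<close> need.\<close>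

lemma entropy_time_sharing:
  assumes fin: "finite (set_pmf p)" and fI: "finite I" "I \<noteq> {}"
  defines "P \<equiv> bind_pmf (pmf_of_set I) (\<lambda>i. map_pmf (Pair i) p)"
  shows "entropy_pmf P (\<lambda>s. (V (fst s) (snd s), (fst s, D (fst s) (snd s))))
      - entropy_pmf P (\<lambda>s. (fst s, D (fst s) (snd s)))
     = (\<Sum>i\<in>I. entropy_pmf p (\<lambda>m. (V i m, D i m)) - entropy_pmf p (D i)) / card I" (is ?t1)
    and "(\<Sum>i\<in>I. entropy_pmf p (V i)) / card I \<le> entropy_pmf P (\<lambda>s. V (fst s) (snd s))" (is ?t2)
proof -
  have fU: "finite (set_pmf (pmf_of_set I))" using fI by simp
  have fP: "finite (set_pmf P)" unfolding P_def using fI fin by auto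
  note m = entropy_mixture'[of "pmf_of_set I" "\<lambda>_. p", OF fU fin, folded P_def]
  have 1: "entropy_pmf P (\<lambda>s. (V (fst s) (snd s), (fst s, D (fst s) (snd s))))
    = entropy_pmf P (\<lambda>s. ((V (fst s) (snd s), D (fst s) (snd s)), fst s))"
    by (rule entropy_eq[OF fP]) (auto simp: determines_def)
  have 2: "entropy_pmf P (\<lambda>s. (fst s, D (fst s) (snd s))) = entropy_pmf P (\<lambda>s. (D (fst s) (snd s), fst s))"
    by (rule entropy_eq[OF fP]) (auto simp: determines_def)
  show ?t1 unfolding 1 2 m[of "\<lambda>i m. (V i m, D i m)"] m[of D]
    using fI by (simp add: integral_pmf_of_set sum_subtractf diff_divide_distrib)
  have "(\<Sum>i\<in>I. entropy_pmf p (V i)) / card I = EV (pmf_of_set I) (\<lambda>i. entropy_pmf (map_pmf (Pair i) p) (\<lambda>s. V (fst s) (snd s)))"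
    using fI fin by (simp add: integral_pmf_of_set entropy_pmf_map)
  also have "\<dots> \<le> entropy_pmf P (\<lambda>s. V (fst s) (snd s))"
    unfolding P_def using fU fin by (intro entropy_concave) auto
  finally show ?t2 .
qed

lemma entropy_uniform_pair:
  assumes "finite A" "A \<noteq> {}" "finite B" "B \<noteq> {}"
  defines "p \<equiv> pair_pmf (pmf_of_set A) (pmf_of_set B)"
  shows "entropy_pmf p fst = log 2 (card A)" "entropy_pmf p snd = log 2 (card B)"
    "entropy_pmf p (\<lambda>m. m) = log 2 (card A) + log 2 (card B)"
proof -
  have fin: "finite (set_pmf p)" unfolding p_def using assms by auto
  have c: "0 < card A" "0 < card B" using assms by (auto simp: card_gt_0_iff)
  have "entropy_pmf p fst = EV p (\<lambda>s. log 2 (card A))"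
    unfolding entropy_pmf_expectation[OF fin]
    by (intro EV_cong refl) (use assms c in \<open>auto simp: map_fst_pair_pmf p_def log_divide\<close>)
  then show "entropy_pmf p fst = log 2 (card A)" by simp
  have "entropy_pmf p snd = EV p (\<lambda>s. log 2 (card B))"
    unfolding entropy_pmf_expectation[OF fin]
    by (intro EV_cong refl) (use assms c in \<open>auto simp: map_snd_pair_pmf p_def log_divide\<close>)
  then show "entropy_pmf p snd = log 2 (card B)" by simp
  have "entropy_pmf p (\<lambda>m. m) = EV p (\<lambda>s. log 2 (card A) + log 2 (card B))"
    unfolding entropy_pmf_expectation[OF fin]
  proof (intro EV_cong refl)
    fix s assume "s \<in> set_pmf p"
    then have "pmf p s = 1 / (card A * card B)" using assms by (cases s) (auto simp: p_def pmf_pair)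
    then show "- log 2 (pmf (map_pmf (\<lambda>m. m) p) s) = log 2 (card A) + log 2 (card B)"
      using c by (simp add: log_divide log_mult)
  qed
  then show "entropy_pmf p (\<lambda>m. m) = log 2 (card A) + log 2 (card B)" by simp
qed

section \<open>Converse\<close>

text \<open>A single code of fixed length. \<open>large1\<close> and \<open>large2\<close> admit one
  message, the case of rate zero, and otherwise ask for enough messages to absorb the one bit of
  Fano's inequality.\<close>

locale z_code = z_channel y1 t1 y2 z2
  for y1 :: "'x1::finite \<Rightarrow> 'y1::finite"
    and t1 :: "'x1 \<Rightarrow> 't1::finite"
    and y2 :: "'x2::finite \<Rightarrow> 't1 \<Rightarrow> 'y2::finite"
    and z2 :: "'x2 \<Rightarrow> 'z2::finite" +
  fixes n :: nat and A1 A2 :: "nat set" and \<epsilon> :: real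
    and f1 :: "nat \<Rightarrow> nat \<Rightarrow> 'z2 list \<Rightarrow> 'x1" and f2 :: "nat \<Rightarrow> nat \<Rightarrow> 'x2"
    and g1 :: "'y1 list \<Rightarrow> nat" and g2 :: "'y2 list \<Rightarrow> nat"
  assumes injective: "\<And>x2. inj (y2 x2)"
    and n_pos: "0 < n"
    and A1: "finite A1" "A1 \<noteq> {}" and A2: "finite A2" "A2 \<noteq> {}"
    and err1: "PR (pair_pmf (pmf_of_set A1) (pmf_of_set A2))
       {m. g1 (output1 y1 z2 f1 f2 n m) \<noteq> fst m} \<le> \<epsilon>"
    and err2: "PR (pair_pmf (pmf_of_set A1) (pmf_of_set A2))
       {m. g2 (output2 t1 y2 z2 f1 f2 n m) \<noteq> snd m} \<le> \<epsilon>"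
    and large1: "card A1 = 1 \<or> 1 \<le> \<epsilon> * log 2 (card A1)"
    and large2: "card A2 = 1 \<or> 1 \<le> \<epsilon> * log 2 (card A2)"
begin

definition P :: "(nat \<times> nat) pmf" where "P = pair_pmf (pmf_of_set A1) (pmf_of_set A2)"

abbreviation H :: "(nat \<times> nat \<Rightarrow> 'a) \<Rightarrow> real" where "H X \<equiv> entropy_pmf P X"

definition X :: "nat \<Rightarrow> nat \<times> nat \<Rightarrow> 'x1 \<times> 'x2" where
  "X i m = (input1 z2 f1 f2 m i, f2 i (snd m))"
definition Zpast :: "nat \<Rightarrow> nat \<times> nat \<Rightarrow> 'z2 list" where
  "Zpast i m = map (\<lambda>j. z2 (f2 j (snd m))) [1..<i]"

definition block :: "(nat \<Rightarrow> nat \<times> nat \<Rightarrow> 'a) \<Rightarrow> nat \<times> nat \<Rightarrow> 'a list" where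
  "block V m = map (\<lambda>j. V j m) [1..<Suc n]"

lemma finP [simp]: "finite (set_pmf P)"
  unfolding P_def using A1 A2 by auto

lemma output1_block: "output1 y1 z2 f1 f2 n = block (\<lambda>i m. Y1 (X i m))"
  by (simp add: fun_eq_iff output1_def block_def Y1_def X_def)

lemma output2_block: "output2 t1 y2 z2 f1 f2 n = block (\<lambda>i m. Y2 (X i m))"
  by (simp add: fun_eq_iff output2_def block_def Y2_def X_def)

abbreviation "avg F \<equiv> (\<Sum>i=1..n. F i) / real n"

text \<open>For \<open>W = (Q, Zpast Q)\<close> with \<open>Q\<close> uniform over the positions,
  \<open>aA\<close>, \<open>aB\<close>, \<open>aC\<close> and \<open>aD\<close> are the conditional
  entropies of the region, and \<open>aY\<close> is a lower bound for \<open>H(Y2)\<close>.\<close>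

definition "aA = avg (\<lambda>i. H (\<lambda>m. (Y1 (X i m), Zpast i m)) - H (Zpast i))"
definition "aB = avg (\<lambda>i. H (\<lambda>m. (YZ (X i m), (T1 (X i m), Zpast i m))) - H (\<lambda>m. (T1 (X i m), Zpast i m)))"
definition "aC = avg (\<lambda>i. H (\<lambda>m. (Y1 (X i m), (T1 (X i m), Zpast i m))) - H (\<lambda>m. (T1 (X i m), Zpast i m)))"
definition "aD = avg (\<lambda>i. H (\<lambda>m. (YZ (X i m), Zpast i m)) - H (Zpast i))"
definition "aY = avg (\<lambda>i. H (\<lambda>m. Y2 (X i m)))"

definition "L1 = log 2 (card A1)"
definition "L2 = log 2 (card A2)"

lemma Zpast_eqI: "snd m = snd m' \<Longrightarrow> Zpast i m = Zpast i m'"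
  by (simp add: Zpast_def)

lemma det_snd_Zpast: "determines (\<lambda>m. (F m, snd m)) (Zpast i)"
  by (auto simp: determines_def intro: Zpast_eqI)

lemma fano1: "H (\<lambda>m. (fst m, block (\<lambda>i m. Y1 (X i m)) m)) - H (block (\<lambda>i m. Y1 (X i m))) \<le> 2 * \<epsilon> * L1"
  unfolding L1_def output1_block[symmetric]
  by (rule fano_inequality[OF finP A1(1) _ _ large1, where g=g1]) (use A1 A2 err1 in \<open>auto simp: P_def\<close>)

lemma fano2: "H (\<lambda>m. (snd m, block (\<lambda>i m. Y2 (X i m)) m)) - H (block (\<lambda>i m. Y2 (X i m))) \<le> 2 * \<epsilon> * L2"
  unfolding L2_def output2_block[symmetric]
  by (rule fano_inequality[OF finP A2(1) _ _ large2, where g=g2]) (use A1 A2 err2 in \<open>auto simp: P_def\<close>)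

lemma HM: "H fst = L1" "H snd = L2" "H (\<lambda>m. m) = L1 + L2"
  unfolding P_def L1_def L2_def using entropy_uniform_pair[OF A1 A2] by auto

lemma block_chain:
  assumes "\<And>i. i \<in> {1..n} \<Longrightarrow> determines (\<lambda>m. (map (\<lambda>j. V j m) [1..<i], C m)) (D i)"
  shows "H (\<lambda>m. (block V m, C m)) - H C \<le> real n * avg (\<lambda>i. H (\<lambda>m. (V i m, D i m)) - H (D i))"
  using entropy_chain_le[of P n V C D, OF finP assms] n_pos unfolding block_def by simp

lemma block_chain0:
  assumes "\<And>i. i \<in> {1..n} \<Longrightarrow> determines (\<lambda>m. map (\<lambda>j. V j m) [1..<i]) (D i)"
  shows "H (block V) \<le> real n * avg (\<lambda>i. H (\<lambda>m. (V i m, D i m)) - H (D i))"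
proof -
  have "H (block V) = H (\<lambda>m. (block V m, ()))" by (rule entropy_eq) (auto simp: determines_def)
  moreover have "H (\<lambda>m. ()) \<le> 0"
    by (rule order_trans[OF entropy_le_log_card[where A="{()}", OF finP]]) auto
  moreover have "determines (\<lambda>m. (map (\<lambda>j. V j m) [1..<i], ())) (D i)" if "i \<in> {1..n}" for i
    using assms[OF that] by (auto simp: determines_def)
  ultimately show ?thesis using block_chain[of V "\<lambda>m. ()" D] by simp
qed

lemma YZ_past:
  assumes "map (\<lambda>j. YZ (X j m)) [1..<i] = map (\<lambda>j. YZ (X j m')) [1..<i]"
  shows "Zpast i m = Zpast i m'"
  using assms by (auto simp: Zpast_def YZ_def Z2_def X_def)

text \<open>Encoder 1 computes its input at time \<open>i\<close> from \<open>m1\<close> and the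
  strict past of the cribbing signal, which is contained in the past of \<open>YZ\<close>.\<close>

lemma block_fst_determines_T:
  "determines (\<lambda>m. (map (\<lambda>j. YZ (X j m)) [1..<i], fst m)) (\<lambda>m. (T1 (X i m), Zpast i m))"
proof -
  have "T1 (X i m) = t1 (f1 i (fst m) (Zpast i m))" for m
    by (simp add: T1_def X_def input1_def Zpast_def)
  then show ?thesis unfolding determines_def using YZ_past by (metis (no_types, lifting) prod.inject)
qed

text \<open>Given \<open>m2\<close>, all inputs of sender 2 are known, and injectivity recovers the
  interference letter by letter.\<close>

lemma block_Y2_determines_T:
  "determines (\<lambda>m. (block (\<lambda>i m. Y2 (X i m)) m, snd m)) (\<lambda>m. (block (\<lambda>i m. T1 (X i m)) m, snd m))"
  unfolding determines_def
proof (intro allI impI)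
  fix m m' assume *: "(block (\<lambda>i m. Y2 (X i m)) m, snd m) = (block (\<lambda>i m. Y2 (X i m)) m', snd m')"
  have "T1 (X i m) = T1 (X i m')" if "i \<in> {1..<Suc n}" for i
  proof -
    have "Y2 (X i m) = Y2 (X i m')" using * that unfolding block_def prod.inject map_eq_conv set_upt by blast
    then have "y2 (f2 i (snd m')) (T1 (X i m)) = y2 (f2 i (snd m')) (T1 (X i m'))"
      using * by (simp add: Y2_def X_def T1_def)
    then show ?thesis using injective by (meson injD)
  qed
  then show "(block (\<lambda>i m. T1 (X i m)) m, snd m) = (block (\<lambda>i m. T1 (X i m)) m', snd m')"
    using * unfolding block_def prod.inject map_eq_conv set_upt by blast
qed

text \<open>From \<open>L1 = H(M1|M2)\<close>: the output word is adjoined, Fano's inequality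
  removes \<open>M1\<close>, and \<open>H(Y1^n|M2)\<close> remains, where \<open>M2\<close> supplies
  \<open>Zpast i\<close> at each step.\<close>

lemma bound_A: "(1 - 2 * \<epsilon>) * L1 \<le> real n * aA"
proof -
  let ?Y = "block (\<lambda>i m. Y1 (X i m))"
  have "L1 = H (\<lambda>m. (fst m, snd m)) - H snd" by (simp add: HM)
  moreover have "H (\<lambda>m. (fst m, snd m)) \<le> H (\<lambda>m. (fst m, (?Y m, snd m)))"
    by (rule entropy_mono) (auto simp: determines_def)
  moreover have "H (\<lambda>m. (fst m, (?Y m, snd m))) \<le> H (\<lambda>m. (fst m, ?Y m)) - H ?Y + H (\<lambda>m. (?Y m, snd m))"
    using cond_entropy_reduces[OF finP, of "\<lambda>m. (?Y m, snd m)" ?Y fst] by (simp add: determines_def)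
  moreover have "H (\<lambda>m. (?Y m, snd m)) - H snd \<le> real n * aA"
    unfolding aA_def by (rule block_chain) (rule det_snd_Zpast)
  ultimately show ?thesis using fano1 by (simp add: algebra_simps)
qed

lemma H_block_Y2: "H (block (\<lambda>i m. Y2 (X i m))) \<le> real n * aY"
proof -
  have "H (\<lambda>m. (Y2 (X i m), ())) = H (\<lambda>m. Y2 (X i m))" for i
    by (rule entropy_eq) (auto simp: determines_def)
  then have "real n * avg (\<lambda>i. H (\<lambda>m. (Y2 (X i m), ())) - H (\<lambda>m. ())) \<le> real n * aY"
    unfolding aY_def using entropy_pmf_nonneg[OF finP, of "\<lambda>m. ()"]
    by (intro mult_left_mono divide_right_mono sum_mono) auto
  moreover have "H (block (\<lambda>i m. Y2 (X i m))) \<le> real n * avg (\<lambda>i. H (\<lambda>m. (Y2 (X i m), ())) - H (\<lambda>m. ()))"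
    by (rule block_chain0) (simp add: determines_def)
  ultimately show ?thesis by linarith
qed

lemma bound_Y: "(1 - 2 * \<epsilon>) * L2 \<le> real n * aY"
proof -
  have "L2 \<le> H (\<lambda>m. (snd m, block (\<lambda>i m. Y2 (X i m)) m))"
    unfolding HM(2)[symmetric] by (rule entropy_mono) (auto simp: determines_def)
  then show ?thesis using fano2 H_block_Y2 by (simp add: algebra_simps)
qed

lemma fano2':
  assumes "determines Y (block (\<lambda>i m. Y2 (X i m)))"
  shows "H (\<lambda>m. (snd m, Y m)) - H Y \<le> 2 * \<epsilon> * L2"
  using cond_entropy_reduces[OF finP assms, of snd] fano2 by simp

lemma det_YZ_Y2: "determines (block (\<lambda>i m. YZ (X i m))) (block (\<lambda>i m. Y2 (X i m)))"
  unfolding determines_def block_def YZ_def by (auto simp del: upt_Suc)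

text \<open>Receiver 2 is handed the cribbing word, and \<open>M1\<close> is conditioned on:
  \<open>L2 = H(M2|M1)\<close> is at most a Fano term plus \<open>H(Y2^n,Z2^n|M1)\<close>, and
  \<open>M1\<close> with the past of \<open>YZ\<close> yields \<open>T1\<close> and
  \<open>Zpast\<close>.\<close>

lemma bound_B: "(1 - 2 * \<epsilon>) * L2 \<le> real n * aB"
proof -
  let ?Y = "block (\<lambda>i m. YZ (X i m))"
  have "H (\<lambda>m. (snd m, fst m)) = H (\<lambda>m. m)" by (rule entropy_eq) (auto simp: determines_def prod_eq_iff)
  then have "L2 = H (\<lambda>m. (snd m, fst m)) - H fst" by (simp add: HM)
  moreover have "H (\<lambda>m. (snd m, fst m)) \<le> H (\<lambda>m. (snd m, (?Y m, fst m)))"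
    by (rule entropy_mono) (auto simp: determines_def)
  moreover have "H (\<lambda>m. (snd m, (?Y m, fst m))) \<le> H (\<lambda>m. (snd m, ?Y m)) - H ?Y + H (\<lambda>m. (?Y m, fst m))"
    using cond_entropy_reduces[OF finP, of "\<lambda>m. (?Y m, fst m)" ?Y snd] by (simp add: determines_def)
  moreover have "H (\<lambda>m. (?Y m, fst m)) - H fst \<le> real n * aB"
    unfolding aB_def by (rule block_chain) (rule block_fst_determines_T)
  ultimately show ?thesis using fano2'[OF det_YZ_Y2] by (simp add: algebra_simps)
qed

text \<open>\<open>L1 = H(M1|M2)\<close> is at most a Fano term plus
  \<open>H(Y1^n|T1^n,M2) + H(T1^n|M2)\<close>. By injectivity
  \<open>H(T1^n,M2) \<le> H(Y,M2)\<close>, which is \<open>H(Y)\<close> plus the Fano term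
  \<open>H(M2|Y)\<close>; subtracting \<open>H(M2) = L2\<close> brings in the second rate. With
  \<open>Y\<close> the word of \<open>Y2\<close> or of \<open>YZ\<close> this gives both bounds on
  the sum.\<close>

lemma bound_sum:
  assumes Y: "determines Y (block (\<lambda>i m. Y2 (X i m)))" and HY: "H Y \<le> real n * aU"
  shows "(1 - 2 * \<epsilon>) * (L1 + L2) \<le> real n * (aC + aU)"
proof -
  let ?Y1 = "block (\<lambda>i m. Y1 (X i m))" and ?T = "block (\<lambda>i m. T1 (X i m))"
  let ?Y2 = "block (\<lambda>i m. Y2 (X i m))"
  have "L1 = H (\<lambda>m. (fst m, snd m)) - H snd" by (simp add: HM)
  moreover have "H (\<lambda>m. (fst m, snd m)) \<le> H (\<lambda>m. (fst m, (?Y1 m, (?T m, snd m))))"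
    by (rule entropy_mono) (auto simp: determines_def)
  moreover have "H (\<lambda>m. (fst m, (?Y1 m, (?T m, snd m)))) \<le> H (\<lambda>m. (fst m, ?Y1 m)) - H ?Y1 + H (\<lambda>m. (?Y1 m, (?T m, snd m)))"
    using cond_entropy_reduces[OF finP, of "\<lambda>m. (?Y1 m, (?T m, snd m))" ?Y1 fst] by (simp add: determines_def)
  moreover have "H (\<lambda>m. (?Y1 m, (?T m, snd m))) - H (\<lambda>m. (?T m, snd m)) \<le> real n * aC"
    unfolding aC_def
  proof (rule block_chain)
    fix i assume i: "i \<in> {1..n}"
    show "determines (\<lambda>m. (map (\<lambda>j. Y1 (X j m)) [1..<i], ?T m, snd m)) (\<lambda>m. (T1 (X i m), Zpast i m))"
      unfolding determines_def
    proof (intro allI impI)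
      fix m m' assume *: "(map (\<lambda>j. Y1 (X j m)) [1..<i], ?T m, snd m) = (map (\<lambda>j. Y1 (X j m')) [1..<i], ?T m', snd m')"
      then have "i \<in> set [1..<Suc n] \<longrightarrow> T1 (X i m) = T1 (X i m')"
        by (simp add: block_def map_eq_conv del: upt_Suc)
      then show "(T1 (X i m), Zpast i m) = (T1 (X i m'), Zpast i m')"
        using i Zpast_eqI[of m m'] * by (simp del: upt_Suc)
    qed
  qed
  moreover have "H (\<lambda>m. (?T m, snd m)) \<le> H (\<lambda>m. (Y m, snd m))"
  proof (rule entropy_mono[OF finP])
    show "determines (\<lambda>m. (Y m, snd m)) (\<lambda>m. (?T m, snd m))"
      using Y block_Y2_determines_T unfolding determines_def prod.inject by blast
  qed
  moreover have "H (\<lambda>m. (Y m, snd m)) = H (\<lambda>m. (snd m, Y m))"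
    by (rule entropy_eq) (auto simp: determines_def)
  ultimately have "L1 \<le> 2 * \<epsilon> * L1 + real n * aC + H (\<lambda>m. (snd m, Y m)) - L2"
    using fano1 by (simp add: HM)
  then show ?thesis using fano2'[OF Y] HY by (simp add: algebra_simps)
qed

lemma bound_CY: "(1 - 2 * \<epsilon>) * (L1 + L2) \<le> real n * (aC + aY)"
  by (rule bound_sum[OF _ H_block_Y2]) (simp add: determines_def)

lemma bound_CD: "(1 - 2 * \<epsilon>) * (L1 + L2) \<le> real n * (aC + aD)"
proof (rule bound_sum[OF det_YZ_Y2])
  show "H (block (\<lambda>i m. YZ (X i m))) \<le> real n * aD"
    unfolding aD_def by (rule block_chain0) (auto simp: determines_def intro: YZ_past)
qed

lemma single_letter:
  "\<exists>(pW :: (nat \<times> 'z2 list) pmf) p1 p2. finite (set_pmf pW) \<and>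
    mean hA pW p1 p2 = aA \<and>
    mean hB pW p1 p2 = aB \<and>
    mean hC pW p1 p2 = aC \<and>
    mean hD pW p1 p2 = aD \<and>
    aY \<le> H2 pW p1 p2"
proof -
  define U where "U = pmf_of_set {1..n}"
  define Q where "Q = bind_pmf U (\<lambda>i. map_pmf (Pair i) P)"
  define zp where "zp = (\<lambda>i m2. map (\<lambda>j. z2 (f2 j m2)) [1..<i])"
  define W where "W = (\<lambda>s :: nat \<times> nat \<times> nat. (fst s, Zpast (fst s) (snd s)))"
  define pW where "pW = bind_pmf U (\<lambda>i. bind_pmf (pmf_of_set A2) (\<lambda>m2. return_pmf (i, zp i m2)))"
  \<comment> \<open>Given \<open>(i, z)\<close>, \<open>m1\<close> stays uniform, being independent
    of the cribbing signal, while \<open>m2\<close> is conditioned on having produced the past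
    \<open>z\<close>. Hence the product form of the joint law.\<close>
  define p1 where "p1 = (\<lambda>(i, z). map_pmf (\<lambda>m1. f1 i m1 z) (pmf_of_set A1))"
  define p2 where "p2 = (\<lambda>(i, z). map_pmf (f2 i) (cond_pmf (pmf_of_set A2) {m2. zp i m2 = z}))"
  have I: "finite {1..n}" "{1..n} \<noteq> {}" using n_pos by auto
  have fU: "finite (set_pmf U)" unfolding U_def using I by simp
  have fQ: "finite (set_pmf Q)" unfolding Q_def using fU by auto
  have fW: "finite (set_pmf pW)" unfolding pW_def using fU A2 by auto
  have fj: "finite (set_pmf (joint_pmf pW p1 p2))" unfolding joint_pmf_def using fW by (auto intro: finite_supp)
  have joint: "joint_pmf pW p1 p2 = map_pmf (\<lambda>s. (W s, X (fst s) (snd s))) Q"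
  proof -
    have "joint_pmf pW p1 p2 = bind_pmf U (\<lambda>i. bind_pmf (pmf_of_set A2) (\<lambda>m2.
      bind_pmf (cond_pmf (pmf_of_set A2) {m2'. zp i m2' = zp i m2}) (\<lambda>m2'.
        bind_pmf (pmf_of_set A1) (\<lambda>m1. return_pmf ((i, zp i m2), (f1 i m1 (zp i m2), f2 i m2'))))))"
      unfolding joint_pmf_def pW_def p1_def p2_def pair_pmf_def map_pmf_def
      by (simp add: bind_assoc_pmf bind_return_pmf) (subst bind_commute_pmf, rule refl)
    also have "\<dots> = bind_pmf U (\<lambda>i. bind_pmf (pmf_of_set A2) (\<lambda>m2.
        bind_pmf (pmf_of_set A1) (\<lambda>m1. return_pmf ((i, zp i m2), (f1 i m1 (zp i m2), f2 i m2)))))"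
      by (subst bind_bind_cond_pmf_fibers) (rule refl)
    also have "\<dots> = bind_pmf U (\<lambda>i. bind_pmf (pmf_of_set A1) (\<lambda>m1.
        bind_pmf (pmf_of_set A2) (\<lambda>m2. return_pmf ((i, zp i m2), (f1 i m1 (zp i m2), f2 i m2)))))"
      by (subst bind_commute_pmf) (rule refl)
    also have "\<dots> = map_pmf (\<lambda>s. (W s, X (fst s) (snd s))) Q"
      unfolding Q_def P_def pair_pmf_def map_pmf_def W_def X_def Zpast_def zp_def input1_def
      by (simp add: bind_assoc_pmf bind_return_pmf)
    finally show ?thesis .
  qed
  have ent: "entropy_pmf (joint_pmf pW p1 p2) F = entropy_pmf Q (\<lambda>s. F (W s, X (fst s) (snd s)))"
    for F :: "(nat \<times> 'z2 list) \<times> 'x1 \<times> 'x2 \<Rightarrow> 'v"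
    unfolding joint using fQ by (simp add: entropy_pmf_map)
  note ts = entropy_time_sharing[of P "{1..n}", OF finP I, folded U_def, folded Q_def]
  note cj = cond_entropy_joint[of pW p1 p2, OF fW, unfolded ent, symmetric]
  have fin2: "finite (set_pmf (pair_pmf (p1 w) (p2 w)))" for w by (rule finite_supp)
  have one: "EV pW (\<lambda>w. entropy_pmf (pair_pmf (p1 w) (p2 w)) V)
    = avg (\<lambda>i. H (\<lambda>m. (V (X i m), Zpast i m)) - H (Zpast i))" for V :: "'x1 \<times> 'x2 \<Rightarrow> 'v"
    using ts(1)[of "\<lambda>i m. V (X i m)" Zpast] cj(1)[OF fin2, of V] by (simp add: W_def)
  have two: "EV pW (\<lambda>w. entropy_pmf (pair_pmf (p1 w) (p2 w)) (\<lambda>x. (V x, T1 x))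
      - entropy_pmf (pair_pmf (p1 w) (p2 w)) T1)
    = avg (\<lambda>i. H (\<lambda>m. (V (X i m), (T1 (X i m), Zpast i m))) - H (\<lambda>m. (T1 (X i m), Zpast i m)))"
    for V :: "'x1 \<times> 'x2 \<Rightarrow> 'v"
  proof -
    have "entropy_pmf Q (\<lambda>s. (V (X (fst s) (snd s)), (T1 (X (fst s) (snd s)), W s)))
      = entropy_pmf Q (\<lambda>s. (V (X (fst s) (snd s)), (fst s, (T1 (X (fst s) (snd s)), Zpast (fst s) (snd s)))))"
      by (rule entropy_eq[OF fQ]) (auto simp: determines_def W_def)
    moreover have "entropy_pmf Q (\<lambda>s. (T1 (X (fst s) (snd s)), W s))
      = entropy_pmf Q (\<lambda>s. (fst s, (T1 (X (fst s) (snd s)), Zpast (fst s) (snd s))))"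
      by (rule entropy_eq[OF fQ]) (auto simp: determines_def W_def)
    ultimately show ?thesis
      using ts(1)[of "\<lambda>i m. V (X i m)" "\<lambda>i m. (T1 (X i m), Zpast i m)"] cj(2)[OF fin2, of V T1] by simp
  qed
  have "aY \<le> entropy_pmf Q (\<lambda>s. Y2 (X (fst s) (snd s)))"
    unfolding aY_def using ts(2)[of "\<lambda>i m. Y2 (X i m)"] by simp
  also have "\<dots> = entropy_pmf (map_pmf snd (joint_pmf pW p1 p2)) Y2"
    using fj ent[of "\<lambda>s. Y2 (snd s)"] by (simp add: entropy_pmf_map)
  also have "map_pmf snd (joint_pmf pW p1 p2) = bind_pmf pW (law p1 p2)"
    by (simp add: joint_pmf_def map_bind_pmf map_pmf_comp)
  finally show ?thesis
    using fW one[of Y1] one[of YZ] two[of Y1] two[of YZ]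
    unfolding hA_def hB_def hC_def hD_def aA_def aB_def aC_def aD_def by blast
qed

lemma scaled_in_region:
  assumes R: "0 \<le> R1" "0 \<le> R2" and L: "real n * R1 \<le> L1" "real n * R2 \<le> L2" and e: "\<epsilon> \<le> 1/2"
  shows "((1 - 2 * \<epsilon>) * R1, (1 - 2 * \<epsilon>) * R2) \<in> region"
proof -
  obtain pW p1 p2 where fW: "finite (set_pmf (pW :: (nat \<times> 'z2 list) pmf))"
    and s: "mean hA pW p1 p2 = aA"
    "mean hB pW p1 p2 = aB"
    "mean hC pW p1 p2 = aC"
    "mean hD pW p1 p2 = aD"
    and Y: "aY \<le> H2 pW p1 p2"
    using single_letter by blast
  have *: "(1 - 2 * \<epsilon>) * r \<le> a" if "(1 - 2 * \<epsilon>) * l \<le> real n * a" "real n * r \<le> l" for a r l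
  proof -
    have "real n * ((1 - 2 * \<epsilon>) * r) \<le> (1 - 2 * \<epsilon>) * l"
      using mult_left_mono[OF that(2), of "1 - 2 * \<epsilon>"] e by (simp add: mult.left_commute)
    also have "\<dots> \<le> real n * a" by fact
    finally show ?thesis using n_pos by simp
  qed
  have L12: "real n * (R1 + R2) \<le> L1 + L2" using L by (simp add: distrib_left)
  have "in_bounds pW (law p1 p2) ((1 - 2 * \<epsilon>) * R1) ((1 - 2 * \<epsilon>) * R2)"
    unfolding in_bounds_iff s
    using *[OF bound_A L(1)] *[OF bound_B L(2)] *[OF bound_Y L(2)] *[OF bound_CY L12] *[OF bound_CD L12] Y
    by (auto simp: distrib_left)
  then show ?thesis using R e fW by (intro regionI[where pW=pW and ?p1.0=p1 and ?p2.0=p2]) auto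
qed

end

section \<open>Passage to vanishing error probability\<close>

context z_channel
begin

lemma messages_card: "card (messages n R) = nat \<lceil>2 powr (real n * R)\<rceil>"
  by (simp add: messages_def)

lemma messages_finite [simp]: "finite (messages n R)"
  by (simp add: messages_def)

lemma messages_nonempty [simp]: "messages n R \<noteq> {}"
  by (simp add: messages_def Suc_le_eq)

lemma messages_log: "real n * R \<le> log 2 (card (messages n R))"
proof -
  have "2 powr (real n * R) \<le> real (card (messages n R))" unfolding messages_card by linarith
  then show ?thesis by (subst le_log_iff) (auto simp: card_gt_0_iff)
qed

theorem converse:
  assumes injective: "\<And>x2. inj (y2 x2)" and ach: "achievable y1 t1 y2 z2 (R1, R2)"
  shows "(R1, R2) \<in> closure region"
proof -
  have R: "0 \<le> R1" "0 \<le> R2" using ach by (auto simp: achievable_def)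
  have reg: "((1 - 2 * \<epsilon>) * R1, (1 - 2 * \<epsilon>) * R2) \<in> region" if e: "0 < \<epsilon>" "\<epsilon> \<le> 1/2" for \<epsilon>
  proof -
    have "\<forall>\<^sub>F n in sequentially. \<exists>f1 f2 g1 g2. is_code y1 t1 y2 z2 n R1 R2 \<epsilon> f1 f2 g1 g2"
      using ach e(1) by (simp add: achievable_def)
    then obtain N where N: "\<And>n. N \<le> n \<Longrightarrow> \<exists>f1 f2 g1 g2. is_code y1 t1 y2 z2 n R1 R2 \<epsilon> f1 f2 g1 g2"
      unfolding eventually_sequentially by blast
    have ev: "\<exists>n0. \<forall>n\<ge>n0. R = 0 \<or> 1 \<le> \<epsilon> * (real n * R)" if "0 \<le> R" for R
    proof (cases "R = 0")
      case False
      then have "0 < \<epsilon> * R" using that e by simp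
      then obtain n0 where "1 / (\<epsilon> * R) < real n0" using reals_Archimedean2 by blast
      then have "1 \<le> \<epsilon> * (real n * R)" if "n \<ge> n0" for n
      proof -
        have "1 / (\<epsilon> * R) \<le> real n" using \<open>1 / (\<epsilon> * R) < real n0\<close> that by linarith
        then show ?thesis using \<open>0 < \<epsilon> * R\<close> by (simp add: field_simps)
      qed
      then show ?thesis by blast
    qed simp
    obtain k1 where k1: "\<forall>n\<ge>k1. R1 = 0 \<or> 1 \<le> \<epsilon> * (real n * R1)" using ev[OF R(1)] by blast
    obtain k2 where k2: "\<forall>n\<ge>k2. R2 = 0 \<or> 1 \<le> \<epsilon> * (real n * R2)" using ev[OF R(2)] by blast
    \<comment> \<open>Long enough for the code to exist and for Fano's one bit to be absorbed at
      each positive rate.\<close>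
    define n where "n = Max {1, N, k1, k2}"
    have n: "1 \<le> n" "N \<le> n" "k1 \<le> n" "k2 \<le> n" unfolding n_def by auto
    obtain f1 f2 g1 g2 where code: "is_code y1 t1 y2 z2 n R1 R2 \<epsilon> f1 f2 g1 g2" using N[OF n(2)] by blast
    have large: "card (messages n R) = 1 \<or> 1 \<le> \<epsilon> * log 2 (card (messages n R))"
      if "R = 0 \<or> 1 \<le> \<epsilon> * (real n * R)" for R
      using that
    proof
      assume "R = 0" then show ?thesis by (simp add: messages_card)
    next
      assume "1 \<le> \<epsilon> * (real n * R)"
      also have "\<dots> \<le> \<epsilon> * log 2 (card (messages n R))" using messages_log e by (intro mult_left_mono) auto
      finally show ?thesis by simp
    qed
    have l: "card (messages n R1) = 1 \<or> 1 \<le> \<epsilon> * log 2 (card (messages n R1))"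
      "card (messages n R2) = 1 \<or> 1 \<le> \<epsilon> * log 2 (card (messages n R2))"
      using n k1 k2 by (auto intro!: large simp del: One_nat_def)
    interpret z_code y1 t1 y2 z2 n "messages n R1" "messages n R2" \<epsilon> f1 f2 g1 g2
    proof unfold_locales
      show "0 < n" using n by simp
      show "PR (pair_pmf (pmf_of_set (messages n R1)) (pmf_of_set (messages n R2)))
       {m. g1 (output1 y1 z2 f1 f2 n m) \<noteq> fst m} \<le> \<epsilon>" "PR (pair_pmf (pmf_of_set (messages n R1)) (pmf_of_set (messages n R2)))
       {m. g2 (output2 t1 y2 z2 f1 f2 n m) \<noteq> snd m} \<le> \<epsilon>"
        using code by (simp_all add: is_code_def message_pmf_def)
    qed (use injective l in simp_all)
    show ?thesis using R messages_log e(2) by (intro scaled_in_region) (auto simp: L1_def L2_def)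
  qed
  \<comment> \<open>This \<open>\<epsilon>\<close> stays at most \<open>1/2\<close>, as
    \<open>reg\<close> demands, and tends to zero.\<close>
  define f where "f = (\<lambda>k::nat. let \<epsilon> = 1 / (2 * (real k + 1)) in ((1 - 2 * \<epsilon>) * R1, (1 - 2 * \<epsilon>) * R2))"
  have "f k \<in> region" for k unfolding f_def Let_def by (rule reg) auto
  moreover have "f \<longlonglongrightarrow> (R1, R2)"
  proof -
    have "(\<lambda>k. 1 - 2 * (1 / (2 * (real k + 1)))) \<longlonglongrightarrow> 1" by real_asymp
    then have "(\<lambda>k. ((1 - 2 * (1 / (2 * (real k + 1)))) * R1, (1 - 2 * (1 / (2 * (real k + 1)))) * R2)) \<longlonglongrightarrow> (1 * R1, 1 * R2)"
      by (intro tendsto_Pair tendsto_mult tendsto_const)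
    then show ?thesis unfolding f_def Let_def mult_1 .
  qed
  ultimately show ?thesis unfolding closure_sequential by (intro exI[of _ f]) simp
qed

end

section \<open>Memoryless kernels and collision probabilities\<close>

primrec kernel_list :: "('a \<Rightarrow> 'b pmf) \<Rightarrow> 'a list \<Rightarrow> 'b list pmf" where
  "kernel_list \<kappa> [] = return_pmf []"
| "kernel_list \<kappa> (a # as) = bind_pmf (\<kappa> a) (\<lambda>b. map_pmf (Cons b) (kernel_list \<kappa> as))"

text \<open>A kernel driven by \<open>N\<close> units, so that facts about
  \<open>kernel_list\<close> specialise to it.\<close>

definition iid :: "nat \<Rightarrow> 'a pmf \<Rightarrow> 'a list pmf" where
  "iid N p = kernel_list (\<lambda>_. p) (replicate N ())"

lemma iid_0 [simp]: "iid 0 p = return_pmf []"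
  by (simp add: iid_def)

lemma iid_Suc [simp]: "iid (Suc N) p = bind_pmf p (\<lambda>a. map_pmf (Cons a) (iid N p))"
  by (simp add: iid_def)

lemma kernel_list_Cons_pmf:
  "kernel_list \<kappa> (a # as) = map_pmf (\<lambda>(b, bs). b # bs) (pair_pmf (\<kappa> a) (kernel_list \<kappa> as))"
  by (simp add: pair_pmf_def map_pmf_def bind_assoc_pmf bind_return_pmf)

lemma pmf_kernel_list_Cons:
  "pmf (kernel_list \<kappa> (a # as)) (b # bs) = pmf (\<kappa> a) b * pmf (kernel_list \<kappa> as) bs"
proof -
  have "pmf (kernel_list \<kappa> (a # as)) ((\<lambda>(b, bs). b # bs) (b, bs)) = pmf (pair_pmf (\<kappa> a) (kernel_list \<kappa> as)) (b, bs)"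
    unfolding kernel_list_Cons_pmf by (rule pmf_map_inj') (auto simp: inj_on_def)
  then show ?thesis by (simp add: pmf_pair del: kernel_list.simps)
qed

lemma set_kernel_list: "set_pmf (kernel_list \<kappa> as) = {bs. list_all2 (\<lambda>a b. b \<in> set_pmf (\<kappa> a)) as bs}"
proof (induction as)
  case (Cons a as)
  show ?case by (auto simp: Cons.IH list_all2_Cons1)
qed auto

lemma set_iid: "as \<in> set_pmf (iid N p) \<Longrightarrow> length as = N \<and> set as \<subseteq> set_pmf p"
proof (induction N arbitrary: as)
  case (Suc N)
  then obtain a as' where "as = a # as'" "a \<in> set_pmf p" "as' \<in> set_pmf (iid N p)" by auto
  then show ?case using Suc.IH[of as'] by auto
qed simp

lemma length_kernel_list: "bs \<in> set_pmf (kernel_list \<kappa> as) \<Longrightarrow> length bs = length as"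
  by (auto simp: set_kernel_list dest: list_all2_lengthD)

lemma finite_kernel_list:
  "(\<And>a. a \<in> set as \<Longrightarrow> finite (set_pmf (\<kappa> a))) \<Longrightarrow> finite (set_pmf (kernel_list \<kappa> as))"
  by (induction as) auto

lemma finite_iid: "finite (set_pmf p) \<Longrightarrow> finite (set_pmf (iid N p))"
  unfolding iid_def by (rule finite_kernel_list)

lemma map_kernel_list: "map_pmf (map f) (kernel_list \<kappa> as) = kernel_list (\<lambda>a. map_pmf f (\<kappa> a)) as"
proof (induction as)
  case (Cons a as)
  show ?case by (simp add: map_bind_pmf bind_map_pmf map_pmf_comp Cons.IH[symmetric])
qed simp

lemma bind_kernel_list:
  "bind_pmf (kernel_list \<kappa> as) (\<lambda>bs. map_pmf (zip bs) (kernel_list \<eta> (zip as bs)))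
   = kernel_list (\<lambda>a. bind_pmf (\<kappa> a) (\<lambda>b. map_pmf (Pair b) (\<eta> (a, b)))) as"
proof (induction as)
  case (Cons a as)
  have "bind_pmf (kernel_list \<kappa> (a # as)) (\<lambda>bs. map_pmf (zip bs) (kernel_list \<eta> (zip (a # as) bs)))
    = bind_pmf (\<kappa> a) (\<lambda>b. bind_pmf (kernel_list \<kappa> as) (\<lambda>bs. bind_pmf (\<eta> (a, b)) (\<lambda>c.
        map_pmf (\<lambda>cs. (b, c) # zip bs cs) (kernel_list \<eta> (zip as bs)))))"
    by (simp add: bind_assoc_pmf bind_map_pmf map_bind_pmf map_pmf_comp)
  also have "\<dots> = bind_pmf (\<kappa> a) (\<lambda>b. bind_pmf (\<eta> (a, b)) (\<lambda>c. bind_pmf (kernel_list \<kappa> as) (\<lambda>bs.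
        map_pmf (\<lambda>cs. (b, c) # zip bs cs) (kernel_list \<eta> (zip as bs)))))"
    by (subst bind_commute_pmf) (rule refl)
  also have "\<dots> = bind_pmf (\<kappa> a) (\<lambda>b. bind_pmf (\<eta> (a, b)) (\<lambda>c. map_pmf (Cons (b, c))
     (bind_pmf (kernel_list \<kappa> as) (\<lambda>bs. map_pmf (zip bs) (kernel_list \<eta> (zip as bs))))))"
    by (simp add: map_bind_pmf map_pmf_comp)
  also have "\<dots> = kernel_list (\<lambda>a. bind_pmf (\<kappa> a) (\<lambda>b. map_pmf (Pair b) (\<eta> (a, b)))) (a # as)"
    by (simp add: Cons.IH bind_assoc_pmf bind_map_pmf)
  finally show ?case .
qed (simp add: bind_return_pmf)

lemma bind_kernel_list_snd:
  "bind_pmf (kernel_list \<kappa> as) (\<lambda>bs. kernel_list \<eta> (zip as bs))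
   = kernel_list (\<lambda>a. bind_pmf (\<kappa> a) (\<lambda>b. \<eta> (a, b))) as"
proof -
  have "kernel_list (\<lambda>a. bind_pmf (\<kappa> a) (\<lambda>b. \<eta> (a, b))) as
    = map_pmf (map snd) (bind_pmf (kernel_list \<kappa> as) (\<lambda>bs. map_pmf (zip bs) (kernel_list \<eta> (zip as bs))))"
    unfolding bind_kernel_list map_kernel_list by (simp add: map_bind_pmf map_pmf_comp)
  also have "\<dots> = bind_pmf (kernel_list \<kappa> as) (\<lambda>bs. map_pmf (\<lambda>cs. map snd (zip bs cs)) (kernel_list \<eta> (zip as bs)))"
    by (simp add: map_bind_pmf map_pmf_comp)
  also have "\<dots> = bind_pmf (kernel_list \<kappa> as) (\<lambda>bs. kernel_list \<eta> (zip as bs))"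
    by (intro bind_pmf_cong refl map_pmf_idI) (auto dest!: length_kernel_list simp: map_snd_zip)
  finally show ?thesis by simp
qed

lemma bind_iid:
  "bind_pmf (iid N p) (\<lambda>as. map_pmf (zip as) (kernel_list \<kappa> as))
   = iid N (bind_pmf p (\<lambda>a. map_pmf (Pair a) (\<kappa> a)))"
proof (induction N)
  case (Suc N)
  have "bind_pmf (iid (Suc N) p) (\<lambda>as. map_pmf (zip as) (kernel_list \<kappa> as))
   = bind_pmf p (\<lambda>a. bind_pmf (iid N p) (\<lambda>as. bind_pmf (\<kappa> a) (\<lambda>b. map_pmf (\<lambda>bs. (a, b) # zip as bs) (kernel_list \<kappa> as))))"
    by (simp add: bind_assoc_pmf bind_map_pmf map_bind_pmf map_pmf_comp)
  also have "\<dots> = bind_pmf p (\<lambda>a. bind_pmf (\<kappa> a) (\<lambda>b. bind_pmf (iid N p) (\<lambda>as. map_pmf (\<lambda>bs. (a, b) # zip as bs) (kernel_list \<kappa> as))))"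
    by (subst bind_commute_pmf) (rule refl)
  also have "\<dots> = bind_pmf p (\<lambda>a. bind_pmf (\<kappa> a) (\<lambda>b. map_pmf (Cons (a, b))
     (bind_pmf (iid N p) (\<lambda>as. map_pmf (zip as) (kernel_list \<kappa> as)))))"
    by (simp add: map_bind_pmf map_pmf_comp)
  also have "\<dots> = iid (Suc N) (bind_pmf p (\<lambda>a. map_pmf (Pair a) (\<kappa> a)))"
    by (simp add: Suc.IH bind_assoc_pmf bind_map_pmf)
  finally show ?case .
qed (simp add: bind_return_pmf)

lemma map_iid: "map_pmf (map f) (iid N p) = iid N (map_pmf f p)"
  by (simp add: iid_def map_kernel_list)

lemma bind_iid_snd: "bind_pmf (iid N p) (kernel_list \<kappa>) = iid N (bind_pmf p \<kappa>)"
proof -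
  have "iid N (bind_pmf p \<kappa>) = map_pmf (map snd) (iid N (bind_pmf p (\<lambda>a. map_pmf (Pair a) (\<kappa> a))))"
    by (simp add: map_iid map_bind_pmf map_pmf_comp)
  also have "\<dots> = bind_pmf (iid N p) (\<lambda>as. map_pmf (\<lambda>bs. map snd (zip as bs)) (kernel_list \<kappa> as))"
    by (simp flip: bind_iid add: map_bind_pmf map_pmf_comp)
  also have "\<dots> = bind_pmf (iid N p) (kernel_list \<kappa>)"
    by (intro bind_pmf_cong refl map_pmf_idI) (auto dest!: length_kernel_list simp: map_snd_zip)
  finally show ?thesis by simp
qed

text \<open>Bounds the probability that one of \<open>c\<close> independent copies of \<open>u\<close> given \<open>v\<close>
  coincides with the original, or the probability that \<open>\<kappa> v\<close> gives \<open>u\<close> a mass above \<open>1/c\<close>.\<close>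

definition collision :: "'v pmf \<Rightarrow> ('v \<Rightarrow> 'u pmf) \<Rightarrow> real \<Rightarrow> real" where
  "collision p \<kappa> c = EV p (\<lambda>v. EV (\<kappa> v) (\<lambda>u. min 1 (c * pmf (\<kappa> v) u)))"

lemma min_one_le_powr:
  fixes x :: real
  assumes "0 \<le> x" "0 < \<rho>" "\<rho> \<le> 1"
  shows "min 1 x \<le> x powr \<rho>"
proof (cases "x \<le> 1")
  case True
  then have "x powr 1 \<le> x powr \<rho>" using powr_mono'[of \<rho> 1 x] assms by simp
  moreover have "min 1 x = x powr 1" using True assms by simp
  ultimately show ?thesis by simp
next
  case False
  then show ?thesis using assms by (simp add: ge_one_powr_ge_zero)
qed

lemma collision_iid_le:
  assumes fp: "finite (set_pmf p)" and fk: "\<And>v. v \<in> set_pmf p \<Longrightarrow> finite (set_pmf (\<kappa> v))"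
    and \<rho>: "0 < \<rho>" "\<rho> \<le> 1" and c: "0 \<le> c"
  shows "collision (iid N p) (kernel_list \<kappa>) c
    \<le> c powr \<rho> * EV p (\<lambda>v. EV (\<kappa> v) (\<lambda>u. pmf (\<kappa> v) u powr \<rho>)) ^ N"
proof -
  have fi: "finite (set_pmf (iid N p))" for N using finite_iid[OF fp] .
  have fl: "finite (set_pmf (kernel_list \<kappa> vs))" if "vs \<in> set_pmf (iid N p)" for vs N
    using set_iid[OF that] fk by (intro finite_kernel_list) auto
  let ?F = "\<lambda>vs. EV (kernel_list \<kappa> vs) (\<lambda>us. pmf (kernel_list \<kappa> vs) us powr \<rho>)"
  let ?f = "\<lambda>v. EV (\<kappa> v) (\<lambda>u. pmf (\<kappa> v) u powr \<rho>)"
  have E: "EV (iid N p) ?F = EV p ?f ^ N"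
  proof (induction N)
    case (Suc N)
    have step: "?F (v # vs) = ?f v * ?F vs" if v: "v \<in> set_pmf p" and vs: "vs \<in> set_pmf (iid N p)" for v vs
    proof -
      have "?F (v # vs) = EV (\<kappa> v) (\<lambda>u. EV (kernel_list \<kappa> vs)
          (\<lambda>us. pmf (kernel_list \<kappa> (v # vs)) (u # us) powr \<rho>))"
        using fk[OF v] fl[OF vs] unfolding kernel_list.simps(2)
        by (subst EV_bind) auto
      also have "\<dots> = EV (\<kappa> v) (\<lambda>u. pmf (\<kappa> v) u powr \<rho> * ?F vs)"
        unfolding pmf_kernel_list_Cons by (simp add: powr_mult)
      finally show ?thesis by simp
    qed
    have "EV (iid (Suc N) p) ?F
      = EV p (\<lambda>v. EV (iid N p) (\<lambda>vs. ?F (v # vs)))"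
      using fp fi by (simp add: EV_bind del: kernel_list.simps)
    also have "\<dots> = EV p (\<lambda>v. EV (iid N p) (\<lambda>vs. ?f v * ?F vs))"
      using step by (intro EV_cong refl)
    also have "\<dots> = EV p ?f * EV (iid N p) ?F" by simp
    finally show ?case using Suc.IH by simp
  qed simp
  have "collision (iid N p) (kernel_list \<kappa>) c \<le> EV (iid N p) (\<lambda>vs. c powr \<rho> * ?F vs)"
    unfolding collision_def
  proof (rule EV_mono[OF fi])
    fix vs assume vs: "vs \<in> set_pmf (iid N p)"
    have "EV (kernel_list \<kappa> vs) (\<lambda>u. min 1 (c * pmf (kernel_list \<kappa> vs) u))
      \<le> EV (kernel_list \<kappa> vs) (\<lambda>u. c powr \<rho> * pmf (kernel_list \<kappa> vs) u powr \<rho>)"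
    proof (rule EV_mono[OF fl[OF vs]])
      fix u
      show "min 1 (c * pmf (kernel_list \<kappa> vs) u) \<le> c powr \<rho> * pmf (kernel_list \<kappa> vs) u powr \<rho>"
        using min_one_le_powr[of "c * pmf (kernel_list \<kappa> vs) u" \<rho>] c \<rho> by (simp add: powr_mult)
    qed
    then show "EV (kernel_list \<kappa> vs) (\<lambda>u. min 1 (c * pmf (kernel_list \<kappa> vs) u)) \<le> c powr \<rho> * ?F vs"
      by simp
  qed
  then show ?thesis using E by simp
qed

text \<open>At \<open>\<rho> = 0\<close> the expectation is one and its derivative is the mean of
  \<open>ln g\<close>, which is negative; so a small positive exponent works.\<close>

lemma ex_powr_expectation_less_one:
  fixes g :: "'s \<Rightarrow> real"
  assumes fin: "finite (set_pmf j)" and pos: "\<And>s. s \<in> set_pmf j \<Longrightarrow> 0 < g s"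
    and neg: "EV j (\<lambda>s. ln (g s)) < 0"
  shows "\<exists>\<rho>. 0 < \<rho> \<and> \<rho> \<le> 1 \<and> EV j (\<lambda>s. g s powr \<rho>) < 1"
proof -
  define f where "f = (\<lambda>\<rho>. \<Sum>s\<in>set_pmf j. pmf j s * exp (\<rho> * ln (g s)))"
  have f: "EV j (\<lambda>s. g s powr \<rho>) = f \<rho>" for \<rho>
    using fin pos by (auto simp: EV_finite f_def powr_def intro!: sum.cong) (metis less_irrefl)
  have "(f has_real_derivative (\<Sum>s\<in>set_pmf j. pmf j s * ln (g s))) (at 0)"
    unfolding f_def by (auto intro!: derivative_eq_intros simp: mult.commute)
  moreover have "(\<Sum>s\<in>set_pmf j. pmf j s * ln (g s)) < 0" using neg fin by (simp add: EV_finite)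
  ultimately obtain d where d: "0 < d" "\<And>h. 0 < h \<Longrightarrow> h < d \<Longrightarrow> f (0 + h) < f 0"
    using DERIV_neg_dec_right by blast
  have "f 0 = 1" using fin by (simp add: f_def sum_pmf_eq_1)
  then have "f (min 1 (d / 2)) < 1" using d(2)[of "min 1 (d / 2)"] d(1) by simp
  then show ?thesis using d(1) f by (intro exI[of _ "min 1 (d / 2)"]) auto
qed

text \<open>Chernoff's method: for \<open>g = 2 powr a * pmf\<close> the mean of \<open>ln g\<close>
  is \<open>ln 2\<close> times the difference of \<open>a\<close> and the conditional entropy, so a
  rate \<open>a\<close> below this entropy gives geometric decay in \<open>N\<close>.
  \<open>C\<close> absorbs the rounding of codebook sizes.\<close>

theorem collision_tendsto_0:
  assumes fp: "finite (set_pmf p)" and fk: "\<And>v. v \<in> set_pmf p \<Longrightarrow> finite (set_pmf (\<kappa> v))"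
    and a: "a < EV p (\<lambda>v. entropy_pmf (\<kappa> v) (\<lambda>u. u))"
    and c: "\<And>N. 0 \<le> c N" "\<And>N. c N \<le> C * 2 powr (real N * a)" and C: "0 < C"
  shows "(\<lambda>N. collision (iid N p) (kernel_list \<kappa>) (c N)) \<longlonglongrightarrow> 0"
proof -
  define j where "j = bind_pmf p (\<lambda>v. map_pmf (Pair v) (\<kappa> v))"
  define g where "g = (\<lambda>(v, u). 2 powr a * pmf (\<kappa> v) u)"
  have fj: "finite (set_pmf j)" unfolding j_def using fp fk by auto
  have gpos: "0 < g s" if "s \<in> set_pmf j" for s
    using that by (auto simp: j_def g_def pmf_positive)
  have Ej: "EV j h = EV p (\<lambda>v. EV (\<kappa> v) (\<lambda>u. h (v, u)))"
    for h :: "_ \<Rightarrow> real"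
    unfolding j_def using fp fk by (subst EV_bind) auto
  have "EV j (\<lambda>s. ln (g s))
     = EV j (\<lambda>s. ln 2 * (a - (- log 2 (pmf (\<kappa> (fst s)) (snd s)))))"
  proof (intro EV_cong refl)
    fix s assume "s \<in> set_pmf j"
    then have "0 < pmf (\<kappa> (fst s)) (snd s)" by (auto simp: j_def pmf_positive)
    then show "ln (g s) = ln 2 * (a - (- log 2 (pmf (\<kappa> (fst s)) (snd s))))"
      by (simp add: g_def case_prod_beta ln_mult log_def ln_powr field_simps)
  qed
  also have "\<dots> = ln 2 * (a - EV j (\<lambda>s. - log 2 (pmf (\<kappa> (fst s)) (snd s))))"
    using fj by (subst Bochner_Integration.integral_mult_right_zero, subst Bochner_Integration.integral_diff) auto
  also have "EV j (\<lambda>s. - log 2 (pmf (\<kappa> (fst s)) (snd s)))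
     = EV p (\<lambda>v. entropy_pmf (\<kappa> v) (\<lambda>u. u))"
    unfolding Ej by (intro EV_cong refl) (use fk in \<open>simp add: entropy_pmf_expectation\<close>)
  finally have "EV j (\<lambda>s. ln (g s)) < 0" using a by (simp add: mult_pos_neg)
  then obtain \<rho> where \<rho>: "0 < \<rho>" "\<rho> \<le> 1" "EV j (\<lambda>s. g s powr \<rho>) < 1"
    using ex_powr_expectation_less_one[of j g, OF fj gpos] by blast
  define \<theta> where "\<theta> = EV p (\<lambda>v. EV (\<kappa> v) (\<lambda>u. pmf (\<kappa> v) u powr \<rho>))"
  have g\<theta>: "EV j (\<lambda>s. g s powr \<rho>) = 2 powr (a * \<rho>) * \<theta>"
    unfolding Ej \<theta>_def g_def by (simp add: powr_mult powr_powr)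
  have \<theta>0: "0 \<le> \<theta>" unfolding \<theta>_def by (intro EV_nonneg) auto
  have le: "collision (iid N p) (kernel_list \<kappa>) (c N) \<le> C powr \<rho> * (2 powr (a * \<rho>) * \<theta>) ^ N" for N
  proof -
    have "collision (iid N p) (kernel_list \<kappa>) (c N) \<le> c N powr \<rho> * \<theta> ^ N"
      unfolding \<theta>_def by (rule collision_iid_le[OF fp fk \<rho>(1,2) c(1)])
    also have "\<dots> \<le> (C * 2 powr (real N * a)) powr \<rho> * \<theta> ^ N"
      using c[of N] \<rho> \<theta>0 by (intro mult_right_mono powr_mono2) auto
    also have "\<dots> = C powr \<rho> * (2 powr (a * \<rho>) * \<theta>) ^ N"
      using C by (simp add: powr_mult powr_powr power_mult_distrib powr_power mult_ac)
    finally show ?thesis .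
  qed
  have nonneg: "0 \<le> collision (iid N p) (kernel_list \<kappa>) (c N)" for N
    unfolding collision_def using c by (intro EV_nonneg) auto
  have "(\<lambda>N. C powr \<rho> * (2 powr (a * \<rho>) * \<theta>) ^ N) \<longlonglongrightarrow> C powr \<rho> * 0"
    using \<rho>(3) \<theta>0 unfolding g\<theta> by (intro tendsto_mult tendsto_const LIMSEQ_power_zero) auto
  then have lim: "(\<lambda>N. C powr \<rho> * (2 powr (a * \<rho>) * \<theta>) ^ N) \<longlonglongrightarrow> 0" by simp
  show ?thesis
  proof (rule tendsto_sandwich[OF _ _ tendsto_const lim])
    show "\<forall>\<^sub>F N in sequentially. 0 \<le> collision (iid N p) (kernel_list \<kappa>) (c N)"
      using nonneg by (intro always_eventually allI)
    show "\<forall>\<^sub>F N in sequentially. collision (iid N p) (kernel_list \<kappa>) (c N) \<le> C powr \<rho> * (2 powr (a * \<rho>) * \<theta>) ^ N"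
      using le by (intro always_eventually allI)
  qed
qed

section \<open>One block of the coding scheme\<close>

lemma PR_eq_EV:
  "PR p {x. Q x} = EV p (\<lambda>x. if Q x then 1 else 0)"
proof -
  have "EV p (\<lambda>x. if Q x then 1 else 0 :: real) = EV p (indicator {x. Q x})"
    by (intro EV_cong refl) (simp add: indicator_def)
  then show ?thesis by simp
qed

lemma PR_union_le:
  assumes "finite J"
  shows "PR p {x. \<exists>j\<in>J. Q j x} \<le> (\<Sum>j\<in>J. PR p {x. Q j x})"
proof -
  have "{x. \<exists>j\<in>J. Q j x} = (\<Union>j\<in>J. {x. Q j x})" by auto
  then show ?thesis using measure_pmf.finite_measure_subadditive_finite[OF assms, of "\<lambda>j. {x. Q j x}" p] by simp
qed

lemma PR_mono:
  assumes "\<And>x. x \<in> set_pmf p \<Longrightarrow> Q x \<Longrightarrow> R x"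
  shows "PR p {x. Q x} \<le> PR p {x. R x}"
  using assms by (intro measure_pmf.finite_measure_mono_AE AE_pmfI) auto

lemma PR_or_le:
  "PR p {x. Q x \<or> R x} \<le> PR p {x. Q x} + PR p {x. R x}"
proof -
  have "{x. Q x \<or> R x} = {x. Q x} \<union> {x. R x}" by auto
  then show ?thesis using measure_Un_le[of "{x. Q x}" p "{x. R x}"] by simp
qed

section \<open>Independent random functions\<close>

lemma finite_Pi_pmf:
  assumes "finite A" "finite (set_pmf p)"
  shows "finite (set_pmf (Pi_pmf A d (\<lambda>_. p)))"
  using assms by (auto simp: set_Pi_pmf)

lemma Pi_pmf_in_set:
  assumes "finite A" "f \<in> set_pmf (Pi_pmf A d (\<lambda>_. p))" "i \<in> A"
  shows "f i \<in> set_pmf p"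
  using assms by (auto simp: set_Pi_pmf PiE_dflt_def)

lemma EV_Pi_component:
  assumes "finite A" "i \<in> A"
  shows "EV (Pi_pmf A d (\<lambda>_. p)) (\<lambda>f. g (f i)) = EV p (g :: _ \<Rightarrow> real)"
proof -
  have "EV (Pi_pmf A d (\<lambda>_. p)) (\<lambda>f. g (f i))
    = EV (map_pmf (\<lambda>f. f i) (Pi_pmf A d (\<lambda>_. p))) g" by simp
  also have "map_pmf (\<lambda>f. f i) (Pi_pmf A d (\<lambda>_. p)) = p"
    using assms by (simp add: Pi_pmf_component)
  finally show ?thesis .
qed

lemma PR_Pi_component:
  assumes "finite A" "i \<in> A"
  shows "PR (Pi_pmf A d (\<lambda>_. p)) {f. Q (f i)} = PR p {x. Q x}"
  unfolding PR_eq_EV using EV_Pi_component[OF assms] .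

lemma Pi_pmf_split:
  assumes "finite A" "i \<in> A"
  shows "Pi_pmf A d (\<lambda>_. p) = bind_pmf p (\<lambda>x. map_pmf (\<lambda>f. f(i := x)) (Pi_pmf (A - {i}) d (\<lambda>_. p)))"
proof -
  have "A = insert i (A - {i})" using assms by auto
  then have "Pi_pmf A d (\<lambda>_. p) = Pi_pmf (insert i (A - {i})) d (\<lambda>_. p)" by simp
  also have "\<dots> = bind_pmf p (\<lambda>x. map_pmf (\<lambda>f. f(i := x)) (Pi_pmf (A - {i}) d (\<lambda>_. p)))"
    using assms by (subst Pi_pmf_insert') (auto simp: map_pmf_def)
  finally show ?thesis .
qed

lemma EV_Pi_split:
  fixes g :: "_ \<Rightarrow> real"
  assumes "finite A" "i \<in> A" "finite (set_pmf p)"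
  shows "EV (Pi_pmf A d (\<lambda>_. p)) g
   = EV p (\<lambda>x. EV (Pi_pmf (A - {i}) d (\<lambda>_. p)) (\<lambda>f. g (f(i := x))))"
  unfolding Pi_pmf_split[OF assms(1,2)]
  using assms by (subst EV_bind) (auto intro!: finite_Pi_pmf)

lemma EV_Pi_two:
  fixes g :: "_ \<Rightarrow> _ \<Rightarrow> real"
  assumes "finite A" "i \<in> A" "j \<in> A" "i \<noteq> j" "finite (set_pmf p)"
  shows "EV (Pi_pmf A d (\<lambda>_. p)) (\<lambda>f. g (f i) (f j))
   = EV p (\<lambda>x. EV p (g x))"
  unfolding EV_Pi_split[OF assms(1,2,5)]
  using assms by (simp add: EV_Pi_component)

text \<open>One use of an abstract channel; words are put in for its letters later. \<open>L\<close>
  is the size of the interference list and \<open>K\<close> the number of clouds. By the assumption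
  \<open>t1\<close>, an input drawn from \<open>PX1 w t\<close> causes exactly the interference
  \<open>t\<close>, so receiver 2 meets only entries of the list.\<close>

locale block_code =
  fixes PW :: "'w pmf" and PT :: "'w \<Rightarrow> 't pmf" and PX1 :: "'w \<Rightarrow> 't \<Rightarrow> 'x1 pmf" and PX2 :: "'w \<Rightarrow> 'x2 pmf"
    and y1 :: "'x1 \<Rightarrow> 'y1" and t1 :: "'x1 \<Rightarrow> 't" and y2 :: "'x2 \<Rightarrow> 't \<Rightarrow> 'y2" and z2 :: "'x2 \<Rightarrow> 'z2"
    and M1 M2 L K :: nat
  assumes fW: "finite (set_pmf PW)" and fT: "\<And>w. finite (set_pmf (PT w))"
    and fX1: "\<And>w t. finite (set_pmf (PX1 w t))" and fX2: "\<And>w. finite (set_pmf (PX2 w))"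
    and pos: "0 < M1" "0 < M2" "0 < L" "0 < K"
    and t1: "\<And>w t x. t \<in> set_pmf (PT w) \<Longrightarrow> x \<in> set_pmf (PX1 w t) \<Longrightarrow> t1 x = t"
begin

definition "YZ x t = (y2 x t, z2 x)"
definition "PYZT w t = map_pmf (\<lambda>x. YZ x t) (PX2 w)"
definition "PYZ w = bind_pmf (PT w) (PYZT w)"
definition "PY2 = bind_pmf PW (\<lambda>w. map_pmf fst (PYZ w))"
definition "PWT = bind_pmf PW (\<lambda>w. map_pmf (Pair w) (PT w))"

text \<open>The finite set of cribbing signals that can occur, on which the random hash is an
  independent family.\<close>

definition "ZS = (\<Union>w\<in>set_pmf PW. z2 ` set_pmf (PX2 w))"

text \<open>A cloud collects the random objects attached to one value of the index shared by both
  encoders: the sequence \<open>w\<close>, the codewords of sender 2, the interference codewords, and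
  the hash of the cribbing signal that determines the index used in the next block.\<close>

definition "cw_pmf w = Pi_pmf {..<M2} undefined (\<lambda>_. PX2 w)"
definition "ct_pmf w = Pi_pmf {..<L} undefined (\<lambda>_. PT w)"
definition "hash_pmf = Pi_pmf ZS 0 (\<lambda>_. pmf_of_set {..<K})"
definition "inner_pmf w = pair_pmf (cw_pmf w) (pair_pmf (ct_pmf w) hash_pmf)"
definition "cloud_pmf = bind_pmf PW (\<lambda>w. map_pmf (Pair w) (inner_pmf w))"
definition "codebook_pmf = Pi_pmf {..<K} undefined (\<lambda>_. cloud_pmf)"

definition "cW = (\<lambda>(w :: 'w, f :: nat \<Rightarrow> 'x2, t :: nat \<Rightarrow> 't, h :: 'z2 \<Rightarrow> nat). w)"
definition "cX = (\<lambda>(w :: 'w, f :: nat \<Rightarrow> 'x2, t :: nat \<Rightarrow> 't, h :: 'z2 \<Rightarrow> nat). f)"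
definition "cT = (\<lambda>(w :: 'w, f :: nat \<Rightarrow> 'x2, t :: nat \<Rightarrow> 't, h :: 'z2 \<Rightarrow> nat). t)"
definition "cH = (\<lambda>(w :: 'w, f :: nat \<Rightarrow> 'x2, t :: nat \<Rightarrow> 't, h :: 'z2 \<Rightarrow> nat). h)"

lemma c_simps [simp]: "cW (w, f, t, h) = w" "cX (w, f, t, h) = f" "cT (w, f, t, h) = t" "cH (w, f, t, h) = h"
  by (auto simp: cW_def cX_def cT_def cH_def)

definition "matches c m l k y \<longleftrightarrow> y2 (cX c m) (cT c l) = y \<and> cH c (z2 (cX c m)) = k"

text \<open>The hash of the true codeword is available to receiver 2 from the following block. A
  wrong list index with the right \<open>(k, m)\<close> is no confusion.\<close>

definition "confused C k0 m t \<longleftrightarrow> (\<exists>k<K. \<exists>m'<M2. (k, m') \<noteq> (k0, m) \<and>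
   (\<exists>l<L. matches (C k) m' l (cH (C k0) (z2 (cX (C k0) m))) (y2 (cX (C k0) m) t)))"

section \<open>Errors of receiver 2\<close>

lemma finZS: "finite ZS" unfolding ZS_def using fW fX2 by auto

lemma K_set: "finite {..<K}" "{..<K} \<noteq> {}" using pos by auto

lemma fcw [simp]: "finite (set_pmf (cw_pmf w))" unfolding cw_pmf_def using fX2 by (intro finite_Pi_pmf) auto
lemma fct [simp]: "finite (set_pmf (ct_pmf w))" unfolding ct_pmf_def using fT by (intro finite_Pi_pmf) auto
lemma fhash [simp]: "finite (set_pmf hash_pmf)" unfolding hash_pmf_def using finZS K_set by (intro finite_Pi_pmf) auto
lemma finner [simp]: "finite (set_pmf (inner_pmf w))" unfolding inner_pmf_def by simp
lemma fcloud [simp]: "finite (set_pmf cloud_pmf)" unfolding cloud_pmf_def using fW by auto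
lemma fcodebook [simp]: "finite (set_pmf codebook_pmf)" unfolding codebook_pmf_def by (intro finite_Pi_pmf) auto

lemma inner_expectation:
  fixes g :: "_ \<Rightarrow> real"
  shows "EV (inner_pmf w) g = EV (cw_pmf w) (\<lambda>f.
    EV (ct_pmf w) (\<lambda>t. EV hash_pmf (\<lambda>h. g (f, t, h))))"
  unfolding inner_pmf_def by (simp add: EV_pair)

lemma cloud_expectation:
  fixes g :: "_ \<Rightarrow> real"
  shows "EV cloud_pmf g = EV PW (\<lambda>w.
    EV (inner_pmf w) (\<lambda>s. g (w, s)))"
  unfolding cloud_pmf_def using fW by (subst EV_bind) auto

lemma hash_value:
  assumes "z \<in> ZS"
  shows "PR hash_pmf {h. h z = k} \<le> 1 / K"
proof -
  have "PR hash_pmf {h. h z = k} = PR (pmf_of_set {..<K}) {x. x = k}"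
    unfolding hash_pmf_def using PR_Pi_component[OF finZS assms, where Q="\<lambda>x. x = k"] .
  also have "\<dots> = pmf (pmf_of_set {..<K}) k" by (simp add: measure_pmf_single)
  also have "\<dots> \<le> 1 / K" using K_set by (simp add: indicator_def)
  finally show ?thesis .
qed

lemma hash_collision:
  assumes "z \<in> ZS" "z' \<in> ZS" "z \<noteq> z'"
  shows "PR hash_pmf {h. h z' = h z} \<le> 1 / K"
proof -
  have "PR hash_pmf {h. h z' = h z}
    = EV (pmf_of_set {..<K}) (\<lambda>k. EV (pmf_of_set {..<K}) (\<lambda>k'. if k' = k then 1 else 0))"
    unfolding PR_eq_EV hash_pmf_def
    using EV_Pi_two[OF finZS assms(1,2,3), where p="pmf_of_set {..<K}" and g="\<lambda>k k'. if k' = k then 1 else 0"] K_set by simp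
  also have "\<dots> \<le> 1 / K"
  proof (rule EV_le_const)
    fix k
    have "EV (pmf_of_set {..<K}) (\<lambda>k'. if k' = k then 1 else 0) = pmf (pmf_of_set {..<K}) k"
      unfolding PR_eq_EV[symmetric] by (simp add: measure_pmf_single)
    then show "EV (pmf_of_set {..<K}) (\<lambda>k'. if k' = k then 1 else 0) \<le> 1 / K"
      using K_set by (simp add: indicator_def)
  qed (use K_set in simp)
  finally show ?thesis .
qed

lemma cw_in: "f \<in> set_pmf (cw_pmf w) \<Longrightarrow> m < M2 \<Longrightarrow> f m \<in> set_pmf (PX2 w)"
  unfolding cw_pmf_def by (rule Pi_pmf_in_set) auto

lemma ct_in: "t \<in> set_pmf (ct_pmf w) \<Longrightarrow> l < L \<Longrightarrow> t l \<in> set_pmf (PT w)"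
  unfolding ct_pmf_def by (rule Pi_pmf_in_set) auto

lemma z_in_ZS: "w \<in> set_pmf PW \<Longrightarrow> f \<in> set_pmf (cw_pmf w) \<Longrightarrow> m < M2 \<Longrightarrow> z2 (f m) \<in> ZS"
  unfolding ZS_def using cw_in by blast

lemma E_cw: "m < M2 \<Longrightarrow> EV (cw_pmf w) (\<lambda>f. g (f m)) = EV (PX2 w) (g :: _ \<Rightarrow> real)"
  unfolding cw_pmf_def by (rule EV_Pi_component) auto

lemma E_ct: "l < L \<Longrightarrow> EV (ct_pmf w) (\<lambda>t. g (t l)) = EV (PT w) (g :: _ \<Rightarrow> real)"
  unfolding ct_pmf_def by (rule EV_Pi_component) auto

lemma E_PYZT: "EV (PYZT w \<tau>) g = EV (PX2 w) (\<lambda>x. (g (YZ x \<tau>) :: real))"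
  by (simp add: PYZT_def)

lemma fPYZT [simp]: "finite (set_pmf (PYZT w \<tau>))" unfolding PYZT_def using fX2 by simp

lemma E_PYZ: "EV (PYZ w) g
   = EV (PT w) (\<lambda>\<tau>. EV (PX2 w) (\<lambda>x. (g (YZ x \<tau>) :: real)))"
  unfolding PYZ_def using fT by (subst EV_bind) (auto simp: E_PYZT)

lemma fPYZ [simp]: "finite (set_pmf (PYZ w))" unfolding PYZ_def using fT by auto

lemma pmf_as_expectation: "pmf p u = EV p (\<lambda>x. if x = u then 1 else 0)"
  unfolding PR_eq_EV[symmetric] by (simp add: measure_pmf_single)

lemma E_PY2: "EV PY2 g = EV PW (\<lambda>w.
   EV (PT w) (\<lambda>\<tau>. EV (PX2 w) (\<lambda>x. (g (y2 x \<tau>) :: real))))"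
  unfolding PY2_def using fW by (subst EV_bind) (auto simp: E_PYZ YZ_def)

lemma pmf_PY2: "pmf PY2 y = EV PW (\<lambda>w. EV (PX2 w) (\<lambda>x.
   EV (PT w) (\<lambda>\<tau>. if y2 x \<tau> = y then 1 else 0)))"
proof -
  have "pmf PY2 y = EV PY2 (\<lambda>u. if u = y then 1 else 0)" by (rule pmf_as_expectation)
  also have "\<dots> = EV PW (\<lambda>w. EV (PT w) (\<lambda>\<tau>.
   EV (PX2 w) (\<lambda>x. if y2 x \<tau> = y then 1 else 0)))"
    unfolding E_PY2 ..
  finally show ?thesis
    using EV_swap[OF fT fX2] by simp
qed

text \<open>The hash of a cloud is independent of its codewords and its list, so agreement with a
  prescribed hash value costs a factor \<open>1 / K\<close>.\<close>

lemma match_prob: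
  assumes "m < M2" "l < L"
  shows "PR cloud_pmf {c. matches c m l k y} \<le> pmf PY2 y / K"
proof -
  have "PR cloud_pmf {c. matches c m l k y}
    = EV PW (\<lambda>w. EV (cw_pmf w) (\<lambda>f. EV (ct_pmf w) (\<lambda>t.
        EV hash_pmf (\<lambda>h. if y2 (f m) (t l) = y \<and> h (z2 (f m)) = k then 1 else 0))))"
    unfolding PR_eq_EV cloud_expectation inner_expectation by (simp add: matches_def)
  also have "\<dots> \<le> EV PW (\<lambda>w. EV (cw_pmf w) (\<lambda>f. EV (ct_pmf w) (\<lambda>t.
        (if y2 (f m) (t l) = y then 1 else 0) * (1 / K))))"
  proof (intro EV_mono fW fcw fct)
    fix w f t assume w: "w \<in> set_pmf PW" and f: "f \<in> set_pmf (cw_pmf w)"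
    show "EV hash_pmf (\<lambda>h. if y2 (f m) (t l) = y \<and> h (z2 (f m)) = k then 1 else 0)
      \<le> (if y2 (f m) (t l) = y then 1 else 0) * (1 / K)"
      using hash_value[OF z_in_ZS[OF w f assms(1)], of k] by (simp add: PR_eq_EV)
  qed
  also have "\<dots> = EV PW (\<lambda>w. EV (PX2 w) (\<lambda>x. EV (PT w) (\<lambda>\<tau>.
        (if y2 x \<tau> = y then 1 else 0) * (1 / K))))"
    unfolding E_ct[OF assms(2), where g="\<lambda>\<tau>. (if y2 _ \<tau> = y then 1 else 0) * (1 / K)"]
      E_cw[OF assms(1), where g="\<lambda>x. EV (PT _) (\<lambda>\<tau>. (if y2 x \<tau> = y then 1 else 0) * (1 / K))"] ..
  also have "\<dots> = pmf PY2 y / K" unfolding pmf_PY2 by simp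
  finally show ?thesis .
qed

text \<open>Another cloud is independent of the transmitted one. Fewer than
  \<open>K * M2 * L\<close> candidates meet the match probability \<open>pmf PY2 y / K\<close>, so
  the number of clouds cancels and only \<open>M2 * L\<close> competes with
  \<open>H(Y2)\<close>.\<close>

lemma other_cloud_error:
  assumes k0: "k0 < K" and m: "m < M2" and l: "l < L"
  shows "PR codebook_pmf {C. \<exists>k\<in>{..<K} - {k0}. \<exists>m'<M2. \<exists>l'<L.
     matches (C k) m' l' (cH (C k0) (z2 (cX (C k0) m))) (y2 (cX (C k0) m) (cT (C k0) l))}
   \<le> collision (return_pmf ()) (\<lambda>_. PY2) (real M2 * real L)"
proof -
  let ?R = "{..<K} - {k0}"
  let ?rest = "Pi_pmf ?R undefined (\<lambda>_. cloud_pmf)"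
  have one: "PR ?rest {C. \<exists>k\<in>?R. \<exists>m'<M2. \<exists>l'<L. matches (C k) m' l' \<kappa> y} \<le> min 1 (real M2 * real L * pmf PY2 y)"
    for \<kappa> y
  proof -
    let ?J = "?R \<times> ({..<M2} \<times> {..<L})"
    have "PR ?rest {C. \<exists>k\<in>?R. \<exists>m'<M2. \<exists>l'<L. matches (C k) m' l' \<kappa> y}
      \<le> PR ?rest {C. \<exists>j\<in>?J. matches (C (fst j)) (fst (snd j)) (snd (snd j)) \<kappa> y}"
      by (intro PR_mono) force
    also have "\<dots> \<le> (\<Sum>j\<in>?J. PR ?rest {C. matches (C (fst j)) (fst (snd j)) (snd (snd j)) \<kappa> y})"
      by (rule PR_union_le) auto
    also have "\<dots> \<le> (\<Sum>j\<in>?J. pmf PY2 y / K)"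
    proof (rule sum_mono)
      fix j assume j: "j \<in> ?J"
      have "PR ?rest {C. matches (C (fst j)) (fst (snd j)) (snd (snd j)) \<kappa> y}
        = PR cloud_pmf {c. matches c (fst (snd j)) (snd (snd j)) \<kappa> y}"
        using j by (intro PR_Pi_component) auto
      also have "\<dots> \<le> pmf PY2 y / K" using j by (intro match_prob) auto
      finally show "PR ?rest {C. matches (C (fst j)) (fst (snd j)) (snd (snd j)) \<kappa> y} \<le> pmf PY2 y / K" .
    qed
    also have "\<dots> = real (card ?R) * (real M2 * real L) * (pmf PY2 y / K)" by (simp add: card_cartesian_product)
    also have "\<dots> \<le> real K * (real M2 * real L) * (pmf PY2 y / K)"
      using card_mono[of "{..<K}" ?R] by (intro mult_right_mono) auto
    also have "\<dots> = real M2 * real L * pmf PY2 y" using pos by simp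
    finally show ?thesis by simp
  qed
  have "PR codebook_pmf {C. \<exists>k\<in>?R. \<exists>m'<M2. \<exists>l'<L.
     matches (C k) m' l' (cH (C k0) (z2 (cX (C k0) m))) (y2 (cX (C k0) m) (cT (C k0) l))}
    = EV cloud_pmf (\<lambda>c. PR ?rest {C. \<exists>k\<in>?R. \<exists>m'<M2. \<exists>l'<L.
         matches (C k) m' l' (cH c (z2 (cX c m))) (y2 (cX c m) (cT c l))})"
  proof -
    have k0': "k0 \<in> {..<K}" using k0 by simp
    have *: "(\<exists>k\<in>?R. \<exists>m'<M2. \<exists>l'<L. matches ((C(k0 := c)) k) m' l' (cH ((C(k0 := c)) k0) (z2 (cX ((C(k0 := c)) k0) m)))
        (y2 (cX ((C(k0 := c)) k0) m) (cT ((C(k0 := c)) k0) l)))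
      \<longleftrightarrow> (\<exists>k\<in>?R. \<exists>m'<M2. \<exists>l'<L. matches (C k) m' l' (cH c (z2 (cX c m))) (y2 (cX c m) (cT c l)))" for C c by auto
    show ?thesis unfolding PR_eq_EV codebook_pmf_def
        EV_Pi_split[OF finite_lessThan k0' fcloud] * ..
  qed
  also have "\<dots> \<le> EV cloud_pmf (\<lambda>c. min 1 (real M2 * real L * pmf PY2 (y2 (cX c m) (cT c l))))"
    by (intro EV_mono fcloud one)
  also have "\<dots> = EV PW (\<lambda>w. EV (cw_pmf w) (\<lambda>f. EV (ct_pmf w) (\<lambda>t.
       min 1 (real M2 * real L * pmf PY2 (y2 (f m) (t l))))))"
    unfolding cloud_expectation inner_expectation by simp
  also have "\<dots> = EV PW (\<lambda>w. EV (PX2 w) (\<lambda>x. EV (PT w) (\<lambda>\<tau>.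
       min 1 (real M2 * real L * pmf PY2 (y2 x \<tau>)))))"
    unfolding E_ct[OF l, where g="\<lambda>\<tau>. min 1 (real M2 * real L * pmf PY2 (y2 _ \<tau>))"]
      E_cw[OF m, where g="\<lambda>x. EV (PT _) (\<lambda>\<tau>. min 1 (real M2 * real L * pmf PY2 (y2 x \<tau>)))"] ..
  also have "\<dots> = collision (return_pmf ()) (\<lambda>_. PY2) (real M2 * real L)"
    unfolding collision_def expectation_return_pmf E_PY2 using EV_swap[OF fT fX2] by simp
  finally show ?thesis .
qed

text \<open>This is the term that asks for many clouds: \<open>K\<close> must exceed
  \<open>M2\<close> by a growing factor.\<close>

lemma same_cloud_hash:
  assumes w: "w \<in> set_pmf PW" and m: "m < M2"
  shows "PR (inner_pmf w) {(f, t, h). \<exists>m'<M2. z2 (f m') \<noteq> z2 (f m) \<and> h (z2 (f m')) = h (z2 (f m))}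
    \<le> M2 / K"
proof -
  have "PR (inner_pmf w) {(f, t, h). \<exists>m'<M2. z2 (f m') \<noteq> z2 (f m) \<and> h (z2 (f m')) = h (z2 (f m))}
    = EV (cw_pmf w) (\<lambda>f. EV (ct_pmf w) (\<lambda>t.
        PR hash_pmf {h. \<exists>m'<M2. z2 (f m') \<noteq> z2 (f m) \<and> h (z2 (f m')) = h (z2 (f m))}))"
    unfolding PR_eq_EV inner_expectation by simp
  also have "\<dots> \<le> M2 / K"
  proof (intro EV_le_const fcw fct)
    fix f assume f: "f \<in> set_pmf (cw_pmf w)"
    have "PR hash_pmf {h. \<exists>m'<M2. z2 (f m') \<noteq> z2 (f m) \<and> h (z2 (f m')) = h (z2 (f m))}
      \<le> PR hash_pmf {h. \<exists>m'\<in>{..<M2}. z2 (f m') \<noteq> z2 (f m) \<and> h (z2 (f m')) = h (z2 (f m))}"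
      by (intro PR_mono) auto
    also have "\<dots> \<le> (\<Sum>m'\<in>{..<M2}. PR hash_pmf {h. z2 (f m') \<noteq> z2 (f m) \<and> h (z2 (f m')) = h (z2 (f m))})"
      by (rule PR_union_le) simp
    also have "\<dots> \<le> (\<Sum>m'\<in>{..<M2}. 1 / K)"
    proof (rule sum_mono)
      fix m' assume m': "m' \<in> {..<M2}"
      show "PR hash_pmf {h. z2 (f m') \<noteq> z2 (f m) \<and> h (z2 (f m')) = h (z2 (f m))} \<le> 1 / K"
      proof (cases "z2 (f m') = z2 (f m)")
        case False
        then show ?thesis using hash_collision[OF z_in_ZS[OF w f m] z_in_ZS[OF w f, of m']] m' by simp
      qed simp
    qed
    also have "\<dots> = M2 / K" by simp
    finally show "PR hash_pmf {h. \<exists>m'<M2. z2 (f m') \<noteq> z2 (f m) \<and> h (z2 (f m')) = h (z2 (f m))} \<le> M2 / K" .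
  qed
  finally show ?thesis .
qed

text \<open>With both indices different, codeword and list entry are fresh draws given
  \<open>w\<close>, so each competitor has law \<open>PYZ w\<close>. This leads to
  \<open>H(Y2,Z2|W)\<close>.\<close>

lemma same_cloud_both:
  assumes m: "m < M2" and l: "l < L"
  shows "PR (inner_pmf w) {(f, t, h). \<exists>m'\<in>{..<M2} - {m}. \<exists>l'\<in>{..<L} - {l}. YZ (f m') (t l') = YZ (f m) (t l)}
    \<le> EV (PYZ w) (\<lambda>u. min 1 (real M2 * real L * pmf (PYZ w) u))"
proof -
  let ?Q = "\<lambda>f t u. if \<exists>m'\<in>{..<M2} - {m}. \<exists>l'\<in>{..<L} - {l}. YZ (f m') (t l') = u then 1 else 0 :: real"
  let ?MR = "{..<M2} - {m}" and ?LR = "{..<L} - {l}"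
  let ?F = "Pi_pmf ?MR undefined (\<lambda>_. PX2 w)" and ?T = "Pi_pmf ?LR undefined (\<lambda>_. PT w)"
  have fF: "finite (set_pmf ?F)" and fTT: "finite (set_pmf ?T)" using fX2 fT by (intro finite_Pi_pmf; simp)+
  have one: "EV ?F (\<lambda>f. EV ?T (\<lambda>t.
      ?Q f t u)) \<le> min 1 (real M2 * real L * pmf (PYZ w) u)" for u
  proof -
    have "EV ?F (\<lambda>f. EV ?T (\<lambda>t.
      ?Q f t u))
      = PR (pair_pmf ?F ?T) {s. \<exists>j\<in>?MR \<times> ?LR. YZ (fst s (fst j)) (snd s (snd j)) = u}"
    proof -
      have *: "(\<exists>j\<in>?MR \<times> ?LR. YZ (fst s (fst j)) (snd s (snd j)) = u)
        \<longleftrightarrow> (\<exists>m'\<in>?MR. \<exists>l'\<in>?LR. YZ (fst s m') (snd s l') = u)" for s :: "(nat \<Rightarrow> 'x2) \<times> (nat \<Rightarrow> 't)" by force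
      show ?thesis unfolding * unfolding PR_eq_EV EV_pair[OF fF fTT] by simp
    qed
    also have "\<dots> \<le> (\<Sum>j\<in>?MR \<times> ?LR. PR (pair_pmf ?F ?T) {s. YZ (fst s (fst j)) (snd s (snd j)) = u})"
      by (rule PR_union_le) auto
    also have "\<dots> = (\<Sum>j\<in>?MR \<times> ?LR. pmf (PYZ w) u)"
    proof (rule sum.cong[OF refl])
      fix j assume j: "j \<in> ?MR \<times> ?LR"
      have "PR (pair_pmf ?F ?T) {s. YZ (fst s (fst j)) (snd s (snd j)) = u}
        = EV ?F (\<lambda>f. EV ?T (\<lambda>t. if YZ (f (fst j)) (t (snd j)) = u then 1 else 0))"
        unfolding PR_eq_EV EV_pair[OF fF fTT] by simp
      also have "\<dots> = EV ?F (\<lambda>f. EV (PT w) (\<lambda>\<tau>. if YZ (f (fst j)) \<tau> = u then 1 else 0))"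
      proof (intro EV_cong refl)
        fix f
        show "EV ?T (\<lambda>t. if YZ (f (fst j)) (t (snd j)) = u then 1 else (0 :: real))
          = EV (PT w) (\<lambda>\<tau>. if YZ (f (fst j)) \<tau> = u then 1 else 0)"
          using j by (intro EV_Pi_component[where g="\<lambda>\<tau>. if YZ (f (fst j)) \<tau> = u then 1 else 0"]) auto
      qed
      also have "\<dots> = EV (PX2 w) (\<lambda>x. EV (PT w) (\<lambda>\<tau>. if YZ x \<tau> = u then 1 else 0))"
        using j by (intro EV_Pi_component[where g="\<lambda>x. EV (PT w) (\<lambda>\<tau>. if YZ x \<tau> = u then 1 else 0)"]) auto
      also have "\<dots> = pmf (PYZ w) u"
        unfolding pmf_as_expectation[of "PYZ w"] E_PYZ by (rule EV_swap[OF fX2 fT])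
      finally show "PR (pair_pmf ?F ?T) {s. YZ (fst s (fst j)) (snd s (snd j)) = u} = pmf (PYZ w) u" .
    qed
    also have "\<dots> = real (card ?MR * card ?LR) * pmf (PYZ w) u" by (simp add: card_cartesian_product)
    also have "\<dots> \<le> real (M2 * L) * pmf (PYZ w) u"
      using card_mono[of "{..<M2}" ?MR] card_mono[of "{..<L}" ?LR]
      by (intro mult_right_mono of_nat_mono mult_le_mono) auto
    finally have le: "EV ?F (\<lambda>f. EV ?T (\<lambda>t.
      ?Q f t u)) \<le> real M2 * real L * pmf (PYZ w) u" by simp
    have "EV ?F (\<lambda>f. EV ?T (\<lambda>t.
      ?Q f t u)) \<le> (1 :: real)"
      by (intro EV_le_const fF fTT) auto
    with le show ?thesis by simp
  qed
  have mm: "m \<in> {..<M2}" and ll: "l \<in> {..<L}" using m l by auto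
  have "PR (inner_pmf w) {(f, t, h). \<exists>m'\<in>?MR. \<exists>l'\<in>?LR. YZ (f m') (t l') = YZ (f m) (t l)}
    = EV (cw_pmf w) (\<lambda>f. EV (ct_pmf w) (\<lambda>t.
        if \<exists>m'\<in>?MR. \<exists>l'\<in>?LR. YZ (f m') (t l') = YZ (f m) (t l) then 1 else 0))"
    unfolding PR_eq_EV inner_expectation by simp
  also have "\<dots> = EV (PX2 w) (\<lambda>x. EV ?F (\<lambda>f.
       EV (PT w) (\<lambda>\<tau>. EV ?T (\<lambda>t.
        ?Q f t (YZ x \<tau>)))))"
  proof -
    have *: "(\<exists>m'\<in>?MR. \<exists>l'\<in>?LR. YZ ((f(m := x)) m') ((t(l := \<tau>)) l') = YZ ((f(m := x)) m) ((t(l := \<tau>)) l))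
      \<longleftrightarrow> (\<exists>m'\<in>?MR. \<exists>l'\<in>?LR. YZ (f m') (t l') = YZ x \<tau>)" for f x t \<tau> by auto
    show ?thesis unfolding cw_pmf_def ct_pmf_def EV_Pi_split[OF finite_lessThan mm fX2]
      EV_Pi_split[OF finite_lessThan ll fT] * ..
  qed
  also have "\<dots> = EV (PX2 w) (\<lambda>x. EV (PT w) (\<lambda>\<tau>.
       EV ?F (\<lambda>f. EV ?T (\<lambda>t.
        ?Q f t (YZ x \<tau>)))))"
    by (intro EV_cong refl EV_swap fF fT)
  also have "\<dots> \<le> EV (PX2 w) (\<lambda>x. EV (PT w) (\<lambda>\<tau>.
       min 1 (real M2 * real L * pmf (PYZ w) (YZ x \<tau>))))"
    by (intro EV_mono fX2 fT one)
  also have "\<dots> = EV (PYZ w) (\<lambda>u. min 1 (real M2 * real L * pmf (PYZ w) u))"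
    unfolding E_PYZ by (rule EV_swap[OF fX2 fT])
  finally show ?thesis .
qed

text \<open>With the true list entry only the codeword is fresh, so each competitor has law
  \<open>PYZT w \<tau>\<close>. This leads to \<open>H(Y2,Z2|T1,W)\<close>, without the factor
  \<open>L\<close>.\<close>

lemma same_cloud_one:
  assumes m: "m < M2" and l: "l < L"
  shows "PR (inner_pmf w) {(f, t, h). \<exists>m'\<in>{..<M2} - {m}. YZ (f m') (t l) = YZ (f m) (t l)}
    \<le> EV (PT w) (\<lambda>\<tau>. EV (PYZT w \<tau>) (\<lambda>u. min 1 (real M2 * pmf (PYZT w \<tau>) u)))"
proof -
  let ?MR = "{..<M2} - {m}"
  let ?F = "Pi_pmf ?MR undefined (\<lambda>_. PX2 w)"
  have fF: "finite (set_pmf ?F)" using fX2 by (intro finite_Pi_pmf) auto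
  have one: "EV ?F (\<lambda>f. if \<exists>m'\<in>?MR. YZ (f m') \<tau> = u then 1 else 0)
     \<le> min 1 (real M2 * pmf (PYZT w \<tau>) u)" for u \<tau>
  proof -
    have "EV ?F (\<lambda>f. if \<exists>m'\<in>?MR. YZ (f m') \<tau> = u then 1 else 0)
      \<le> (\<Sum>m'\<in>?MR. PR ?F {f. YZ (f m') \<tau> = u})"
      unfolding PR_eq_EV[symmetric] by (rule PR_union_le) auto
    also have "\<dots> = (\<Sum>m'\<in>?MR. pmf (PYZT w \<tau>) u)"
    proof (rule sum.cong[OF refl])
      fix j assume j: "j \<in> ?MR"
      have "PR ?F {f. YZ (f j) \<tau> = u} = PR (PX2 w) {x. YZ x \<tau> = u}"
        using j by (intro PR_Pi_component) auto
      then show "PR ?F {f. YZ (f j) \<tau> = u} = pmf (PYZT w \<tau>) u"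
        by (simp add: PYZT_def pmf_map vimage_def)
    qed
    also have "\<dots> \<le> real M2 * pmf (PYZT w \<tau>) u"
      using card_mono[of "{..<M2}" ?MR] by (simp add: mult_right_mono)
    finally have le: "EV ?F (\<lambda>f. if \<exists>m'\<in>?MR. YZ (f m') \<tau> = u then 1 else 0)
      \<le> real M2 * pmf (PYZT w \<tau>) u" .
    have "EV ?F (\<lambda>f. if \<exists>m'\<in>?MR. YZ (f m') \<tau> = u then 1 else 0) \<le> (1 :: real)"
      by (rule EV_le_const[OF fF]) auto
    with le show ?thesis by simp
  qed
  have mm: "m \<in> {..<M2}" using m by auto
  have "PR (inner_pmf w) {(f, t, h). \<exists>m'\<in>?MR. YZ (f m') (t l) = YZ (f m) (t l)}
    = EV (cw_pmf w) (\<lambda>f. EV (ct_pmf w) (\<lambda>t.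
        if \<exists>m'\<in>?MR. YZ (f m') (t l) = YZ (f m) (t l) then 1 else 0))"
    unfolding PR_eq_EV inner_expectation by simp
  also have "\<dots> = EV (cw_pmf w) (\<lambda>f. EV (PT w) (\<lambda>\<tau>.
        if \<exists>m'\<in>?MR. YZ (f m') \<tau> = YZ (f m) \<tau> then 1 else 0))"
    unfolding E_ct[OF l, where g="\<lambda>\<tau>. if \<exists>m'\<in>?MR. YZ (_ m') \<tau> = YZ (_ m) \<tau> then 1 else 0"] ..
  also have "\<dots> = EV (PT w) (\<lambda>\<tau>. EV (cw_pmf w) (\<lambda>f.
        if \<exists>m'\<in>?MR. YZ (f m') \<tau> = YZ (f m) \<tau> then 1 else 0))"
    by (rule EV_swap[OF fcw fT])
  also have "\<dots> = EV (PT w) (\<lambda>\<tau>. EV (PX2 w) (\<lambda>x. EV ?F (\<lambda>f.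
        if \<exists>m'\<in>?MR. YZ (f m') \<tau> = YZ x \<tau> then 1 else 0)))"
  proof -
    have *: "(\<exists>m'\<in>?MR. YZ ((f(m := x)) m') \<tau> = YZ ((f(m := x)) m) \<tau>) \<longleftrightarrow> (\<exists>m'\<in>?MR. YZ (f m') \<tau> = YZ x \<tau>)" for f x \<tau> by auto
    show ?thesis unfolding cw_pmf_def EV_Pi_split[OF finite_lessThan mm fX2] * ..
  qed
  also have "\<dots> \<le> EV (PT w) (\<lambda>\<tau>. EV (PX2 w) (\<lambda>x. min 1 (real M2 * pmf (PYZT w \<tau>) (YZ x \<tau>))))"
    by (intro EV_mono fX2 fT one)
  finally show ?thesis unfolding E_PYZT .
qed

lemma same_cloud_error:
  assumes k0: "k0 < K" and m: "m < M2" and l: "l < L"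
  shows "PR cloud_pmf {c. \<exists>m'\<in>{..<M2} - {m}. \<exists>l'<L.
     matches c m' l' (cH c (z2 (cX c m))) (y2 (cX c m) (cT c l))}
   \<le> collision PW PYZ (real M2 * real L) + collision PWT (\<lambda>(w, t). PYZT w t) (real M2) + M2 / K"
proof -
  let ?G = "\<lambda>w. EV (PT w) (\<lambda>\<tau>. EV (PYZT w \<tau>) (\<lambda>u. min 1 (real M2 * pmf (PYZT w \<tau>) u)))"
  let ?F = "\<lambda>w. EV (PYZ w) (\<lambda>u. min 1 (real M2 * real L * pmf (PYZ w) u))"
  have "PR cloud_pmf {c. \<exists>m'\<in>{..<M2} - {m}. \<exists>l'<L. matches c m' l' (cH c (z2 (cX c m))) (y2 (cX c m) (cT c l))}
    = EV PW (\<lambda>w. PR (inner_pmf w) {s. \<exists>m'\<in>{..<M2} - {m}. \<exists>l'<L.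
       matches (w, s) m' l' (cH (w, s) (z2 (cX (w, s) m))) (y2 (cX (w, s) m) (cT (w, s) l))})"
    unfolding PR_eq_EV cloud_expectation ..
  also have "\<dots> \<le> EV PW (\<lambda>w. ?F w
     + ?G w
     + M2 / K)"
  proof (intro EV_mono fW)
    fix w assume w: "w \<in> set_pmf PW"
    let ?a = "\<lambda>(f, t, h). \<exists>m'<M2. z2 (f m') \<noteq> z2 (f m) \<and> h (z2 (f m')) = h (z2 (f m))"
    let ?b = "\<lambda>(f, t, h :: 'z2 \<Rightarrow> nat). \<exists>m'\<in>{..<M2} - {m}. \<exists>l'\<in>{..<L} - {l}. YZ (f m') (t l') = YZ (f m) (t l)"
    let ?c = "\<lambda>(f, t, h :: 'z2 \<Rightarrow> nat). \<exists>m'\<in>{..<M2} - {m}. YZ (f m') (t l) = YZ (f m) (t l)"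
    have "PR (inner_pmf w) {s. \<exists>m'\<in>{..<M2} - {m}. \<exists>l'<L.
       matches (w, s) m' l' (cH (w, s) (z2 (cX (w, s) m))) (y2 (cX (w, s) m) (cT (w, s) l))}
      \<le> PR (inner_pmf w) {s. ?b s \<or> (?c s \<or> ?a s)}"
    proof (rule PR_mono)
      fix s assume ex: "\<exists>m'\<in>{..<M2} - {m}. \<exists>l'<L.
       matches (w, s) m' l' (cH (w, s) (z2 (cX (w, s) m))) (y2 (cX (w, s) m) (cT (w, s) l))"
      obtain f t h where s: "s = (f, t, h)" by (cases s) auto
      obtain m' l' where ml: "m' < M2" "m' \<noteq> m" "l' < L"
        and y: "y2 (f m') (t l') = y2 (f m) (t l)" and hh: "h (z2 (f m')) = h (z2 (f m))"
        using ex unfolding s matches_def by auto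
      show "?b s \<or> (?c s \<or> ?a s)"
      \<comment> \<open>Agreeing hashes mean equal cribbing signals unless the hash collides, so
        receiver 2 in effect compares \<open>Z2\<close> as well.\<close>
      proof (cases "z2 (f m') = z2 (f m)")
        case True
        then have yz: "YZ (f m') (t l') = YZ (f m) (t l)" using y by (simp add: YZ_def)
        show ?thesis
        proof (cases "l' = l")
          case True then show ?thesis using yz ml unfolding s by auto
        next
          case False then show ?thesis using yz ml unfolding s by auto
        qed
      next
        case False then show ?thesis using hh ml unfolding s by auto
      qed
    qed
    also have "\<dots> \<le> PR (inner_pmf w) {s. ?b s} + (PR (inner_pmf w) {s. ?c s} + PR (inner_pmf w) {s. ?a s})"
      by (rule order_trans[OF PR_or_le add_left_mono[OF PR_or_le]])
    also have "\<dots> \<le> ?F w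
     + (?G w
     + M2 / K)"
      by (intro add_mono same_cloud_both[OF m l] same_cloud_one[OF m l] same_cloud_hash[OF w m])
    finally show "PR (inner_pmf w) {s. \<exists>m'\<in>{..<M2} - {m}. \<exists>l'<L.
       matches (w, s) m' l' (cH (w, s) (z2 (cX (w, s) m))) (y2 (cX (w, s) m) (cT (w, s) l))}
      \<le> ?F w
     + ?G w
     + M2 / K" by simp
  qed
  also have "\<dots> = collision PW PYZ (real M2 * real L)
    + EV PW (\<lambda>w. ?G w) + M2 / K"
    unfolding collision_def using fW by simp
  also have "EV PW (\<lambda>w. ?G w)
    = collision PWT (\<lambda>(w, t). PYZT w t) (real M2)"
    unfolding collision_def PWT_def using fW fT by (subst EV_bind) auto
  finally show ?thesis .
qed

definition "err_bound = collision (return_pmf ()) (\<lambda>_. PY2) (real M2 * real L)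
  + (collision PW PYZ (real M2 * real L) + collision PWT (\<lambda>(w, t). PYZT w t) (real M2) + M2 / K)"

lemma confused_prob:
  assumes k0: "k0 < K" and m: "m < M2" and l: "l < L"
  shows "PR codebook_pmf {C. confused C k0 m (cT (C k0) l)} \<le> err_bound"
proof -
  let ?k = "\<lambda>c. cH c (z2 (cX c m))" and ?y = "\<lambda>c. y2 (cX c m) (cT c l)"
  have "PR codebook_pmf {C. confused C k0 m (cT (C k0) l)}
    \<le> PR codebook_pmf {C. (\<exists>k\<in>{..<K} - {k0}. \<exists>m'<M2. \<exists>l'<L. matches (C k) m' l' (?k (C k0)) (?y (C k0)))
       \<or> (\<exists>m'\<in>{..<M2} - {m}. \<exists>l'<L. matches (C k0) m' l' (?k (C k0)) (?y (C k0)))}"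
    by (intro PR_mono) (auto simp: confused_def)
  also have "\<dots> \<le> PR codebook_pmf {C. (\<exists>k\<in>{..<K} - {k0}. \<exists>m'<M2. \<exists>l'<L. matches (C k) m' l' (?k (C k0)) (?y (C k0)))}
     + PR codebook_pmf {C. \<exists>m'\<in>{..<M2} - {m}. \<exists>l'<L. matches (C k0) m' l' (?k (C k0)) (?y (C k0))}"
    by (rule PR_or_le)
  also have "PR codebook_pmf {C. \<exists>m'\<in>{..<M2} - {m}. \<exists>l'<L. matches (C k0) m' l' (?k (C k0)) (?y (C k0))}
    = PR cloud_pmf {c. \<exists>m'\<in>{..<M2} - {m}. \<exists>l'<L. matches c m' l' (?k c) (?y c)}"
    unfolding codebook_pmf_def using k0 by (intro PR_Pi_component) auto
  finally show ?thesis
    using other_cloud_error[OF assms] same_cloud_error[OF assms] unfolding err_bound_def by linarith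
qed

end

section \<open>Near-uniform bin index for receiver 1\<close>

lemma random_binning_variance:
  fixes q :: "'y \<Rightarrow> real" and M :: nat
  assumes Y: "finite Y" and M: "0 < M"
  shows "EV (Pi_pmf Y d (\<lambda>_. pmf_of_set {..<M})) (\<lambda>b.
      \<Sum>m<M. (\<Sum>y\<in>Y. q y * ((if b y = m then 1 else 0) - 1 / M))\<^sup>2) \<le> (\<Sum>y\<in>Y. (q y)\<^sup>2)"
proof -
  let ?B = "Pi_pmf Y d (\<lambda>_. pmf_of_set {..<M})" and ?U = "pmf_of_set {..<M}"
  have U: "finite {..<M}" "{..<M} \<noteq> {}" using M by auto
  have fU: "finite (set_pmf ?U)" using U by simp
  have fB: "finite (set_pmf ?B)" using Y fU by (intro finite_Pi_pmf)
  have one: "EV ?B (\<lambda>b. (\<Sum>y\<in>Y. q y * ((if b y = m then 1 else 0) - 1 / M))\<^sup>2)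
    \<le> (\<Sum>y\<in>Y. (q y)\<^sup>2) / M" if m: "m < M" for m
  proof -
    \<comment> \<open>The centred indicator of bin \<open>m\<close>. Its values at distinct points
      are uncorrelated and its second moment is at most \<open>1 / M\<close>, so only the diagonal
      of the squared sum survives.\<close>
    define g where "g = (\<lambda>k. (if k = m then 1 else 0) - 1 / real M)"
    have s1: "(\<Sum>k<M. if k = m then 1 else 0 :: real) = 1" using m by (simp add: sum.delta)
    have Eg: "EV ?U g = 0"
      using U M s1 by (simp add: integral_pmf_of_set g_def sum_subtractf)
    have Eg2: "EV ?U (\<lambda>k. g k * g k) \<le> 1 / M"
    proof -
      have "(\<Sum>k<M. g k * g k) = (\<Sum>k<M. (if k = m then 1 else 0) * (1 - 2 / M) + 1 / M * (1 / M))"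
        by (intro sum.cong refl) (auto simp: g_def algebra_simps)
      also have "\<dots> = 1 * (1 - 2 / M) + M * (1 / M * (1 / M))"
        unfolding sum.distrib sum_distrib_right[symmetric] s1 by simp
      also have "\<dots> \<le> 1" using M by (simp add: field_simps)
      finally show ?thesis using U M by (simp add: integral_pmf_of_set divide_right_mono)
    qed
    have E2: "EV ?B (\<lambda>b. g (b y) * g (b y')) \<le> (if y = y' then 1 / M else 0)"
      and E2': "y \<noteq> y' \<Longrightarrow> EV ?B (\<lambda>b. g (b y) * g (b y')) = 0"
      if "y \<in> Y" "y' \<in> Y" for y y'
    proof -
      show ne: "EV ?B (\<lambda>b. g (b y) * g (b y')) = 0" if "y \<noteq> y'"
        using EV_Pi_two[OF Y \<open>y \<in> Y\<close> \<open>y' \<in> Y\<close> that fU, where g="\<lambda>k k'. g k * g k'"] Eg by simp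
      show "EV ?B (\<lambda>b. g (b y) * g (b y')) \<le> (if y = y' then 1 / M else 0)"
      proof (cases "y = y'")
        case True
        then show ?thesis using EV_Pi_component[OF Y \<open>y \<in> Y\<close>, where g="\<lambda>k. g k * g k" and p="?U"] Eg2 by simp
      qed (use ne in simp)
    qed
    have "EV ?B (\<lambda>b. (\<Sum>y\<in>Y. q y * g (b y))\<^sup>2)
      = EV ?B (\<lambda>b. \<Sum>y\<in>Y. \<Sum>y'\<in>Y. (q y * q y') * (g (b y) * g (b y')))"
      by (simp add: power2_eq_square sum_product mult_ac)
    also have "\<dots> = (\<Sum>y\<in>Y. \<Sum>y'\<in>Y. (q y * q y') * EV ?B (\<lambda>b. g (b y) * g (b y')))"
      using fB by (simp add: Bochner_Integration.integral_sum)
    also have "\<dots> = (\<Sum>y\<in>Y. (q y * q y) * EV ?B (\<lambda>b. g (b y) * g (b y)))"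
    proof (intro sum.cong refl)
      fix y assume y: "y \<in> Y"
      have "(\<Sum>y'\<in>Y. (q y * q y') * EV ?B (\<lambda>b. g (b y) * g (b y')))
        = (\<Sum>y'\<in>{y}. (q y * q y') * EV ?B (\<lambda>b. g (b y) * g (b y')))"
        using Y y E2'[OF y] by (intro sum.mono_neutral_right) auto
      then show "(\<Sum>y'\<in>Y. (q y * q y') * EV ?B (\<lambda>b. g (b y) * g (b y')))
        = (q y * q y) * EV ?B (\<lambda>b. g (b y) * g (b y))" by simp
    qed
    also have "\<dots> \<le> (\<Sum>y\<in>Y. (q y * q y) * (1 / M))"
    proof (intro sum_mono mult_left_mono)
      fix y assume y: "y \<in> Y"
      show "EV ?B (\<lambda>b. g (b y) * g (b y)) \<le> 1 / M" using E2[OF y y] by simp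
    qed auto
    finally show ?thesis unfolding g_def by (simp add: power2_eq_square sum_divide_distrib)
  qed
  have "EV ?B (\<lambda>b. \<Sum>m<M. (\<Sum>y\<in>Y. q y * ((if b y = m then 1 else 0) - 1 / M))\<^sup>2)
    = (\<Sum>m<M. EV ?B (\<lambda>b. (\<Sum>y\<in>Y. q y * ((if b y = m then 1 else 0) - 1 / M))\<^sup>2))"
    using fB by (subst Bochner_Integration.integral_sum) auto
  also have "\<dots> \<le> (\<Sum>m<M. (\<Sum>y\<in>Y. (q y)\<^sup>2) / M)" using one by (intro sum_mono) auto
  finally show ?thesis using M by simp
qed

text \<open>A square is nonnegative. Summed over \<open>M\<close> bins, this bounds the absolute
  deviation by \<open>s / 2\<close> plus a multiple of the second moment, in place of the
  Cauchy-Schwarz inequality.\<close>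

lemma abs_le_quadratic:
  fixes x s M :: real
  assumes "0 < s" "0 < M"
  shows "\<bar>x\<bar> \<le> s / (2 * M) + M / (2 * s) * x\<^sup>2"
proof -
  have "0 \<le> (M * \<bar>x\<bar> - s)\<^sup>2 / (2 * s * M)" using assms by simp
  also have "\<dots> = M / (2 * s) * x\<^sup>2 - \<bar>x\<bar> + s / (2 * M)"
    using assms by (simp add: power2_diff power_mult_distrib field_simps) (simp add: power2_eq_square)
  finally show ?thesis by simp
qed

lemma PR_finite_sum:
  assumes "finite Y" "set_pmf p \<subseteq> Y"
  shows "PR p {y. Q y} = (\<Sum>y\<in>Y. pmf p y * (if Q y then 1 else 0))"
  unfolding PR_eq_EV using assms by (subst integral_measure_pmf[OF assms(1)]) auto

lemma EV_finite_sum: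
  fixes f :: "_ \<Rightarrow> real"
  assumes "finite Y" "set_pmf p \<subseteq> Y"
  shows "EV p f = (\<Sum>y\<in>Y. pmf p y * f y)"
  using assms by (subst integral_measure_pmf[OF assms(1)]) auto

lemma sum_pmf_le_1: "finite Y \<Longrightarrow> (\<Sum>y\<in>Y. pmf p y) \<le> 1"
  by (simp flip: measure_measure_pmf_finite)

context block_code
begin

definition "PY1T w t = map_pmf y1 (PX1 w t)"
definition "PY1 w = bind_pmf (PT w) (PY1T w)"
definition "YS = (\<Union>w\<in>set_pmf PW. \<Union>t\<in>set_pmf (PT w). y1 ` set_pmf (PX1 w t))"
definition "bin_pmf = Pi_pmf YS 0 (\<lambda>_. pmf_of_set {..<M1})"
definition "QX c = bind_pmf (pmf_of_set {..<L}) (\<lambda>l. PX1 (cW c) (cT c l))"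

text \<open>For a binning \<open>b\<close> into \<open>M1\<close> bins, twice the total variation
  distance between the uniform law and the bin index of an input drawn through a random list
  entry.\<close>

definition "tv c b = (\<Sum>m<M1. \<bar>1 / M1 - PR (QX c) {x. b (y1 x) = m}\<bar>)"

lemma finYS: "finite YS" unfolding YS_def using fW fT fX1 by auto

lemma L_set: "finite {..<L}" "{..<L} \<noteq> {}" using pos by auto
lemma M1_set: "finite {..<M1}" "{..<M1} \<noteq> {}" using pos by auto

lemma fbin [simp]: "finite (set_pmf bin_pmf)"
  unfolding bin_pmf_def using finYS M1_set by (intro finite_Pi_pmf) auto

lemma fPY1T [simp]: "finite (set_pmf (PY1T w \<tau>))" unfolding PY1T_def using fX1 by simp
lemma fPY1 [simp]: "finite (set_pmf (PY1 w))" unfolding PY1_def using fT by auto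
lemma fQX [simp]: "finite (set_pmf (QX c))" unfolding QX_def using L_set fX1 by auto

lemma PY1T_YS: "w \<in> set_pmf PW \<Longrightarrow> \<tau> \<in> set_pmf (PT w) \<Longrightarrow> set_pmf (PY1T w \<tau>) \<subseteq> YS"
  unfolding PY1T_def YS_def by auto

lemma pmf_PY1: "pmf (PY1 w) y = EV (PT w) (\<lambda>\<tau>. pmf (PY1T w \<tau>) y)"
  unfolding PY1_def by (rule pmf_bind)

lemma E_QX: "EV (QX c) g = (\<Sum>l<L. EV (PX1 (cW c) (cT c l)) (g :: _ \<Rightarrow> real)) / L"
  unfolding QX_def using L_set fX1 by (subst EV_bind) (auto simp: integral_pmf_of_set)

text \<open>The two thresholds replace joint typicality: \<open>\<alpha>\<close> caps the output
  probability given the interference, \<open>\<beta>\<close> the one given \<open>w\<close>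
  alone.\<close>

definition "typ \<alpha> \<beta> w \<tau> y = (if pmf (PY1T w \<tau>) y \<le> \<alpha> \<and> pmf (PY1 w) y \<le> \<beta> then pmf (PY1T w \<tau>) y else 0)"
definition "typ_mass \<alpha> \<beta> w t y = (\<Sum>l<L. typ \<alpha> \<beta> w (t l) y) / L"
definition "atyp_mass \<alpha> \<beta> w t y = (\<Sum>l<L. pmf (PY1T w (t l)) y - typ \<alpha> \<beta> w (t l) y) / L"

lemma typ_bounds: "0 \<le> typ \<alpha> \<beta> w \<tau> y" "typ \<alpha> \<beta> w \<tau> y \<le> pmf (PY1T w \<tau>) y"
  by (auto simp: typ_def)

lemma mass_nonneg: "0 \<le> typ_mass \<alpha> \<beta> w t y" "0 \<le> atyp_mass \<alpha> \<beta> w t y"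
  unfolding typ_mass_def atyp_mass_def using typ_bounds by (auto intro!: divide_nonneg_nonneg sum_nonneg)

text \<open>The truncated mass is treated in mean square and gives the variance term. The discarded
  mass counts twice, once in the bins where it falls and once as the missing share of the uniform
  law.\<close>

lemma tv_pointwise:
  assumes w: "w \<in> set_pmf PW" and t: "t \<in> set_pmf (ct_pmf w)" and s: "0 < s"
  shows "tv (w, f, t, h) b \<le> s / 2
     + M1 / (2 * s) * (\<Sum>m<M1. (\<Sum>y\<in>YS. typ_mass \<alpha> \<beta> w t y * ((if b y = m then 1 else 0) - 1 / M1))\<^sup>2)
     + 2 * (\<Sum>y\<in>YS. atyp_mass \<alpha> \<beta> w t y)"
proof -
  let ?q = "typ_mass \<alpha> \<beta> w t" and ?r = "atyp_mass \<alpha> \<beta> w t"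
  let ?I = "\<lambda>y m. if b y = m then 1 else 0 :: real"
  define R where "R = (\<Sum>y\<in>YS. ?r y)"
  have M: "0 < real M1" using pos by simp
  have tl: "t l \<in> set_pmf (PT w)" if "l < L" for l using ct_in[OF t that] .
  have qr: "?q y + ?r y = (\<Sum>l<L. pmf (PY1T w (t l)) y) / L" for y
    unfolding typ_mass_def atyp_mass_def by (simp add: sum_subtractf flip: add_divide_distrib)
  have prob: "PR (QX (w, f, t, h)) {x. b (y1 x) = m} = (\<Sum>y\<in>YS. (?q y + ?r y) * ?I y m)" for m
  proof -
    have "PR (QX (w, f, t, h)) {x. b (y1 x) = m}
      = (\<Sum>l<L. PR (PY1T w (t l)) {y. b y = m}) / L"
      unfolding PR_eq_EV E_QX PY1T_def by simp
    also have "\<dots> = (\<Sum>l<L. \<Sum>y\<in>YS. pmf (PY1T w (t l)) y * ?I y m) / L"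
    proof (intro arg_cong2[where f="(/)"] sum.cong refl)
      fix l assume "l \<in> {..<L}"
      then show "PR (PY1T w (t l)) {y. b y = m} = (\<Sum>y\<in>YS. pmf (PY1T w (t l)) y * ?I y m)"
        using PY1T_YS[OF w tl] by (intro PR_finite_sum[OF finYS]) auto
    qed
    also have "\<dots> = (\<Sum>y\<in>YS. (?q y + ?r y) * ?I y m)"
      unfolding qr by (subst sum.swap) (simp add: sum_divide_distrib sum_distrib_right)
    finally show ?thesis .
  qed
  have total: "(\<Sum>y\<in>YS. ?q y) + R = 1"
  proof -
    have "(\<Sum>y\<in>YS. ?q y) + R = (\<Sum>l<L. \<Sum>y\<in>YS. pmf (PY1T w (t l)) y) / L"
      unfolding R_def sum.distrib[symmetric] qr sum_divide_distrib by (rule sum.swap)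
    also have "(\<Sum>l<L. \<Sum>y\<in>YS. pmf (PY1T w (t l)) y) = (\<Sum>l<L. 1)"
      using PY1T_YS[OF w tl] finYS by (intro sum.cong refl sum_pmf_eq_1) auto
    finally show ?thesis using pos by simp
  qed
  have "tv (w, f, t, h) b \<le> (\<Sum>m<M1. (s / (2 * M1) + M1 / (2 * s) * (\<Sum>y\<in>YS. ?q y * (?I y m - 1 / M1))\<^sup>2)
      + ((\<Sum>y\<in>YS. ?r y * ?I y m) + R / M1))"
    unfolding tv_def prob
  proof (rule sum_mono)
    fix m
    let ?D = "\<Sum>y\<in>YS. ?q y * (?I y m - 1 / M1)"
    have D: "?D = (\<Sum>y\<in>YS. ?q y * ?I y m) - (\<Sum>y\<in>YS. ?q y) / M1"
      by (simp add: right_diff_distrib sum_subtractf sum_divide_distrib)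
    have S: "(\<Sum>y\<in>YS. (?q y + ?r y) * ?I y m) = (\<Sum>y\<in>YS. ?q y * ?I y m) + (\<Sum>y\<in>YS. ?r y * ?I y m)"
      by (simp add: distrib_right sum.distrib)
    have one: "1 / M1 = (\<Sum>y\<in>YS. ?q y) / M1 + R / M1"
      unfolding add_divide_distrib[symmetric] total ..
    have r0: "0 \<le> (\<Sum>y\<in>YS. ?r y * ?I y m)" "0 \<le> R / M1"
      unfolding R_def using mass_nonneg by (auto intro!: sum_nonneg divide_nonneg_nonneg mult_nonneg_nonneg)
    have "\<bar>1 / M1 - (\<Sum>y\<in>YS. (?q y + ?r y) * ?I y m)\<bar> = \<bar>- ?D - (\<Sum>y\<in>YS. ?r y * ?I y m) + R / M1\<bar>"
      unfolding S D by (subst one) (simp add: algebra_simps)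
    also have "\<dots> \<le> \<bar>?D\<bar> + ((\<Sum>y\<in>YS. ?r y * ?I y m) + R / M1)" using r0 by linarith
    also have "\<dots> \<le> (s / (2 * M1) + M1 / (2 * s) * ?D\<^sup>2) + ((\<Sum>y\<in>YS. ?r y * ?I y m) + R / M1)"
      using abs_le_quadratic[OF s M, of ?D] by simp
    finally show "\<bar>1 / M1 - (\<Sum>y\<in>YS. (?q y + ?r y) * ?I y m)\<bar>
      \<le> (s / (2 * M1) + M1 / (2 * s) * ?D\<^sup>2) + ((\<Sum>y\<in>YS. ?r y * ?I y m) + R / M1)" .
  qed
  also have "\<dots> = s / 2 + M1 / (2 * s) * (\<Sum>m<M1. (\<Sum>y\<in>YS. ?q y * (?I y m - 1 / M1))\<^sup>2)
     + ((\<Sum>m<M1. \<Sum>y\<in>YS. ?r y * ?I y m) + R)"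
    using M by (simp add: sum.distrib sum_distrib_left)
  also have "(\<Sum>m<M1. \<Sum>y\<in>YS. ?r y * ?I y m) \<le> R"
  proof -
    have "(\<Sum>m<M1. \<Sum>y\<in>YS. ?r y * ?I y m) = (\<Sum>y\<in>YS. ?r y * (\<Sum>m<M1. ?I y m))"
      unfolding sum_distrib_left by (rule sum.swap)
    also have "\<dots> \<le> (\<Sum>y\<in>YS. ?r y * 1)"
      using mass_nonneg by (intro sum_mono mult_left_mono) (auto simp: sum.delta')
    finally show ?thesis by (simp add: R_def)
  qed
  finally show ?thesis unfolding R_def by simp
qed

text \<open>The second moment of an average over \<open>L\<close> independent list entries: the
  diagonal contributes at most \<open>\<alpha> / L\<close>, and the independent pairs contribute
  squared means, at most \<open>\<beta>\<close> in total. Multiplied by \<open>M1\<close>, these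
  become the two conditions on the rate of sender 1.\<close>

lemma typ_mass_square:
  assumes w: "w \<in> set_pmf PW" and ab: "0 < \<alpha>" "0 < \<beta>"
  shows "EV (ct_pmf w) (\<lambda>t. \<Sum>y\<in>YS. (typ_mass \<alpha> \<beta> w t y)\<^sup>2) \<le> \<alpha> / L + \<beta>"
proof -
  let ?a = "typ \<alpha> \<beta> w"
  let ?E = "\<lambda>y. EV (PT w) (\<lambda>\<tau>. ?a \<tau> y)"
  let ?E2 = "\<lambda>y. EV (PT w) (\<lambda>\<tau>. ?a \<tau> y * ?a \<tau> y)"
  have Lp: "0 < real L" using pos by simp
  have one: "EV (ct_pmf w) (\<lambda>t. (typ_mass \<alpha> \<beta> w t y)\<^sup>2) \<le> ?E2 y / L + ?E y * ?E y" for y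
  proof -
    have E0: "0 \<le> ?E y" "0 \<le> ?E2 y" using typ_bounds by (auto intro!: EV_nonneg)
    have "EV (ct_pmf w) (\<lambda>t. (typ_mass \<alpha> \<beta> w t y)\<^sup>2)
      = EV (ct_pmf w) (\<lambda>t. (\<Sum>l<L. \<Sum>l'<L. ?a (t l) y * ?a (t l') y) / (real L * real L))"
      by (simp add: typ_mass_def power_divide power2_eq_square sum_product)
    also have "\<dots> = (\<Sum>l<L. \<Sum>l'<L. EV (ct_pmf w) (\<lambda>t. ?a (t l) y * ?a (t l') y)) / (real L * real L)"
      by (simp add: Bochner_Integration.integral_sum)
    also have "\<dots> \<le> (\<Sum>l<L. \<Sum>l'<L. (if l' = l then ?E2 y else 0) + ?E y * ?E y) / (real L * real L)"
    proof (intro divide_right_mono sum_mono)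
      fix l l' assume l: "l \<in> {..<L}" "l' \<in> {..<L}"
      show "EV (ct_pmf w) (\<lambda>t. ?a (t l) y * ?a (t l') y) \<le> (if l' = l then ?E2 y else 0) + ?E y * ?E y"
      proof (cases "l' = l")
        case True
        then have "EV (ct_pmf w) (\<lambda>t. ?a (t l) y * ?a (t l') y) = ?E2 y"
          using E_ct[of l w "\<lambda>\<tau>. ?a \<tau> y * ?a \<tau> y"] l by simp
        then show ?thesis using True E0 by simp
      next
        case False
        have "EV (ct_pmf w) (\<lambda>t. ?a (t l) y * ?a (t l') y)
          = EV (PT w) (\<lambda>\<tau>. EV (PT w) (\<lambda>\<tau>'. ?a \<tau> y * ?a \<tau>' y))"
          unfolding ct_pmf_def
          using EV_Pi_two[OF finite_lessThan l False[symmetric] fT, where g="\<lambda>\<tau> \<tau>'. ?a \<tau> y * ?a \<tau>' y"] .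
        then show ?thesis using False by simp
      qed
    qed auto
    also have "\<dots> = ?E2 y / L + ?E y * ?E y"
      using Lp by (simp add: sum.distrib field_simps)
    finally show ?thesis .
  qed
  have E2: "(\<Sum>y\<in>YS. ?E2 y) \<le> \<alpha>"
  proof -
    have "(\<Sum>y\<in>YS. ?E2 y) = EV (PT w) (\<lambda>\<tau>. \<Sum>y\<in>YS. ?a \<tau> y * ?a \<tau> y)"
      using fT by (subst Bochner_Integration.integral_sum) auto
    also have "\<dots> \<le> \<alpha>"
    proof (rule EV_le_const[OF fT])
      fix \<tau>
      have "(\<Sum>y\<in>YS. ?a \<tau> y * ?a \<tau> y) \<le> (\<Sum>y\<in>YS. \<alpha> * pmf (PY1T w \<tau>) y)"
        using ab by (intro sum_mono) (auto simp: typ_def intro!: mult_right_mono)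
      also have "\<dots> \<le> \<alpha>" using sum_pmf_le_1[OF finYS, of "PY1T w \<tau>"] ab
        by (simp flip: sum_distrib_left)
      finally show "(\<Sum>y\<in>YS. ?a \<tau> y * ?a \<tau> y) \<le> \<alpha>" .
    qed
    finally show ?thesis .
  qed
  have E1: "(\<Sum>y\<in>YS. ?E y * ?E y) \<le> \<beta>"
  proof -
    have "(\<Sum>y\<in>YS. ?E y * ?E y) \<le> (\<Sum>y\<in>YS. \<beta> * pmf (PY1 w) y)"
    proof (rule sum_mono)
      fix y
      show "?E y * ?E y \<le> \<beta> * pmf (PY1 w) y"
      proof (cases "pmf (PY1 w) y \<le> \<beta>")
        case True
        have "?E y \<le> pmf (PY1 w) y" unfolding pmf_PY1 using typ_bounds by (intro EV_mono fT) auto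
        moreover have "0 \<le> ?E y" using typ_bounds by (intro EV_nonneg) auto
        ultimately show ?thesis using True by (intro mult_mono) auto
      next
        case False
        then have "?E y = 0" by (simp add: typ_def)
        then show ?thesis using ab by simp
      qed
    qed
    also have "\<dots> \<le> \<beta>" using sum_pmf_le_1[OF finYS, of "PY1 w"] ab by (simp flip: sum_distrib_left)
    finally show ?thesis .
  qed
  have "EV (ct_pmf w) (\<lambda>t. \<Sum>y\<in>YS. (typ_mass \<alpha> \<beta> w t y)\<^sup>2)
    = (\<Sum>y\<in>YS. EV (ct_pmf w) (\<lambda>t. (typ_mass \<alpha> \<beta> w t y)\<^sup>2))"
    by (subst Bochner_Integration.integral_sum) auto
  also have "\<dots> \<le> (\<Sum>y\<in>YS. ?E2 y / L + ?E y * ?E y)" using one by (intro sum_mono)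
  also have "\<dots> = (\<Sum>y\<in>YS. ?E2 y) / L + (\<Sum>y\<in>YS. ?E y * ?E y)" by (simp add: sum.distrib sum_divide_distrib)
  also have "\<dots> \<le> \<alpha> / L + \<beta>" using E1 E2 Lp by (intro add_mono divide_right_mono) auto
  finally show ?thesis .
qed

text \<open>Where a threshold is exceeded, one of the two minima equals one; so the sum of both
  minima dominates the indicator of the discarded part.\<close>

lemma atyp_mass_le:
  assumes w: "w \<in> set_pmf PW" and ab: "0 < \<alpha>" "0 < \<beta>"
  shows "EV (ct_pmf w) (\<lambda>t. \<Sum>y\<in>YS. atyp_mass \<alpha> \<beta> w t y)
    \<le> EV (PT w) (\<lambda>\<tau>. EV (PY1T w \<tau>) (\<lambda>y. min 1 (1 / \<alpha> * pmf (PY1T w \<tau>) y)))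
     + EV (PY1 w) (\<lambda>y. min 1 (1 / \<beta> * pmf (PY1 w) y))"
proof -
  let ?A = "\<lambda>\<tau> y. min 1 (1 / \<alpha> * pmf (PY1T w \<tau>) y)"
  let ?B = "\<lambda>y. min 1 (1 / \<beta> * pmf (PY1 w) y)"
  let ?b = "\<lambda>\<tau> y. pmf (PY1T w \<tau>) y - typ \<alpha> \<beta> w \<tau> y"
  have "EV (ct_pmf w) (\<lambda>t. \<Sum>y\<in>YS. atyp_mass \<alpha> \<beta> w t y)
    = (\<Sum>y\<in>YS. (\<Sum>l<L. EV (ct_pmf w) (\<lambda>t. ?b (t l) y)) / L)"
    unfolding atyp_mass_def by (subst Bochner_Integration.integral_sum) (auto simp: Bochner_Integration.integral_sum)
  also have "\<dots> = (\<Sum>y\<in>YS. (\<Sum>l<L. EV (PT w) (\<lambda>\<tau>. ?b \<tau> y)) / L)"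
    by (intro sum.cong refl arg_cong2[where f="(/)"] E_ct[where g="\<lambda>\<tau>. ?b \<tau> _"]) auto
  also have "\<dots> = (\<Sum>y\<in>YS. EV (PT w) (\<lambda>\<tau>. ?b \<tau> y))" using pos by simp
  also have "\<dots> = EV (PT w) (\<lambda>\<tau>. \<Sum>y\<in>YS. ?b \<tau> y)"
    using fT by (subst Bochner_Integration.integral_sum) auto
  also have "\<dots> \<le> EV (PT w) (\<lambda>\<tau>. EV (PY1T w \<tau>) (\<lambda>y.
      ?A \<tau> y + ?B y))"
  proof (rule EV_mono[OF fT])
    fix \<tau> assume \<tau>: "\<tau> \<in> set_pmf (PT w)"
    have "(\<Sum>y\<in>YS. ?b \<tau> y) \<le> (\<Sum>y\<in>YS. pmf (PY1T w \<tau>) y * (?A \<tau> y + ?B y))"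
    proof (rule sum_mono)
      fix y
      have nn: "0 \<le> ?A \<tau> y" "0 \<le> ?B y" using ab by auto
      show "?b \<tau> y \<le> pmf (PY1T w \<tau>) y * (?A \<tau> y + ?B y)"
      proof (cases "pmf (PY1T w \<tau>) y \<le> \<alpha> \<and> pmf (PY1 w) y \<le> \<beta>")
        case True
        then show ?thesis using nn by (auto simp: typ_def intro!: mult_nonneg_nonneg add_nonneg_nonneg)
      next
        case False
        then have "?A \<tau> y = 1 \<or> ?B y = 1"
          using ab by (auto simp: min_def field_simps)
        then have "1 \<le> ?A \<tau> y + ?B y" using nn by linarith
        then have "pmf (PY1T w \<tau>) y * 1 \<le> pmf (PY1T w \<tau>) y * (?A \<tau> y + ?B y)"
          by (intro mult_left_mono) auto
        moreover have "?b \<tau> y \<le> pmf (PY1T w \<tau>) y" using typ_bounds(1) by simp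
        ultimately show ?thesis by linarith
      qed
    qed
    also have "\<dots> = EV (PY1T w \<tau>) (\<lambda>y. ?A \<tau> y + ?B y)"
      using PY1T_YS[OF w \<tau>] by (intro EV_finite_sum[OF finYS, symmetric])
    finally show "(\<Sum>y\<in>YS. ?b \<tau> y) \<le> EV (PY1T w \<tau>) (\<lambda>y.
      ?A \<tau> y + ?B y)" .
  qed
  also have "\<dots> = EV (PT w) (\<lambda>\<tau>. EV (PY1T w \<tau>) (\<lambda>y. ?A \<tau> y))
     + EV (PT w) (\<lambda>\<tau>. EV (PY1T w \<tau>) (\<lambda>y. ?B y))"
    using fT by simp
  also have "EV (PT w) (\<lambda>\<tau>. EV (PY1T w \<tau>) (\<lambda>y. ?B y))
    = EV (PY1 w) (\<lambda>y. ?B y)"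
    using EV_bind[of "PT w" "PY1T w", OF fT fPY1T, folded PY1_def] by simp
  finally show ?thesis .
qed

definition "tv_bound \<alpha> \<beta> s = s / 2 + M1 / (2 * s) * (\<alpha> / L + \<beta>)
  + 2 * (collision PWT (\<lambda>(w, t). PY1T w t) (1 / \<alpha>) + collision PW PY1 (1 / \<beta>))"

lemma tv_expectation:
  assumes ab: "0 < \<alpha>" "0 < \<beta>" and s: "0 < s"
  shows "EV cloud_pmf (\<lambda>c. EV bin_pmf (tv c)) \<le> tv_bound \<alpha> \<beta> s"
proof -
  let ?g = "\<lambda>w t. s / 2 + M1 / (2 * s) * (\<Sum>y\<in>YS. (typ_mass \<alpha> \<beta> w t y)\<^sup>2) + 2 * (\<Sum>y\<in>YS. atyp_mass \<alpha> \<beta> w t y)"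
  let ?cA = "\<lambda>w. EV (PT w) (\<lambda>\<tau>. EV (PY1T w \<tau>) (\<lambda>y. min 1 (1 / \<alpha> * pmf (PY1T w \<tau>) y)))"
  let ?cB = "\<lambda>w. EV (PY1 w) (\<lambda>y. min 1 (1 / \<beta> * pmf (PY1 w) y))"
  have step: "EV bin_pmf (tv (w, f, t, h)) \<le> ?g w t"
    if w: "w \<in> set_pmf PW" and t: "t \<in> set_pmf (ct_pmf w)" for w f t h
  proof -
    let ?V = "\<lambda>b. \<Sum>m<M1. (\<Sum>y\<in>YS. typ_mass \<alpha> \<beta> w t y * ((if b y = m then 1 else 0) - 1 / M1))\<^sup>2"
    have "EV bin_pmf (tv (w, f, t, h))
      \<le> EV bin_pmf (\<lambda>b. s / 2 + M1 / (2 * s) * ?V b + 2 * (\<Sum>y\<in>YS. atyp_mass \<alpha> \<beta> w t y))"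
      by (intro EV_mono fbin tv_pointwise w t s)
    also have "\<dots> = s / 2 + M1 / (2 * s) * EV bin_pmf ?V + 2 * (\<Sum>y\<in>YS. atyp_mass \<alpha> \<beta> w t y)"
      by simp
    also have "\<dots> \<le> ?g w t"
      using s random_binning_variance[OF finYS pos(1), where d=0 and q="typ_mass \<alpha> \<beta> w t", folded bin_pmf_def]
      by (intro add_mono mult_left_mono order_refl) auto
    finally show ?thesis .
  qed
  have "EV cloud_pmf (\<lambda>c. EV bin_pmf (tv c))
    \<le> EV PW (\<lambda>w. EV (cw_pmf w) (\<lambda>f. EV (ct_pmf w) (\<lambda>t.
       EV hash_pmf (\<lambda>h. ?g w t))))"
    unfolding cloud_expectation inner_expectation by (intro EV_mono fW fcw fct fhash step)
  also have "\<dots> = EV PW (\<lambda>w. s / 2 + M1 / (2 * s) * EV (ct_pmf w) (\<lambda>t. \<Sum>y\<in>YS. (typ_mass \<alpha> \<beta> w t y)\<^sup>2)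
     + 2 * EV (ct_pmf w) (\<lambda>t. \<Sum>y\<in>YS. atyp_mass \<alpha> \<beta> w t y))" by simp
  also have "\<dots> \<le> EV PW (\<lambda>w. s / 2 + M1 / (2 * s) * (\<alpha> / L + \<beta>) + 2 * (?cA w + ?cB w))"
    using s by (intro EV_mono fW add_mono mult_left_mono order_refl typ_mass_square atyp_mass_le ab) auto
  also have "\<dots> = s / 2 + M1 / (2 * s) * (\<alpha> / L + \<beta>) + 2 * (EV PW ?cA + EV PW ?cB)"
    using fW by simp
  also have "EV PW ?cA = collision PWT (\<lambda>(w, t). PY1T w t) (1 / \<alpha>)"
    unfolding collision_def PWT_def using fW fT by (subst EV_bind) auto
  also have "EV PW ?cB = collision PW PY1 (1 / \<beta>)"
    unfolding collision_def ..
  finally show ?thesis unfolding tv_bound_def .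
qed

text \<open>With one bin the bin index is exactly uniform; the default value \<open>0\<close> is
  that bin too. This allows rate zero for sender 1 even if \<open>H(Y1|W)\<close> vanishes.\<close>

lemma tv_single_bin:
  assumes "M1 = 1"
  shows "EV cloud_pmf (\<lambda>c. EV bin_pmf (tv c)) = 0"
proof -
  have "tv c b = 0" if "b \<in> set_pmf bin_pmf" for c b
  proof -
    have "b y = 0" for y
    proof -
      have "b \<in> PiE_dflt YS 0 (\<lambda>_. {..<M1})"
        using that finYS M1_set unfolding bin_pmf_def by (simp add: set_Pi_pmf o_def)
      then show ?thesis using assms by (cases "y \<in> YS") (auto simp: PiE_dflt_def)
    qed
    then show ?thesis unfolding tv_def using assms by simp
  qed
  then have "EV bin_pmf (tv c) = EV bin_pmf (\<lambda>_. 0)" for c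
    by (intro EV_cong refl)
  then show ?thesis by simp
qed

text \<open>Encoder 1 picks, among the inputs whose output lies in the bin of the message, the one that is
  least harmful to receiver 2.  This is at most as harmful as a random choice from the bin, which by
  near-uniformity of the bin index behaves like an unconstrained random input.\<close>

theorem block_code_exists:
  assumes \<pi>: "set_pmf \<pi> \<subseteq> {..<K}" and ab: "0 < \<alpha>" "0 < \<beta>" and s: "0 < s"
    and le: "err_bound + (if M1 = 1 then 0 else tv_bound \<alpha> \<beta> s) \<le> \<epsilon>"
  shows "\<exists>X1 X2 hash d1 d2.
    (\<forall>k<K. \<forall>m<M1. \<exists>w\<in>set_pmf PW. \<exists>\<tau>\<in>set_pmf (PT w). X1 k m \<in> set_pmf (PX1 w \<tau>)) \<and>
    (\<forall>k<K. \<forall>m<M2. \<exists>w\<in>set_pmf PW. X2 k m \<in> set_pmf (PX2 w)) \<and>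
    (\<forall>k<K. \<forall>m<M2. hash k (z2 (X2 k m)) < K) \<and>
    EV \<pi> (\<lambda>k. (\<Sum>m1<M1. \<Sum>m2<M2.
      if d1 (y1 (X1 k m1)) = m1 \<and> d2 (hash k (z2 (X2 k m2))) (y2 (X2 k m2) (t1 (X1 k m1))) = (k, m2)
      then 0 else 1) / (real M1 * real M2)) \<le> \<epsilon>"
proof -
  have f\<pi>: "finite (set_pmf \<pi>)" using \<pi> by (rule finite_subset) simp
  define conf where "conf = (\<lambda>C k m t. if confused C k m t then 1 else 0 :: real)"
  let ?cf = "\<lambda>C k. (\<Sum>l<L. \<Sum>m<M2. conf C k m (cT (C k) l)) / (real L * real M2)"
  \<comment> \<open>Confusion of receiver 2 for a random list entry plus the deviation from uniform
    bins. One codebook and one binning must make the sum small on average over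
    \<open>\<pi>\<close>.\<close>
  define J where "J = (\<lambda>(C, b). EV \<pi> (\<lambda>k.
    ?cf C k + tv (C k) b))"
  have "EV (pair_pmf codebook_pmf bin_pmf) J
    = EV \<pi> (\<lambda>k. EV codebook_pmf (\<lambda>C. EV bin_pmf (\<lambda>b.
        ?cf C k + tv (C k) b)))"
    unfolding J_def using f\<pi>
    by (simp add: EV_pair EV_swap[where q=\<pi>] del: Bochner_Integration.integral_add Bochner_Integration.integral_divide)
  also have "\<dots> \<le> \<epsilon>"
  \<comment> \<open>The clouds are identically distributed, so the bound holds at each single
    \<open>k\<close> and hence for every law \<open>\<pi>\<close>.\<close>
  proof (rule EV_le_const[OF f\<pi>])
    fix k assume "k \<in> set_pmf \<pi>"
    then have k: "k < K" using \<pi> by auto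
    have "EV codebook_pmf (\<lambda>C. EV bin_pmf (\<lambda>b.
        ?cf C k + tv (C k) b))
      = EV codebook_pmf (\<lambda>C. ?cf C k)
       + EV codebook_pmf (\<lambda>C. EV bin_pmf (tv (C k)))"
      by simp
    also have "EV codebook_pmf (\<lambda>C. ?cf C k)
      = (\<Sum>l<L. \<Sum>m<M2. EV codebook_pmf (\<lambda>C. conf C k m (cT (C k) l))) / (real L * real M2)"
      by (simp add: Bochner_Integration.integral_sum)
    also have "\<dots> \<le> (\<Sum>l<L. \<Sum>m<M2. err_bound) / (real L * real M2)"
      using confused_prob[OF k] unfolding conf_def PR_eq_EV
      by (intro divide_right_mono sum_mono) auto
    also have "\<dots> = err_bound" using pos by simp
    also have "EV codebook_pmf (\<lambda>C. EV bin_pmf (tv (C k)))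
      = EV cloud_pmf (\<lambda>c. EV bin_pmf (tv c))"
      unfolding codebook_pmf_def using k by (intro EV_Pi_component) auto
    also have "\<dots> \<le> (if M1 = 1 then 0 else tv_bound \<alpha> \<beta> s)" using tv_expectation[OF ab s] tv_single_bin by simp
    finally show "EV codebook_pmf (\<lambda>C. EV bin_pmf (\<lambda>b.
        ?cf C k + tv (C k) b)) \<le> \<epsilon>"
      using le by simp
  qed
  finally have "\<exists>x\<in>set_pmf (pair_pmf codebook_pmf bin_pmf). J x \<le> \<epsilon>"
    by (intro ex_le_expectation) auto
  then obtain C b where C: "C \<in> set_pmf codebook_pmf" and J: "J (C, b) \<le> \<epsilon>" by auto
  have Ck: "cW (C k) \<in> set_pmf PW" "cX (C k) \<in> set_pmf (cw_pmf (cW (C k)))" "cT (C k) \<in> set_pmf (ct_pmf (cW (C k)))"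
    "cH (C k) \<in> set_pmf hash_pmf" if k: "k < K" for k
  proof -
    have "C k \<in> set_pmf cloud_pmf"
      using Pi_pmf_in_set[OF finite_lessThan C[unfolded codebook_pmf_def]] k by simp
    then show "cW (C k) \<in> set_pmf PW" "cX (C k) \<in> set_pmf (cw_pmf (cW (C k)))" "cT (C k) \<in> set_pmf (ct_pmf (cW (C k)))"
      "cH (C k) \<in> set_pmf hash_pmf"
      by (auto simp: cloud_pmf_def inner_pmf_def)
  qed
  have X2in: "cX (C k) m \<in> set_pmf (PX2 (cW (C k)))" if "k < K" "m < M2" for k m
    using cw_in[OF Ck(2)[OF that(1)] that(2)] .
  have Tin: "cT (C k) l \<in> set_pmf (PT (cW (C k)))" if "k < K" "l < L" for k l
    using ct_in[OF Ck(3)[OF that(1)] that(2)] .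
  define ebar where "ebar = (\<lambda>k x. (\<Sum>m<M2. conf C k m (t1 x)) / real M2)"
  \<comment> \<open>The admissible inputs for message \<open>m\<close>. For an empty bin
    \<open>X1\<close> is any input of the support, and the message is charged as an error.\<close>
  define F where "F = (\<lambda>k m. {x \<in> set_pmf (QX (C k)). b (y1 x) = m})"
  have fF: "finite (F k m)" for k m unfolding F_def by simp
  have "\<exists>x. x \<in> set_pmf (QX (C k)) \<and> (F k m \<noteq> {} \<longrightarrow> x \<in> F k m \<and> (\<forall>x'\<in>F k m. ebar k x \<le> ebar k x'))" for k m
  proof (cases "F k m = {}")
    case True
    moreover obtain x where "x \<in> set_pmf (QX (C k))" using set_pmf_not_empty by fastforce
    ultimately show ?thesis by blast
  next
    case False
    then obtain x where "x \<in> F k m" "\<forall>x'\<in>F k m. ebar k x \<le> ebar k x'"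
      using arg_min_if_finite[OF fF False, of "ebar k"] by (metis not_less)
    then show ?thesis by (auto simp: F_def)
  qed
  then obtain X1 where X1: "\<And>k m. X1 k m \<in> set_pmf (QX (C k))"
    "\<And>k m. F k m \<noteq> {} \<Longrightarrow> X1 k m \<in> F k m \<and> (\<forall>x'\<in>F k m. ebar k (X1 k m) \<le> ebar k x')"
    by metis
  define good where "good = (\<lambda>\<kappa> y (k, m). k < K \<and> m < M2 \<and> (\<exists>l<L. matches (C k) m l \<kappa> y))"
  define d2 where "d2 = (\<lambda>\<kappa> y. SOME p. good \<kappa> y p)"
  have QXset: "\<exists>l<L. x \<in> set_pmf (PX1 (cW (C k)) (cT (C k) l)) \<and> t1 x = cT (C k) l"
    if k: "k < K" and x: "x \<in> set_pmf (QX (C k))" for k x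
  proof -
    obtain l where l: "l < L" "x \<in> set_pmf (PX1 (cW (C k)) (cT (C k) l))"
      using x L_set unfolding QX_def by auto
    then show ?thesis using t1[OF Tin[OF k l(1)] l(2)] by blast
  qed
  have dec: "d2 (cH (C k) (z2 (cX (C k) m))) (y2 (cX (C k) m) (t1 x)) = (k, m)"
    if k: "k < K" and m: "m < M2" and x: "x \<in> set_pmf (QX (C k))" and nc: "\<not> confused C k m (t1 x)" for k m x
  proof -
    let ?\<kappa> = "cH (C k) (z2 (cX (C k) m))" and ?y = "y2 (cX (C k) m) (t1 x)"
    obtain l where "l < L" "t1 x = cT (C k) l" using QXset[OF k x] by blast
    then have g: "good ?\<kappa> ?y (k, m)" unfolding good_def using k m by (auto simp: matches_def)
    moreover have "p = (k, m)" if "good ?\<kappa> ?y p" for p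
      using that nc unfolding good_def confused_def by (cases p) auto
    ultimately show ?thesis unfolding d2_def by (metis someI)
  qed
  let ?err = "\<lambda>k m1 m2. if b (y1 (X1 k m1)) = m1 \<and> d2 (cH (C k) (z2 (cX (C k) m2))) (y2 (cX (C k) m2) (t1 (X1 k m1))) = (k, m2)
      then 0 else 1 :: real"
  have main: "(\<Sum>m1<M1. \<Sum>m2<M2. ?err k m1 m2) / (real M1 * real M2)
     \<le> ?cf C k + tv (C k) b" if k: "k < K" for k
  proof -
    let ?A = "\<lambda>m. PR (QX (C k)) {x. b (y1 x) = m}"
    let ?S = "\<lambda>m. \<Sum>x\<in>F k m. pmf (QX (C k)) x * ebar k x"
    have e01: "0 \<le> ebar k x" "ebar k x \<le> 1" for x
    proof -
      show "0 \<le> ebar k x" unfolding ebar_def conf_def by (intro divide_nonneg_nonneg sum_nonneg) auto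
      have "(\<Sum>m<M2. conf C k m (t1 x)) \<le> (\<Sum>m<M2. 1)" unfolding conf_def by (intro sum_mono) auto
      then show "ebar k x \<le> 1" unfolding ebar_def using pos by (simp add: field_simps)
    qed
    have A: "?A m = (\<Sum>x\<in>F k m. pmf (QX (C k)) x)" for m
    proof -
      have "?A m = PR (QX (C k)) ({x. b (y1 x) = m} \<inter> set_pmf (QX (C k)))" by (simp add: measure_Int_set_pmf)
      also have "{x. b (y1 x) = m} \<inter> set_pmf (QX (C k)) = F k m" by (auto simp: F_def)
      finally show ?thesis using fF by (simp add: measure_measure_pmf_finite)
    qed
    have each: "(\<Sum>m2<M2. ?err k m1 m2) / (real M1 * real M2) \<le> ?S m1 + \<bar>1 / M1 - ?A m1\<bar>" for m1
    \<comment> \<open>An empty bin has probability zero under \<open>QX\<close>, so its whole weight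
      \<open>1 / M1\<close> is contained in the deviation term.\<close>
    proof (cases "F k m1 = {}")
      case True
      have "(\<Sum>m2<M2. ?err k m1 m2) \<le> (\<Sum>m2<M2. 1)" by (intro sum_mono) auto
      then have "(\<Sum>m2<M2. ?err k m1 m2) / (real M1 * real M2) \<le> real M2 / (real M1 * real M2)"
        by (intro divide_right_mono) auto
      also have "\<dots> = 1 / M1" using pos by simp
      finally show ?thesis using True A[of m1] by simp
    next
      case False
      let ?x = "X1 k m1"
      have x: "?x \<in> F k m1" "\<And>x'. x' \<in> F k m1 \<Longrightarrow> ebar k ?x \<le> ebar k x'" using X1(2)[OF False] by auto
      have "(\<Sum>m2<M2. ?err k m1 m2) \<le> (\<Sum>m2<M2. conf C k m2 (t1 ?x))"
        using x(1) dec[OF k _ X1(1)] by (intro sum_mono) (auto simp: conf_def F_def)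
      then have "(\<Sum>m2<M2. ?err k m1 m2) / (real M1 * real M2) \<le> (\<Sum>m2<M2. conf C k m2 (t1 ?x)) / (real M1 * real M2)"
        by (intro divide_right_mono) auto
      \<comment> \<open>The weight \<open>1 / M1\<close> is exchanged for the probability of the
        bin. Inside the bin the best input is no worse than the average, and the exchange costs at
        most the deviation.\<close>
      also have "\<dots> = ?A m1 * ebar k ?x + (1 / M1 - ?A m1) * ebar k ?x"
        by (simp add: ebar_def algebra_simps)
      also have "\<dots> \<le> ?S m1 + \<bar>1 / M1 - ?A m1\<bar> * 1"
      proof (rule add_mono)
        show "?A m1 * ebar k ?x \<le> ?S m1"
          unfolding A sum_distrib_right using x(2) by (intro sum_mono mult_left_mono) auto
        have "(1 / M1 - ?A m1) * ebar k ?x \<le> \<bar>1 / M1 - ?A m1\<bar> * ebar k ?x"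
          using e01 by (intro mult_right_mono) auto
        also have "\<dots> \<le> \<bar>1 / M1 - ?A m1\<bar> * 1" using e01 by (intro mult_left_mono) auto
        finally show "(1 / M1 - ?A m1) * ebar k ?x \<le> \<bar>1 / M1 - ?A m1\<bar> * 1" .
      qed
      finally show ?thesis by simp
    qed
    have "(\<Sum>m1<M1. ?S m1) = (\<Sum>x\<in>(\<Union>m1<M1. F k m1). pmf (QX (C k)) x * ebar k x)"
      using fF by (subst sum.UNION_disjoint) (auto simp: F_def)
    also have "\<dots> \<le> (\<Sum>x\<in>set_pmf (QX (C k)). pmf (QX (C k)) x * ebar k x)"
      using e01 by (intro sum_mono2) (auto simp: F_def)
    also have "\<dots> = EV (QX (C k)) (ebar k)" by (simp add: EV_finite)
    also have "\<dots> = (\<Sum>l<L. EV (PX1 (cW (C k)) (cT (C k) l)) (ebar k)) / L" by (rule E_QX)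
    also have "\<dots> = (\<Sum>l<L. (\<Sum>m<M2. conf C k m (cT (C k) l)) / real M2) / L"
    proof (intro arg_cong2[where f="(/)"] sum.cong refl)
      fix l assume l: "l \<in> {..<L}"
      have "EV (PX1 (cW (C k)) (cT (C k) l)) (ebar k)
        = EV (PX1 (cW (C k)) (cT (C k) l)) (\<lambda>_. (\<Sum>m<M2. conf C k m (cT (C k) l)) / real M2)"
        using t1[OF Tin[OF k]] l by (intro EV_cong refl) (simp add: ebar_def)
      then show "EV (PX1 (cW (C k)) (cT (C k) l)) (ebar k) = (\<Sum>m<M2. conf C k m (cT (C k) l)) / real M2" by simp
    qed
    also have "\<dots> = ?cf C k"
      by (simp add: mult.commute flip: sum_divide_distrib)
    finally have S: "(\<Sum>m1<M1. ?S m1) \<le> ?cf C k" .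
    have "(\<Sum>m1<M1. \<Sum>m2<M2. ?err k m1 m2) / (real M1 * real M2) = (\<Sum>m1<M1. (\<Sum>m2<M2. ?err k m1 m2) / (real M1 * real M2))"
      by (rule sum_divide_distrib)
    also have "\<dots> \<le> (\<Sum>m1<M1. ?S m1 + \<bar>1 / M1 - ?A m1\<bar>)" using each by (rule sum_mono)
    also have "\<dots> = (\<Sum>m1<M1. ?S m1) + tv (C k) b" by (simp add: sum.distrib tv_def)
    finally show ?thesis using S by linarith
  qed
  have "EV \<pi> (\<lambda>k. (\<Sum>m1<M1. \<Sum>m2<M2. ?err k m1 m2) / (real M1 * real M2)) \<le> J (C, b)"
    unfolding J_def prod.case using main \<pi> by (intro EV_mono f\<pi>) auto
  also note J
  finally have fin: "EV \<pi> (\<lambda>k. (\<Sum>m1<M1. \<Sum>m2<M2. ?err k m1 m2) / (real M1 * real M2)) \<le> \<epsilon>" .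
  have "\<exists>w\<in>set_pmf PW. \<exists>\<tau>\<in>set_pmf (PT w). X1 k m \<in> set_pmf (PX1 w \<tau>)" if "k < K" for k m
    using QXset[OF that X1(1)[of k m]] Tin[OF that] Ck(1)[OF that] by blast
  moreover have "\<exists>w\<in>set_pmf PW. cX (C k) m \<in> set_pmf (PX2 w)" if "k < K" "m < M2" for k m
    using X2in[OF that] Ck(1)[OF that(1)] by blast
  moreover have "cH (C k) (z2 (cX (C k) m)) < K" if "k < K" "m < M2" for k m
  proof -
    have "z2 (cX (C k) m) \<in> ZS" using z_in_ZS[OF Ck(1,2)[OF that(1)] that(2)] .
    then have "cH (C k) (z2 (cX (C k) m)) \<in> set_pmf (pmf_of_set {..<K})"
      using Pi_pmf_in_set[OF finZS Ck(4)[OF that(1), unfolded hash_pmf_def]] by blast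
    then show ?thesis using K_set by simp
  qed
  ultimately show ?thesis using fin
    by (intro exI[of _ X1] exI[of _ "\<lambda>k. cX (C k)"] exI[of _ "\<lambda>k. cH (C k)"] exI[of _ b] exI[of _ d2]) blast
qed

end

section \<open>Words of independent letters\<close>

lemma collision_cong:
  assumes "\<And>v. v \<in> set_pmf p \<Longrightarrow> \<kappa> v = \<kappa>' v"
  shows "collision p \<kappa> c = collision p \<kappa>' c"
  unfolding collision_def
proof (rule EV_cong[OF refl])
  fix v assume "v \<in> set_pmf p"
  then have "\<kappa> v = \<kappa>' v" by (rule assms)
  then show "EV (\<kappa> v) (\<lambda>u. min 1 (c * pmf (\<kappa> v) u))
    = EV (\<kappa>' v) (\<lambda>u. min 1 (c * pmf (\<kappa>' v) u))" by simp
qed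

lemma collision_map: "collision (map_pmf g p) \<kappa> c = collision p (\<lambda>v. \<kappa> (g v)) c"
  unfolding collision_def by simp

lemma collision_inj:
  assumes "\<And>v. v \<in> set_pmf p \<Longrightarrow> inj_on f (set_pmf (\<kappa> v))"
  shows "collision p (\<lambda>v. map_pmf f (\<kappa> v)) c = collision p \<kappa> c"
  unfolding collision_def
proof (intro EV_cong refl)
  fix v assume v: "v \<in> set_pmf p"
  show "EV (map_pmf f (\<kappa> v)) (\<lambda>u. min 1 (c * pmf (map_pmf f (\<kappa> v)) u))
    = EV (\<kappa> v) (\<lambda>u. min 1 (c * pmf (\<kappa> v) u))"
    unfolding integral_map_pmf
    by (intro EV_cong refl) (simp add: pmf_map_inj[OF assms[OF v]])
qed

lemma collision_nonneg: "0 \<le> c \<Longrightarrow> 0 \<le> collision p \<kappa> c"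
  unfolding collision_def by (intro EV_nonneg) auto

lemma map2_kernel_list:
  assumes "length as = length ts"
  shows "map_pmf (\<lambda>xs. map2 g xs ts) (kernel_list p as) = kernel_list (\<lambda>(a, t). map_pmf (\<lambda>x. g x t) (p a)) (zip as ts)"
  using assms
proof (induction as ts rule: list_induct2)
  case (Cons a as t ts)
  show ?case by (simp add: map_bind_pmf bind_map_pmf map_pmf_comp Cons.IH[symmetric])
qed simp

lemma iid_return: "iid N (return_pmf a) = return_pmf (replicate N a)"
  by (induction N) (auto simp: bind_return_pmf)

lemma bind_fiber: "bind_pmf (map_pmf g p) (\<lambda>t. if t \<in> g ` set_pmf p then cond_pmf p {x. g x = t} else p) = p"
proof -
  have "bind_pmf (map_pmf g p) (\<lambda>t. if t \<in> g ` set_pmf p then cond_pmf p {x. g x = t} else p)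
    = bind_pmf p (\<lambda>x. cond_pmf p {y. g y = g x})"
    unfolding bind_map_pmf by (intro bind_pmf_cong refl) auto
  also have "\<dots> = p" by (rule bind_cond_pmf_fibers)
  finally show ?thesis .
qed

lemma powr_ceiling_bounds:
  fixes x :: real
  assumes "0 \<le> x"
  shows "2 powr x \<le> real (nat \<lceil>2 powr x\<rceil>)" "real (nat \<lceil>2 powr x\<rceil>) \<le> 2 * 2 powr x" "0 < nat \<lceil>2 powr x\<rceil>"
proof -
  have "1 \<le> 2 powr x" using assms by (simp add: ge_one_powr_ge_zero)
  then show "2 powr x \<le> real (nat \<lceil>2 powr x\<rceil>)" "real (nat \<lceil>2 powr x\<rceil>) \<le> 2 * 2 powr x" "0 < nat \<lceil>2 powr x\<rceil>"
    by linarith+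
qed

definition size_of_rate :: "nat \<Rightarrow> real \<Rightarrow> nat" where
  "size_of_rate N R = nat \<lceil>2 powr (real N * R)\<rceil>"

context z_channel
begin

text \<open>\<open>\<pi>\<close> is the law of the index \<open>k\<close> with which the block starts, and \<open>hash k\<close> produces the index for
  the next block.\<close>

definition block_for :: "nat pmf \<Rightarrow> nat \<Rightarrow> nat \<Rightarrow> nat \<Rightarrow> nat \<Rightarrow> real \<Rightarrow> bool" where
  "block_for \<pi> N M1 M2 K \<epsilon> \<longleftrightarrow> (\<exists>X1 X2 hash d1 d2.
    (\<forall>k<K. \<forall>m<M1. length (X1 k m) = N) \<and> (\<forall>k<K. \<forall>m<M2. length (X2 k m) = N) \<and>
    (\<forall>k<K. \<forall>m<M2. hash k (map z2 (X2 k m)) < K) \<and>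
    EV \<pi> (\<lambda>k. (\<Sum>m1<M1. \<Sum>m2<M2.
      if d1 (map y1 (X1 k m1)) = m1 \<and> d2 (hash k (map z2 (X2 k m2))) (map2 y2 (X2 k m2) (map t1 (X1 k m1))) = (k, m2)
      then 0 else 1) / (real M1 * real M2)) \<le> \<epsilon>)"

text \<open>The law of \<open>X1\<close> given \<open>W\<close> and \<open>T1\<close>. Conditioning
  on an impossible \<open>t\<close> is unspecified, hence the fallback \<open>p1 w\<close>, which
  never occurs under \<open>sT\<close>.\<close>

definition "sX w t p1 = (if t \<in> t1 ` set_pmf (p1 w) then cond_pmf (p1 w) {x. t1 x = t} else p1 w)"
definition "sT p1 w = map_pmf t1 (p1 w)"
definition "sYZT p2 = (\<lambda>(w, t). map_pmf (\<lambda>x. (y2 x t, z2 x)) (p2 w))"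
definition "sYZ p1 p2 w = bind_pmf (sT p1 w) (\<lambda>t. sYZT p2 (w, t))"
definition "sY2 pW p1 p2 = bind_pmf pW (\<lambda>w. map_pmf fst (sYZ p1 p2 w))"
definition "sWT pW p1 = bind_pmf pW (\<lambda>w. map_pmf (Pair w) (sT p1 w))"
definition "sY1T p1 = (\<lambda>(w, t). map_pmf y1 (sX w t p1))"
definition "sY1 p1 w = map_pmf y1 (p1 w)"

lemma bind_sT_sX: "bind_pmf (sT p1 w) (\<lambda>t. sX w t p1) = p1 w"
  unfolding sT_def sX_def by (rule bind_fiber)

lemma sX_t1: "t \<in> set_pmf (sT p1 w) \<Longrightarrow> x \<in> set_pmf (sX w t p1) \<Longrightarrow> t1 x = t"
proof -
  assume t: "t \<in> set_pmf (sT p1 w)" and x: "x \<in> set_pmf (sX w t p1)"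
  have ne: "set_pmf (p1 w) \<inter> {x. t1 x = t} \<noteq> {}" using t by (auto simp: sT_def)
  have "sX w t p1 = cond_pmf (p1 w) {x. t1 x = t}" using t by (simp add: sX_def sT_def)
  then show "t1 x = t" using x by (simp add: set_cond_pmf[OF ne])
qed

definition "PTn p1 ws = kernel_list (sT p1) ws"
definition "PX1n p1 ws ts = kernel_list (\<lambda>(w, t). sX w t p1) (zip ws ts)"
definition "y2n xs ts = map2 y2 xs ts"

lemma finite_kl: "finite (set_pmf (kernel_list (\<kappa> :: _ \<Rightarrow> 'q::finite pmf) as))"
  by (intro finite_kernel_list finite_supp)

text \<open>The block channel delivers \<open>Y2\<close> and \<open>Z2\<close> as two words, the
  memoryless kernel as one word of pairs. The passage is injective, so collision terms do not
  change.\<close>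

definition "unzip l = (map fst l, map snd l)"

lemma inj_unzip: "inj_on unzip S"
  unfolding unzip_def by (rule inj_onI) (metis zip_map_fst_snd prod.inject)

lemma YZ_unzip: "length xs = length ts \<Longrightarrow> (y2n xs ts, map z2 xs) = unzip (map2 (\<lambda>x t. (y2 x t, z2 x)) xs ts)"
  by (simp add: y2n_def unzip_def) (induction xs ts rule: list_induct2; simp)

end

locale iid_block = z_channel y1 t1 y2 z2
  for y1 :: "'x1::finite \<Rightarrow> 'y1::finite"
    and t1 :: "'x1 \<Rightarrow> 't1::finite"
    and y2 :: "'x2::finite \<Rightarrow> 't1 \<Rightarrow> 'y2::finite"
    and z2 :: "'x2 \<Rightarrow> 'z2::finite" +
  fixes pW :: "'w pmf" and p1 :: "'w \<Rightarrow> 'x1 pmf" and p2 :: "'w \<Rightarrow> 'x2 pmf" and N M1 M2 L K :: nat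
  assumes fin_pW: "finite (set_pmf pW)" and sizes: "0 < M1" "0 < M2" "0 < L" "0 < K"
begin

sublocale B: block_code "iid N pW" "PTn p1" "PX1n p1" "kernel_list p2" "map y1" "map t1" y2n "map z2" M1 M2 L K
proof
  show "finite (set_pmf (iid N pW))" using fin_pW by (intro finite_iid)
  show "finite (set_pmf (PTn p1 w))" for w unfolding PTn_def by (rule finite_kl)
  show "finite (set_pmf (PX1n p1 w t))" for w t unfolding PX1n_def by (rule finite_kl)
  show "finite (set_pmf (kernel_list p2 w))" for w by (rule finite_kl)
  show "0 < M1" "0 < M2" "0 < L" "0 < K" by (fact sizes)+
  fix ws ts xs assume "ts \<in> set_pmf (PTn p1 ws)" "xs \<in> set_pmf (PX1n p1 ws ts)"
  then have a: "list_all2 (\<lambda>w t. t \<in> set_pmf (sT p1 w)) ws ts"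
    and b: "list_all2 (\<lambda>a x. x \<in> set_pmf ((\<lambda>(w, t). sX w t p1) a)) (zip ws ts) xs"
    by (simp_all add: PTn_def PX1n_def set_kernel_list)
  have len: "length ws = length ts" "length xs = length ts"
    using list_all2_lengthD[OF a] list_all2_lengthD[OF b] by auto
  show "map t1 xs = ts"
  proof (rule nth_equalityI)
    fix i assume "i < length (map t1 xs)"
    then have i: "i < length ts" using len by simp
    have "ts ! i \<in> set_pmf (sT p1 (ws ! i))" using a i len by (simp add: list_all2_conv_all_nth)
    moreover have "xs ! i \<in> set_pmf (sX (ws ! i) (ts ! i) p1)" using b i len by (simp add: list_all2_conv_all_nth)
    ultimately show "map t1 xs ! i = ts ! i" using sX_t1 i len by simp
  qed (use len in simp)
qed

lemma PYZT_eq: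
  assumes "length ts = length ws"
  shows "B.PYZT ws ts = map_pmf unzip (kernel_list (sYZT p2) (zip ws ts))"
proof -
  have "kernel_list (sYZT p2) (zip ws ts) = map_pmf (\<lambda>xs. map2 (\<lambda>x t. (y2 x t, z2 x)) xs ts) (kernel_list p2 ws)"
    unfolding sYZT_def using assms by (subst map2_kernel_list) auto
  then have "map_pmf unzip (kernel_list (sYZT p2) (zip ws ts)) = map_pmf (\<lambda>xs. unzip (map2 (\<lambda>x t. (y2 x t, z2 x)) xs ts)) (kernel_list p2 ws)"
    by (simp add: map_pmf_comp)
  also have "\<dots> = B.PYZT ws ts"
    unfolding B.PYZT_def B.YZ_def using assms
    by (intro map_pmf_cong refl) (simp add: YZ_unzip length_kernel_list)
  finally show ?thesis by simp
qed

lemma PTn_length: "ts \<in> set_pmf (PTn p1 ws) \<Longrightarrow> length ts = length ws"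
  unfolding PTn_def by (rule length_kernel_list)

lemma PYZ_eq: "B.PYZ ws = map_pmf unzip (kernel_list (sYZ p1 p2) ws)"
proof -
  have "B.PYZ ws = bind_pmf (PTn p1 ws) (\<lambda>ts. map_pmf unzip (kernel_list (sYZT p2) (zip ws ts)))"
    unfolding B.PYZ_def by (intro bind_pmf_cong refl PYZT_eq PTn_length)
  also have "\<dots> = map_pmf unzip (bind_pmf (kernel_list (sT p1) ws) (\<lambda>ts. kernel_list (sYZT p2) (zip ws ts)))"
    by (simp add: map_bind_pmf PTn_def)
  also have "bind_pmf (kernel_list (sT p1) ws) (\<lambda>ts. kernel_list (sYZT p2) (zip ws ts)) = kernel_list (sYZ p1 p2) ws"
    unfolding bind_kernel_list_snd sYZ_def[abs_def] ..
  finally show ?thesis .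
qed

lemma PY2_eq: "B.PY2 = iid N (sY2 pW p1 p2)"
proof -
  have "B.PY2 = bind_pmf (iid N pW) (kernel_list (\<lambda>w. map_pmf fst (sYZ p1 p2 w)))"
    unfolding B.PY2_def PYZ_eq by (simp add: map_pmf_comp unzip_def map_kernel_list)
  then show ?thesis unfolding bind_iid_snd sY2_def .
qed

lemma PWT_eq: "map_pmf (\<lambda>(ws, ts). zip ws ts) B.PWT = iid N (sWT pW p1)"
  unfolding B.PWT_def PTn_def sWT_def by (simp add: map_bind_pmf map_pmf_comp bind_iid)

lemma PY1T_eq: "B.PY1T ws ts = kernel_list (sY1T p1) (zip ws ts)"
  unfolding B.PY1T_def PX1n_def sY1T_def by (simp add: map_kernel_list case_prod_beta')

lemma PY1_eq: "B.PY1 ws = kernel_list (sY1 p1) ws"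
proof -
  have "B.PY1 ws = bind_pmf (kernel_list (sT p1) ws) (\<lambda>ts. kernel_list (sY1T p1) (zip ws ts))"
    unfolding B.PY1_def PY1T_eq PTn_def ..
  also have "\<dots> = kernel_list (sY1 p1) ws"
    unfolding bind_kernel_list_snd sY1T_def prod.case map_bind_pmf[symmetric] bind_sT_sX sY1_def[abs_def] ..
  finally show ?thesis .
qed

lemma collision_PY2: "collision (return_pmf ()) (\<lambda>_. B.PY2) c
   = collision (iid N (return_pmf ())) (kernel_list (\<lambda>_. sY2 pW p1 p2)) c"
  unfolding PY2_eq iid_return by (simp add: collision_def iid_def)

lemma collision_PYZ: "collision (iid N pW) B.PYZ c = collision (iid N pW) (kernel_list (sYZ p1 p2)) c"
  unfolding PYZ_eq[abs_def] by (rule collision_inj) (rule inj_unzip)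

lemma collision_PYZT: "collision B.PWT (\<lambda>(w, t). B.PYZT w t) c = collision (iid N (sWT pW p1)) (kernel_list (sYZT p2)) c"
proof -
  have "collision B.PWT (\<lambda>(w, t). B.PYZT w t) c
    = collision B.PWT (\<lambda>v. map_pmf unzip (kernel_list (sYZT p2) ((\<lambda>(ws, ts). zip ws ts) v))) c"
  proof (rule collision_cong)
    fix v assume "v \<in> set_pmf B.PWT"
    then show "(\<lambda>(w, t). B.PYZT w t) v = map_pmf unzip (kernel_list (sYZT p2) ((\<lambda>(ws, ts). zip ws ts) v))"
      unfolding B.PWT_def using PTn_length by (auto simp: PYZT_eq)
  qed
  also have "\<dots> = collision B.PWT (\<lambda>v. kernel_list (sYZT p2) ((\<lambda>(ws, ts). zip ws ts) v)) c"
    by (rule collision_inj) (rule inj_unzip)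
  also have "\<dots> = collision (iid N (sWT pW p1)) (kernel_list (sYZT p2)) c"
    unfolding PWT_eq[symmetric] collision_map ..
  finally show ?thesis .
qed

lemma collision_PY1T: "collision B.PWT (\<lambda>(w, t). B.PY1T w t) c = collision (iid N (sWT pW p1)) (kernel_list (sY1T p1)) c"
  unfolding PWT_eq[symmetric] collision_map PY1T_eq by (simp add: case_prod_beta')

lemma collision_PY1: "collision (iid N pW) B.PY1 c = collision (iid N pW) (kernel_list (sY1 p1)) c"
  unfolding PY1_eq[abs_def] ..

lemma block_exists:
  assumes \<pi>: "set_pmf \<pi> \<subseteq> {..<K}" and ab: "0 < \<alpha>" "0 < \<beta>" and s: "0 < s"
    and le: "collision (iid N (return_pmf ())) (kernel_list (\<lambda>_. sY2 pW p1 p2)) (real M2 * real L)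
      + collision (iid N pW) (kernel_list (sYZ p1 p2)) (real M2 * real L)
      + collision (iid N (sWT pW p1)) (kernel_list (sYZT p2)) (real M2) + M2 / K
      + (if M1 = 1 then 0 else s / 2 + M1 / (2 * s) * (\<alpha> / L + \<beta>)
        + 2 * (collision (iid N (sWT pW p1)) (kernel_list (sY1T p1)) (1 / \<alpha>)
             + collision (iid N pW) (kernel_list (sY1 p1)) (1 / \<beta>))) \<le> \<epsilon>"
  shows "block_for \<pi> N M1 M2 K \<epsilon>"
proof -
  have le': "B.err_bound + (if M1 = 1 then 0 else B.tv_bound \<alpha> \<beta> s) \<le> \<epsilon>"
    using le unfolding B.err_bound_def B.tv_bound_def collision_PY2 collision_PYZ collision_PYZT collision_PY1T collision_PY1
    by simp
  obtain X1 X2 hash d1 d2 where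
    X1: "\<forall>k<K. \<forall>m<M1. \<exists>w\<in>set_pmf (iid N pW). \<exists>\<tau>\<in>set_pmf (PTn p1 w). X1 k m \<in> set_pmf (PX1n p1 w \<tau>)"
    and X2: "\<forall>k<K. \<forall>m<M2. \<exists>w\<in>set_pmf (iid N pW). X2 k m \<in> set_pmf (kernel_list p2 w)"
    and h: "\<forall>k<K. \<forall>m<M2. hash k (map z2 (X2 k m)) < K"
    and e: "EV \<pi> (\<lambda>k. (\<Sum>m1<M1. \<Sum>m2<M2.
      if d1 (map y1 (X1 k m1)) = m1 \<and> d2 (hash k (map z2 (X2 k m2))) (y2n (X2 k m2) (map t1 (X1 k m1))) = (k, m2)
      then 0 else 1) / (real M1 * real M2)) \<le> \<epsilon>"
    using B.block_code_exists[OF \<pi> ab s le'] by (elim exE conjE) (rule that, assumption+)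
  have "length (X1 k m) = N" if "k < K" "m < M1" for k m
  proof -
    obtain w \<tau> where w: "w \<in> set_pmf (iid N pW)" "\<tau> \<in> set_pmf (PTn p1 w)" "X1 k m \<in> set_pmf (PX1n p1 w \<tau>)"
      using X1 \<open>k < K\<close> \<open>m < M1\<close> by blast
    then show ?thesis using set_iid[OF w(1)] PTn_length[OF w(2)] unfolding PX1n_def by (auto dest!: length_kernel_list)
  qed
  moreover have "length (X2 k m) = N" if "k < K" "m < M2" for k m
  proof -
    obtain w where w: "w \<in> set_pmf (iid N pW)" "X2 k m \<in> set_pmf (kernel_list p2 w)"
      using X2 \<open>k < K\<close> \<open>m < M2\<close> by blast
    then show ?thesis using set_iid[OF w(1)] by (auto dest!: length_kernel_list)
  qed
  ultimately show ?thesis using h e unfolding y2n_def block_for_def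
    by (intro exI[of _ X1] exI[of _ X2] exI[of _ hash] exI[of _ d1] exI[of _ d2]) blast
qed

end

section \<open>Rates at which the block error vanishes\<close>

context z_channel
begin

lemma entropy_kernel:
  fixes q :: "'t pmf" and \<kappa> :: "'t \<Rightarrow> 'u pmf"
  assumes q: "finite (set_pmf q)" and \<kappa>: "\<And>t. finite (set_pmf (\<kappa> t))"
    and r: "finite (set_pmf r)" "map_pmf (\<lambda>s. (V s, T s)) r = bind_pmf q (\<lambda>t. map_pmf (\<lambda>u. (u, t)) (\<kappa> t))"
  shows "EV q (\<lambda>t. entropy_pmf (\<kappa> t) (\<lambda>u. u)) = entropy_pmf r (\<lambda>s. (V s, T s)) - entropy_pmf r T"
proof -
  let ?j = "bind_pmf q (\<lambda>t. map_pmf (Pair t) (\<kappa> t))"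
  have fj: "finite (set_pmf ?j)" using q \<kappa> by auto
  have "map_pmf T r = map_pmf snd (map_pmf (\<lambda>s. (V s, T s)) r)" by (simp add: map_pmf_comp)
  also have "\<dots> = q" unfolding r(2) by (simp add: map_bind_pmf map_pmf_comp bind_return_pmf')
  finally have T: "map_pmf T r = q" .
  have "entropy_pmf r (\<lambda>s. (V s, T s)) = entropy_pmf ?j (\<lambda>(w, x). (x, w))"
    by (rule entropy_cong_map[OF r(1) fj]) (simp add: r(2) map_bind_pmf map_pmf_comp)
  also have "\<dots> = entropy_pmf q (\<lambda>w. w) + EV q (\<lambda>t. entropy_pmf (\<kappa> t) (\<lambda>u. u))"
    using entropy_mixture[of q \<kappa> "\<lambda>_ x. x", OF q \<kappa>] by simp
  also have "entropy_pmf q (\<lambda>w. w) = entropy_pmf r T"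
    by (rule entropy_cong_map[OF q r(1)]) (simp add: T)
  finally show ?thesis by simp
qed

lemma E_sWT:
  assumes "finite (set_pmf pW)"
  shows "EV (sWT pW p1) f = EV pW (\<lambda>w. EV (sT p1 w) (\<lambda>t. (f (w, t) :: real)))"
  unfolding sWT_def using assms by (subst EV_bind) (auto intro: finite_supp)

text \<open>Identifies the rate thresholds of the five collision terms as \<open>H(Y2)\<close>,
  \<open>H(Y2,Z2|W)\<close>, \<open>H(Y2,Z2|T1,W)\<close>, \<open>H(Y1|T1,W)\<close> and
  \<open>H(Y1|W)\<close>, in this order.\<close>

lemma single_letter_entropies:
  assumes fin: "finite (set_pmf pW)"
  shows "EV (return_pmf ()) (\<lambda>_. entropy_pmf (sY2 pW p1 p2) (\<lambda>u. u)) = H2 pW p1 p2"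
    and "EV pW (\<lambda>w. entropy_pmf (sYZ p1 p2 w) (\<lambda>u. u)) = mean hD pW p1 p2"
    and "EV (sWT pW p1) (\<lambda>v. entropy_pmf (sYZT p2 v) (\<lambda>u. u)) = mean hB pW p1 p2"
    and "EV (sWT pW p1) (\<lambda>v. entropy_pmf (sY1T p1 v) (\<lambda>u. u)) = mean hC pW p1 p2"
    and "EV pW (\<lambda>w. entropy_pmf (sY1 p1 w) (\<lambda>u. u)) = mean hA pW p1 p2"
proof -
  have yz: "map_pmf YZ (pair_pmf (p1 w) (p2 w)) = sYZ p1 p2 w" for w
    unfolding sYZ_def sT_def sYZT_def YZ_def Y2_def Z2_def pair_pmf_def
    by (simp add: map_bind_pmf bind_map_pmf map_pmf_def bind_assoc_pmf bind_return_pmf)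
  have y2: "map_pmf Y2 (bind_pmf pW (law p1 p2)) = sY2 pW p1 p2"
    unfolding sY2_def yz[symmetric] by (simp add: map_bind_pmf map_pmf_comp YZ_def)
  show "EV (return_pmf ()) (\<lambda>_. entropy_pmf (sY2 pW p1 p2) (\<lambda>u. u)) = H2 pW p1 p2"
    unfolding expectation_return_pmf
    by (rule entropy_cong_map) (auto intro: finite_supp simp: y2)
  show "EV pW (\<lambda>w. entropy_pmf (sYZ p1 p2 w) (\<lambda>u. u)) = mean hD pW p1 p2"
    unfolding hD_def
    by (intro EV_cong refl entropy_cong_map) (auto intro: finite_supp simp: yz)
  show "EV pW (\<lambda>w. entropy_pmf (sY1 p1 w) (\<lambda>u. u)) = mean hA pW p1 p2"
    unfolding hA_def
  proof (intro EV_cong refl entropy_cong_map)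
    fix w
    have "map_pmf Y1 (pair_pmf (p1 w) (p2 w)) = map_pmf y1 (map_pmf fst (pair_pmf (p1 w) (p2 w)))"
      by (simp add: map_pmf_comp Y1_def case_prod_beta')
    then show "map_pmf (\<lambda>u. u) (sY1 p1 w) = map_pmf Y1 (pair_pmf (p1 w) (p2 w))"
      by (simp add: map_fst_pair_pmf sY1_def)
  qed (auto intro: finite_supp)
  show "EV (sWT pW p1) (\<lambda>v. entropy_pmf (sYZT p2 v) (\<lambda>u. u)) = mean hB pW p1 p2"
    unfolding E_sWT[OF fin] hB_def
  proof (intro EV_cong refl entropy_kernel)
    fix w
    show "map_pmf (\<lambda>s. (YZ s, T1 s)) (pair_pmf (p1 w) (p2 w)) = bind_pmf (sT p1 w) (\<lambda>t. map_pmf (\<lambda>u. (u, t)) (sYZT p2 (w, t)))"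
      unfolding sT_def sYZT_def YZ_def Y2_def Z2_def T1_def pair_pmf_def
      by (simp add: map_bind_pmf bind_map_pmf map_pmf_def bind_assoc_pmf bind_return_pmf)
  qed (auto intro: finite_supp)
  show "EV (sWT pW p1) (\<lambda>v. entropy_pmf (sY1T p1 v) (\<lambda>u. u)) = mean hC pW p1 p2"
    unfolding E_sWT[OF fin] hC_def
  proof (intro EV_cong refl entropy_kernel)
    fix w
    have "map_pmf (\<lambda>s. (Y1 s, T1 s)) (pair_pmf (p1 w) (p2 w)) = map_pmf (\<lambda>x. (y1 x, t1 x)) (map_pmf fst (pair_pmf (p1 w) (p2 w)))"
      by (simp add: map_pmf_comp Y1_def T1_def case_prod_beta')
    also have "\<dots> = map_pmf (\<lambda>x. (y1 x, t1 x)) (bind_pmf (sT p1 w) (\<lambda>t. sX w t p1))"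
      by (simp add: map_fst_pair_pmf bind_sT_sX)
    also have "\<dots> = bind_pmf (sT p1 w) (\<lambda>t. map_pmf (\<lambda>u. (u, t)) (sY1T p1 (w, t)))"
      unfolding map_bind_pmf sY1T_def prod.case map_pmf_comp
      by (intro bind_pmf_cong refl map_pmf_cong) (simp add: sX_t1)
    finally show "map_pmf (\<lambda>s. (Y1 s, T1 s)) (pair_pmf (p1 w) (p2 w)) = bind_pmf (sT p1 w) (\<lambda>t. map_pmf (\<lambda>u. (u, t)) (sY1T p1 (w, t)))" .
  qed (auto intro: finite_supp)
qed

lemma powr_exp_tendsto_0:
  assumes "c < 0"
  shows "(\<lambda>N. 2 powr (real N * c)) \<longlonglongrightarrow> 0"
proof -
  have "2 powr (real N * c) = (2 powr c) ^ N" for N by (simp add: powr_power mult.commute)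
  moreover have "(\<lambda>N. (2 powr c) ^ N) \<longlonglongrightarrow> 0"
    using assms by (intro LIMSEQ_power_zero) (simp add: powr_less_one)
  ultimately show ?thesis by simp
qed

lemma size_of_rate_bounds:
  assumes "0 \<le> R"
  shows "2 powr (real N * R) \<le> real (size_of_rate N R)" "real (size_of_rate N R) \<le> 2 * 2 powr (real N * R)" "0 < size_of_rate N R"
  unfolding size_of_rate_def using powr_ceiling_bounds[of "real N * R"] assms by auto

text \<open>With \<open>K = M2 * 2 ^ N\<close> the hash term is \<open>(1/2) ^ N\<close>; so many
  clouds are affordable because their number cancels elsewhere. The parameter \<open>s\<close> is
  set to \<open>\<delta>\<close>, whose share \<open>\<delta> / 2\<close> leaves room for the
  vanishing terms.\<close>

lemma block_eventually:
  assumes fin: "finite (set_pmf pW)" and R: "0 \<le> R1" "0 \<le> R2" "0 < Rt"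
    and HY: "R2 + Rt < H2 pW p1 p2"
    and HD: "R2 + Rt < mean hD pW p1 p2"
    and HB: "R2 < mean hB pW p1 p2"
    and R1: "R1 = 0 \<or> R1 < mean hA pW p1 p2 \<and>
       R1 - Rt < mean hC pW p1 p2"
    and \<delta>: "0 < \<delta>"
  shows "\<forall>\<^sub>F N in sequentially. \<forall>\<pi>. set_pmf \<pi> \<subseteq> {..<size_of_rate N R2 * 2 ^ N} \<longrightarrow>
    block_for \<pi> N (size_of_rate N R1) (size_of_rate N R2) (size_of_rate N R2 * 2 ^ N) \<delta>"
proof -
  let ?M1 = "\<lambda>N. size_of_rate N R1" and ?M2 = "\<lambda>N. size_of_rate N R2" and ?L = "\<lambda>N. size_of_rate N Rt"
  let ?K = "\<lambda>N. size_of_rate N R2 * 2 ^ N"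
  note S1 = size_of_rate_bounds[OF R(1)] and S2 = size_of_rate_bounds[OF R(2)] and St = size_of_rate_bounds[OF less_imp_le[OF R(3)]]
  note ent = single_letter_entropies[OF fin]
  have fWT: "finite (set_pmf (sWT pW p1))" unfolding sWT_def using fin by (auto intro: finite_supp)
  have c12: "real (?M2 N) * real (?L N) \<le> 4 * 2 powr (real N * (R2 + Rt))" for N
  proof -
    have "real (?M2 N) * real (?L N) \<le> (2 * 2 powr (real N * R2)) * (2 * 2 powr (real N * Rt))"
      using S2 St by (intro mult_mono) auto
    then show ?thesis by (simp add: powr_add distrib_left)
  qed
  have limY: "(\<lambda>N. collision (iid N (return_pmf ())) (kernel_list (\<lambda>_. sY2 pW p1 p2)) (real (?M2 N) * real (?L N))) \<longlonglongrightarrow> 0"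
    by (rule collision_tendsto_0[OF _ _ _ _ c12]) (use HY ent(1)[of p1 p2] in \<open>auto intro: finite_supp\<close>)
  have limD: "(\<lambda>N. collision (iid N pW) (kernel_list (sYZ p1 p2)) (real (?M2 N) * real (?L N))) \<longlonglongrightarrow> 0"
    by (rule collision_tendsto_0[OF fin _ _ _ c12]) (auto intro: finite_supp simp: ent(2) HD)
  have limB: "(\<lambda>N. collision (iid N (sWT pW p1)) (kernel_list (sYZT p2)) (real (?M2 N))) \<longlonglongrightarrow> 0"
    by (rule collision_tendsto_0[OF fWT _ _ _ S2(2)]) (auto intro: finite_supp simp: ent(3) HB)
  have limK: "(\<lambda>N. real (?M2 N) / real (?K N)) \<longlonglongrightarrow> 0"
  proof -
    have "real (?M2 N) / real (?K N) = (1/2) ^ N" for N using S2(3)[of N] by (simp add: power_one_over)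
    then show ?thesis by (simp add: LIMSEQ_power_zero)
  qed
  obtain \<alpha> \<beta> :: "nat \<Rightarrow> real" where ab: "\<And>N. 0 < \<alpha> N" "\<And>N. 0 < \<beta> N"
    and limT: "R1 \<noteq> 0 \<Longrightarrow> (\<lambda>N. real (?M1 N) / (2 * \<delta>) * (\<alpha> N / real (?L N) + \<beta> N)
        + 2 * (collision (iid N (sWT pW p1)) (kernel_list (sY1T p1)) (1 / \<alpha> N)
             + collision (iid N pW) (kernel_list (sY1 p1)) (1 / \<beta> N))) \<longlonglongrightarrow> 0"
  proof (cases "R1 = 0")
    case True
    then show thesis using that[of "\<lambda>_. 1" "\<lambda>_. 1"] by simp
  next
    case False
    then have hA: "R1 < mean hA pW p1 p2"
      and hC: "R1 - Rt < mean hC pW p1 p2" using R1 by auto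
    \<comment> \<open>The thresholds will be \<open>2 powr (- (real N * a))\<close> and
      \<open>2 powr (- (real N * b))\<close>. Exponents below the averages of \<open>hC\<close> and
      \<open>hA\<close> make the discarded mass vanish; exponents above \<open>R1 - Rt\<close> and
      \<open>R1\<close> make the variance term vanish.\<close>
    obtain a where a: "R1 - Rt < a" "a < mean hC pW p1 p2"
      using dense[OF hC] by blast
    obtain b where b: "R1 < b" "b < mean hA pW p1 p2"
      using dense[OF hA] by blast
    let ?pq = "\<lambda>N. 2 powr (- (real N * a)) / real (?L N) + 2 powr (- (real N * b))"
    let ?pr = "\<lambda>N. 1 / \<delta> * (2 powr (real N * (R1 - Rt - a)) + 2 powr (real N * (R1 - b)))"
    show thesis
    proof (rule that[of "\<lambda>N. 2 powr (- (real N * a))" "\<lambda>N. 2 powr (- (real N * b))"])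
      have inv: "1 / 2 powr (- x) = 2 powr x" for x :: real by (simp add: powr_minus divide_inverse)
      have l1: "(\<lambda>N. collision (iid N (sWT pW p1)) (kernel_list (sY1T p1)) (1 / 2 powr (- (real N * a)))) \<longlonglongrightarrow> 0"
        unfolding inv
        by (rule collision_tendsto_0[OF fWT, where a=a and C=1]) (use a ent(4)[of p1 p2] in \<open>auto intro: finite_supp\<close>)
      have l2: "(\<lambda>N. collision (iid N pW) (kernel_list (sY1 p1)) (1 / 2 powr (- (real N * b)))) \<longlonglongrightarrow> 0"
        unfolding inv
        by (rule collision_tendsto_0[OF fin, where a=b and C=1]) (use b ent(5)[of p1 p2] in \<open>auto intro: finite_supp\<close>)
      have l3: "(\<lambda>N. real (?M1 N) / (2 * \<delta>) * (?pq N)) \<longlonglongrightarrow> 0"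
      proof (rule tendsto_sandwich[OF _ _ tendsto_const])
        show "\<forall>\<^sub>F N in sequentially. 0 \<le> real (?M1 N) / (2 * \<delta>) * (?pq N)"
          using \<delta> by (intro always_eventually allI mult_nonneg_nonneg add_nonneg_nonneg divide_nonneg_nonneg) auto
        show "\<forall>\<^sub>F N in sequentially. real (?M1 N) / (2 * \<delta>) * (?pq N)
          \<le> ?pr N"
        proof (intro always_eventually allI)
          fix N
          have "real (?M1 N) / (2 * \<delta>) * (?pq N)
            \<le> (2 * 2 powr (real N * R1)) / (2 * \<delta>) * (2 powr (- (real N * a)) / 2 powr (real N * Rt) + 2 powr (- (real N * b)))"
            using S1(2)[of N] St(1)[of N] St(3)[of N] \<delta>
            by (intro mult_mono divide_right_mono add_mono divide_left_mono order_refl mult_pos_pos add_nonneg_nonneg) auto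
          also have "\<dots> = 1 / \<delta> * (2 powr (real N * R1) * 2 powr (- (real N * a)) / 2 powr (real N * Rt) + 2 powr (real N * R1) * 2 powr (- (real N * b)))"
            using \<delta> by (simp add: distrib_left)
          also have "\<dots> = ?pr N"
            unfolding powr_add[symmetric] powr_diff[symmetric] by (simp add: algebra_simps)
          finally show "real (?M1 N) / (2 * \<delta>) * (?pq N)
            \<le> ?pr N" .
        qed
        have "(\<lambda>N. ?pr N) \<longlonglongrightarrow> 1 / \<delta> * (0 + 0)"
          using a b by (intro tendsto_mult tendsto_const tendsto_add powr_exp_tendsto_0) auto
        then show "(\<lambda>N. ?pr N) \<longlonglongrightarrow> 0" by simp
      qed
      show "(\<lambda>N. real (?M1 N) / (2 * \<delta>) * (?pq N)
        + 2 * (collision (iid N (sWT pW p1)) (kernel_list (sY1T p1)) (1 / 2 powr (- (real N * a)))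
             + collision (iid N pW) (kernel_list (sY1 p1)) (1 / 2 powr (- (real N * b))))) \<longlonglongrightarrow> 0"
        using tendsto_add[OF l3 tendsto_mult[OF tendsto_const[of 2] tendsto_add[OF l1 l2]]] by simp
    qed auto
  qed
  define F where "F = (\<lambda>N. collision (iid N (return_pmf ())) (kernel_list (\<lambda>_. sY2 pW p1 p2)) (real (?M2 N) * real (?L N))
      + collision (iid N pW) (kernel_list (sYZ p1 p2)) (real (?M2 N) * real (?L N))
      + collision (iid N (sWT pW p1)) (kernel_list (sYZT p2)) (real (?M2 N)) + real (?M2 N) / real (?K N)
      + (if R1 = 0 then 0 else \<delta> / 2 + (real (?M1 N) / (2 * \<delta>) * (\<alpha> N / real (?L N) + \<beta> N)
        + 2 * (collision (iid N (sWT pW p1)) (kernel_list (sY1T p1)) (1 / \<alpha> N)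
             + collision (iid N pW) (kernel_list (sY1 p1)) (1 / \<beta> N)))))"
  have "(\<lambda>N. if R1 = 0 then 0 else \<delta> / 2 + (real (?M1 N) / (2 * \<delta>) * (\<alpha> N / real (?L N) + \<beta> N)
        + 2 * (collision (iid N (sWT pW p1)) (kernel_list (sY1T p1)) (1 / \<alpha> N)
             + collision (iid N pW) (kernel_list (sY1 p1)) (1 / \<beta> N)))) \<longlonglongrightarrow> (if R1 = 0 then 0 else \<delta> / 2 + 0)"
  proof (cases "R1 = 0")
    case True
    then show ?thesis by simp
  next
    case False
    then show ?thesis using tendsto_add[OF tendsto_const[of "\<delta> / 2"] limT[OF False]] by simp
  qed
  then have "F \<longlonglongrightarrow> 0 + 0 + 0 + 0 + (if R1 = 0 then 0 else \<delta> / 2 + 0)"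
    unfolding F_def by (intro tendsto_add limY limD limB limK)
  moreover have "0 + 0 + 0 + 0 + (if R1 = 0 then 0 else \<delta> / 2 + 0) < \<delta>" using \<delta> by simp
  ultimately have "\<forall>\<^sub>F N in sequentially. F N < \<delta>" by (rule order_tendstoD(2))
  then show ?thesis
  proof (rule eventually_mono, intro allI impI)
    fix N and \<pi> :: "nat pmf" assume FN: "F N < \<delta>" and \<pi>: "set_pmf \<pi> \<subseteq> {..<?K N}"
    interpret iid_block y1 t1 y2 z2 pW p1 p2 N "?M1 N" "?M2 N" "?L N" "?K N"
      using fin S1(3) S2(3) St(3) by unfold_locales auto
    let ?t = "\<delta> / 2 + real (?M1 N) / (2 * \<delta>) * (\<alpha> N / real (?L N) + \<beta> N)
        + 2 * (collision (iid N (sWT pW p1)) (kernel_list (sY1T p1)) (1 / \<alpha> N)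
             + collision (iid N pW) (kernel_list (sY1 p1)) (1 / \<beta> N))"
    have t0: "0 \<le> ?t" using \<delta> ab[of N] less_imp_le[OF ab(1)] less_imp_le[OF ab(2)]
      by (intro add_nonneg_nonneg mult_nonneg_nonneg divide_nonneg_nonneg collision_nonneg) auto
    have M1: "R1 = 0 \<Longrightarrow> ?M1 N = 1" by (simp add: size_of_rate_def)
    have "(if ?M1 N = 1 then 0 else ?t) \<le> (if R1 = 0 then 0 else ?t)" using t0 M1 by auto
    then have "collision (iid N (return_pmf ())) (kernel_list (\<lambda>_. sY2 pW p1 p2)) (real (?M2 N) * real (?L N))
      + collision (iid N pW) (kernel_list (sYZ p1 p2)) (real (?M2 N) * real (?L N))
      + collision (iid N (sWT pW p1)) (kernel_list (sYZT p2)) (real (?M2 N)) + real (?M2 N) / real (?K N)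
      + (if ?M1 N = 1 then 0 else ?t) \<le> \<delta>" using FN unfolding F_def add.assoc by linarith
    then show "block_for \<pi> N (?M1 N) (?M2 N) (?K N) \<delta>" by (rule block_exists[OF \<pi> ab \<delta>])
  qed
qed

end

section \<open>Concatenation of blocks\<close>

text \<open>Channel uses count from \<open>1\<close> and positions inside a block from
  \<open>0\<close>, hence \<open>n + 1 + j\<close>.\<close>

lemma map_upt_split:
  assumes "\<And>i. 1 \<le> i \<Longrightarrow> i \<le> n \<Longrightarrow> F i = G i" "\<And>j. j < N \<Longrightarrow> F (n + 1 + j) = h j"
  shows "map F [1..<Suc (n + N)] = map G [1..<Suc n] @ map h [0..<N]"
proof (rule nth_equalityI)
  fix i assume "i < length (map F [1..<Suc (n + N)])"
  then have i: "i < n + N" by (simp del: upt_Suc)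
  then have "[1..<Suc (n + N)] ! i = 1 + i" by (subst nth_upt) auto
  then have l: "map F [1..<Suc (n + N)] ! i = F (1 + i)" using i by (subst nth_map) auto
  show "map F [1..<Suc (n + N)] ! i = (map G [1..<Suc n] @ map h [0..<N]) ! i"
  proof (cases "i < n")
    case True
    then have "(map G [1..<Suc n] @ map h [0..<N]) ! i = G (1 + i)"
      by (simp add: nth_append del: upt_Suc)
    then show ?thesis using l assms(1)[of "1 + i"] True by simp
  next
    case False
    then have "(map G [1..<Suc n] @ map h [0..<N]) ! i = h (i - n)"
      using i by (simp add: nth_append del: upt_Suc)
    then show ?thesis using l assms(2)[of "i - n"] False i by simp
  qed
qed (simp del: upt_Suc)

lemma sum_div_mod:
  fixes G :: "nat \<Rightarrow> nat \<Rightarrow> real"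
  shows "(\<Sum>m<A * M. G (m div M) (m mod M)) = (\<Sum>a<A. \<Sum>b<M. G a b)"
proof -
  have "(\<Sum>m<A * M. G (m div M) (m mod M)) = (\<Sum>a<A. \<Sum>m\<in>{a * M..<a * M + M}. G (m div M) (m mod M))"
    by (rule sum.nat_group[symmetric])
  also have "\<dots> = (\<Sum>a<A. \<Sum>b<M. G a b)"
  proof (rule sum.cong[OF refl])
    fix a
    have "(\<Sum>m\<in>{a * M..<a * M + M}. G (m div M) (m mod M)) = (\<Sum>b<M. G ((a * M + b) div M) ((a * M + b) mod M))"
      by (rule sum.reindex_bij_witness[where i="\<lambda>b. a * M + b" and j="\<lambda>m. m - a * M"]) auto
    then show "(\<Sum>m\<in>{a * M..<a * M + M}. G (m div M) (m mod M)) = (\<Sum>b<M. G a b)" by simp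
  qed
  finally show ?thesis .
qed

text \<open>Discarding a largest value never raises an average.\<close>

lemma subset_average:
  fixes f :: "'a \<Rightarrow> real"
  assumes "finite A" "0 < c" "c \<le> card A"
  shows "\<exists>S\<subseteq>A. card S = c \<and> (\<Sum>x\<in>S. f x) / c \<le> (\<Sum>x\<in>A. f x) / card A"
  using assms
proof (induction "card A - c" arbitrary: A)
  case 0
  then show ?case by (intro exI[of _ A]) auto
next
  case (Suc d)
  then have cA: "c < card A" by simp
  then have "A \<noteq> {}" by auto
  then have "Max (f ` A) \<in> f ` A" using Suc.prems(1) by (intro Max_in) auto
  then obtain m where mA: "m \<in> A" and fm: "Max (f ` A) = f m" by blast
  have m: "m \<in> A" "\<And>x. x \<in> A \<Longrightarrow> f x \<le> f m"
    using mA Suc.prems(1) unfolding fm[symmetric] by auto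
  have cB: "card (A - {m}) = card A - 1" using m Suc.prems by simp
  have "\<exists>S\<subseteq>A - {m}. card S = c \<and> (\<Sum>x\<in>S. f x) / c \<le> (\<Sum>x\<in>A - {m}. f x) / card (A - {m})"
  proof (rule Suc.hyps(1))
    show "d = card (A - {m}) - c" using Suc.hyps(2) cB by linarith
    show "finite (A - {m})" "0 < c" "c \<le> card (A - {m})" using Suc.prems cB cA by auto
  qed
  moreover have "(\<Sum>x\<in>A - {m}. f x) / card (A - {m}) \<le> (\<Sum>x\<in>A. f x) / card A"
  proof -
    let ?s = "\<Sum>x\<in>A - {m}. f x"
    have "?s \<le> (\<Sum>x\<in>A - {m}. f m)" using m by (intro sum_mono) auto
    then have s: "?s \<le> real (card A - 1) * f m" using cB by simp
    have tot: "(\<Sum>x\<in>A. f x) = f m + ?s" using m Suc.prems by (simp add: sum.remove)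
    have n: "0 < real (card A - 1)" "real (card A) = real (card A - 1) + 1" using cA Suc.prems by auto
    have avg: "x / N \<le> (y + x) / (N + 1)" if "0 < N" "x \<le> N * y" for x y N :: real
    proof -
      have "x * (N + 1) \<le> (y + x) * N" using that by (simp add: algebra_simps)
      then have "x * (N + 1) / (N * (N + 1)) \<le> (y + x) * N / (N * (N + 1))"
        using that(1) by (intro divide_right_mono) auto
      moreover have "x * (N + 1) / (N * (N + 1)) = x / N" "(y + x) * N / (N * (N + 1)) = (y + x) / (N + 1)"
        using that(1) by auto
      ultimately show ?thesis by simp
    qed
    show ?thesis unfolding cB tot n(2) using avg[OF n(1) s] .
  qed
  ultimately show ?case using order_trans by blast
qed

context z_channel
begin

definition zword :: "(nat \<Rightarrow> nat \<Rightarrow> 'x2) \<Rightarrow> nat \<Rightarrow> nat \<Rightarrow> 'z2 list" where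
  "zword f2 n m = map (\<lambda>j. z2 (f2 j m)) [1..<Suc n]"

text \<open>In a partial code receiver 2 is given the value of \<open>\<kappa>\<close>, which backward decoding supplies
  from the block that follows.\<close>

definition partial_code :: "nat \<Rightarrow> nat \<Rightarrow> nat \<Rightarrow> nat \<Rightarrow> real \<Rightarrow> bool" where
  "partial_code n A1 A2 K \<delta> \<longleftrightarrow> (\<exists>f1 f2 \<kappa> g1 g2.
    (\<forall>m<A2. \<kappa> (zword f2 n m) < K) \<and>
    (\<Sum>m1<A1. \<Sum>m2<A2. if g1 (output1 y1 z2 f1 f2 n (m1, m2)) = m1 \<and>
       g2 (\<kappa> (zword f2 n m2)) (output2 t1 y2 z2 f1 f2 n (m1, m2)) = m2 then 0 else 1) / (real A1 * real A2) \<le> \<delta>)"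

lemma partial_code_0: "0 < K \<Longrightarrow> partial_code 0 1 1 K 0"
  unfolding partial_code_def
  by (intro exI[of _ "\<lambda>_ _ _. undefined"] exI[of _ "\<lambda>_ _. undefined"] exI[of _ "\<lambda>_. 0"] exI[of _ "\<lambda>_ _. 0"]) auto

text \<open>Messages are split by \<open>div\<close> and \<open>mod\<close>, the quotient going to
  the earlier blocks. Receiver 2 decodes the new block first and obtains, besides its message part,
  the index with which the block started, exactly what decoding the earlier blocks requires. The
  errors add.\<close>

lemma partial_code_append:
  assumes pc: "partial_code n A1 A2 K \<delta>" and pos: "0 < A1" "0 < A2" "0 < M1" "0 < M2"
    and block: "\<And>\<pi>. set_pmf \<pi> \<subseteq> {..<K} \<Longrightarrow> block_for \<pi> N M1 M2 K \<epsilon>"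
  shows "partial_code (n + N) (A1 * M1) (A2 * M2) K (\<delta> + \<epsilon>)"
proof -
  obtain f1 f2 \<kappa> g1 g2 where \<kappa>: "\<forall>m<A2. \<kappa> (zword f2 n m) < K"
    and err: "(\<Sum>m1<A1. \<Sum>m2<A2. if g1 (output1 y1 z2 f1 f2 n (m1, m2)) = m1 \<and>
       g2 (\<kappa> (zword f2 n m2)) (output2 t1 y2 z2 f1 f2 n (m1, m2)) = m2 then 0 else 1) / (real A1 * real A2) \<le> \<delta>"
    using pc unfolding partial_code_def by blast
  define st where "st = (\<lambda>m. \<kappa> (zword f2 n m))"
  \<comment> \<open>The law of the index that the earlier blocks leave behind for a uniform message.
    All that is known is that it lives below \<open>K\<close>.\<close>
  define \<pi> where "\<pi> = map_pmf st (pmf_of_set {..<A2})"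
  have A2s: "finite {..<A2}" "{..<A2} \<noteq> {}" using pos by auto
  have "set_pmf \<pi> \<subseteq> {..<K}" unfolding \<pi>_def using A2s \<kappa> by (auto simp: st_def)
  from block[OF this, unfolded block_for_def] obtain X1 X2 hash d1 d2 where
    len1: "\<And>k m. k < K \<Longrightarrow> m < M1 \<Longrightarrow> length (X1 k m) = N" and len2: "\<And>k m. k < K \<Longrightarrow> m < M2 \<Longrightarrow> length (X2 k m) = N"
    and hash: "\<And>k m. k < K \<Longrightarrow> m < M2 \<Longrightarrow> hash k (map z2 (X2 k m)) < K"
    and berr: "EV \<pi> (\<lambda>k. (\<Sum>m1<M1. \<Sum>m2<M2.
        if d1 (map y1 (X1 k m1)) = m1 \<and> d2 (hash k (map z2 (X2 k m2))) (map2 y2 (X2 k m2) (map t1 (X1 k m1))) = (k, m2)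
        then 0 else 1) / (real M1 * real M2)) \<le> \<epsilon>" by (elim exE conjE) blast
  have stK: "st a < K" if "a < A2" for a using \<kappa> that by (simp add: st_def)
  \<comment> \<open>In the new block encoder 1 has seen at least the first \<open>n\<close> cribbing
    letters, enough to compute the index. The offset \<open>i - n - 1\<close> turns channel uses
    into list positions.\<close>
  define F1 where "F1 = (\<lambda>i m past. if i \<le> n then f1 i (m div M1) past else X1 (\<kappa> (take n past)) (m mod M1) ! (i - n - 1))"
  define F2 where "F2 = (\<lambda>i m. if i \<le> n then f2 i (m div M2) else X2 (st (m div M2)) (m mod M2) ! (i - n - 1))"
  define \<kappa>' where "\<kappa>' = (\<lambda>z. hash (\<kappa> (take n z)) (drop n z))"
  define G1 where "G1 = (\<lambda>ys. g1 (take n ys) * M1 + d1 (drop n ys))"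
  define G2 where "G2 = (\<lambda>k ys. case d2 k (drop n ys) of (k', b) \<Rightarrow> g2 k' (take n ys) * M2 + b)"
  have z_split: "map (\<lambda>j. z2 (F2 j m)) [1..<Suc (n + j)] = zword f2 n (m div M2) @ map (\<lambda>i. z2 (X2 (st (m div M2)) (m mod M2) ! i)) [0..<j]" for m j
    unfolding zword_def by (rule map_upt_split) (auto simp: F2_def)
  have lenz: "length (zword f2 n m) = n" for m by (simp add: zword_def del: upt_Suc)
  have zw: "zword F2 (n + N) m = zword f2 n (m div M2) @ map z2 (X2 (st (m div M2)) (m mod M2))" if m: "m < A2 * M2" for m
  proof -
    have "m div M2 < A2" using m by (simp add: less_mult_imp_div_less)
    then have "length (X2 (st (m div M2)) (m mod M2)) = N" using len2 stK pos by simp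
    then have "map (\<lambda>i. z2 (X2 (st (m div M2)) (m mod M2) ! i)) [0..<N] = map z2 (X2 (st (m div M2)) (m mod M2))"
      by (intro nth_equalityI) auto
    then show ?thesis unfolding zword_def[of F2] z_split by simp
  qed
  have in1: "input1 z2 F1 F2 (m1, m2) i = input1 z2 f1 f2 (m1 div M1, m2 div M2) i" if "1 \<le> i" "i \<le> n" for m1 m2 i
  proof -
    have "map (\<lambda>j. z2 (F2 j m2)) [1..<i] = map (\<lambda>j. z2 (f2 j (m2 div M2))) [1..<i]"
      using that by (auto simp: F2_def)
    then show ?thesis using that(2) unfolding input1_def F1_def fst_conv snd_conv by (simp only: simp_thms if_True)
  qed
  have in2: "input1 z2 F1 F2 (m1, m2) (n + 1 + j) = X1 (st (m2 div M2)) (m1 mod M1) ! j" for m1 m2 j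
    using z_split[of m2 j] lenz[of "m2 div M2"] by (simp add: input1_def F1_def st_def del: upt_Suc)
  have o1: "output1 y1 z2 F1 F2 (n + N) (m1, m2) = output1 y1 z2 f1 f2 n (m1 div M1, m2 div M2) @ map y1 (X1 (st (m2 div M2)) (m1 mod M1))"
    if m: "m1 < A1 * M1" "m2 < A2 * M2" for m1 m2
  proof -
    have "m2 div M2 < A2" using m by (simp add: less_mult_imp_div_less)
    then have "length (X1 (st (m2 div M2)) (m1 mod M1)) = N" using len1 stK pos by simp
    then have "map (\<lambda>j. y1 (X1 (st (m2 div M2)) (m1 mod M1) ! j)) [0..<N] = map y1 (X1 (st (m2 div M2)) (m1 mod M1))"
      by (intro nth_equalityI) auto
    moreover have "output1 y1 z2 F1 F2 (n + N) (m1, m2) = output1 y1 z2 f1 f2 n (m1 div M1, m2 div M2) @ map (\<lambda>j. y1 (X1 (st (m2 div M2)) (m1 mod M1) ! j)) [0..<N]"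
      unfolding output1_def by (rule map_upt_split) (simp_all only: in1 in2)
    ultimately show ?thesis by simp
  qed
  have o2: "output2 t1 y2 z2 F1 F2 (n + N) (m1, m2) = output2 t1 y2 z2 f1 f2 n (m1 div M1, m2 div M2)
      @ map2 y2 (X2 (st (m2 div M2)) (m2 mod M2)) (map t1 (X1 (st (m2 div M2)) (m1 mod M1)))"
    if m: "m1 < A1 * M1" "m2 < A2 * M2" for m1 m2
  proof -
    let ?a = "X1 (st (m2 div M2)) (m1 mod M1)" and ?b = "X2 (st (m2 div M2)) (m2 mod M2)"
    have "m2 div M2 < A2" using m by (simp add: less_mult_imp_div_less)
    then have "length ?a = N" "length ?b = N" using len1 len2 stK pos by simp_all
    then have "map (\<lambda>j. y2 (?b ! j) (t1 (?a ! j))) [0..<N] = map2 y2 ?b (map t1 ?a)"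
      by (intro nth_equalityI) auto
    moreover have "output2 t1 y2 z2 F1 F2 (n + N) (m1, m2) = output2 t1 y2 z2 f1 f2 n (m1 div M1, m2 div M2) @ map (\<lambda>j. y2 (?b ! j) (t1 (?a ! j))) [0..<N]"
      unfolding output2_def by (rule map_upt_split) (simp_all only: in1 in2 snd_conv, simp_all add: F2_def)
    ultimately show ?thesis by simp
  qed
  have leno: "length (output1 y1 z2 f1 f2 n m) = n" "length (output2 t1 y2 z2 f1 f2 n m) = n" for m
    by (simp_all add: output1_def output2_def del: upt_Suc)
  let ?e = "\<lambda>a1 a2. if g1 (output1 y1 z2 f1 f2 n (a1, a2)) = a1 \<and> g2 (st a2) (output2 t1 y2 z2 f1 f2 n (a1, a2)) = a2 then 0 else 1 :: real"
  let ?b = "\<lambda>k b1 b2. if d1 (map y1 (X1 k b1)) = b1 \<and> d2 (hash k (map z2 (X2 k b2))) (map2 y2 (X2 k b2) (map t1 (X1 k b1))) = (k, b2) then 0 else 1 :: real"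
  let ?E = "\<lambda>m1 m2. if G1 (output1 y1 z2 F1 F2 (n + N) (m1, m2)) = m1 \<and>
       G2 (\<kappa>' (zword F2 (n + N) m2)) (output2 t1 y2 z2 F1 F2 (n + N) (m1, m2)) = m2 then 0 else 1 :: real"
  have E: "?E m1 m2 \<le> ?e (m1 div M1) (m2 div M2) + ?b (st (m2 div M2)) (m1 mod M1) (m2 mod M2)"
    if m: "m1 < A1 * M1" "m2 < A2 * M2" for m1 m2
  proof (cases "?e (m1 div M1) (m2 div M2) = 0 \<and> ?b (st (m2 div M2)) (m1 mod M1) (m2 mod M2) = 0")
    case True
    have "\<kappa>' (zword F2 (n + N) m2) = hash (st (m2 div M2)) (map z2 (X2 (st (m2 div M2)) (m2 mod M2)))"
      unfolding zw[OF m(2)] \<kappa>'_def using lenz by (simp add: st_def)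
    then have "G1 (output1 y1 z2 F1 F2 (n + N) (m1, m2)) = m1 \<and>
       G2 (\<kappa>' (zword F2 (n + N) m2)) (output2 t1 y2 z2 F1 F2 (n + N) (m1, m2)) = m2"
      using True leno unfolding o1[OF m] o2[OF m] G1_def G2_def by (auto split: if_splits)
    then show ?thesis by simp
  next
    case False
    then show ?thesis by (auto split: if_splits)
  qed
  have "(\<Sum>m1<A1 * M1. \<Sum>m2<A2 * M2. ?E m1 m2)
    \<le> (\<Sum>m1<A1 * M1. \<Sum>m2<A2 * M2. ?e (m1 div M1) (m2 div M2) + ?b (st (m2 div M2)) (m1 mod M1) (m2 mod M2))"
    using E by (intro sum_mono) auto
  also have "\<dots> = (\<Sum>a1<A1. \<Sum>b1<M1. \<Sum>a2<A2. \<Sum>b2<M2. ?e a1 a2 + ?b (st a2) b1 b2)"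
    unfolding sum_div_mod[where G="\<lambda>a2 b2. ?e _ a2 + ?b (st a2) _ b2"]
      sum_div_mod[where G="\<lambda>a1 b1. \<Sum>a2<A2. \<Sum>b2<M2. ?e a1 a2 + ?b (st a2) b1 b2"] ..
  also have "\<dots> = (\<Sum>a1<A1. \<Sum>b1<M1. \<Sum>a2<A2. \<Sum>b2<M2. ?e a1 a2) + (\<Sum>a1<A1. \<Sum>b1<M1. \<Sum>a2<A2. \<Sum>b2<M2. ?b (st a2) b1 b2)"
    by (simp only: sum.distrib)
  also have "(\<Sum>a1<A1. \<Sum>b1<M1. \<Sum>a2<A2. \<Sum>b2<M2. ?e a1 a2) = real M1 * real M2 * (\<Sum>a1<A1. \<Sum>a2<A2. ?e a1 a2)"
    by (simp add: sum_distrib_left mult.assoc)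
  also have "(\<Sum>a1<A1. \<Sum>b1<M1. \<Sum>a2<A2. \<Sum>b2<M2. ?b (st a2) b1 b2) = real A1 * (\<Sum>a2<A2. \<Sum>b1<M1. \<Sum>b2<M2. ?b (st a2) b1 b2)"
    by (subst (2) sum.swap) simp
  finally have le: "(\<Sum>m1<A1 * M1. \<Sum>m2<A2 * M2. ?E m1 m2) / (real (A1 * M1) * real (A2 * M2))
    \<le> (real M1 * real M2 * (\<Sum>a1<A1. \<Sum>a2<A2. ?e a1 a2) + real A1 * (\<Sum>a2<A2. \<Sum>b1<M1. \<Sum>b2<M2. ?b (st a2) b1 b2)) / (real (A1 * M1) * real (A2 * M2))"
    by (intro divide_right_mono) auto
  also have "\<dots> = (\<Sum>a1<A1. \<Sum>a2<A2. ?e a1 a2) / (real A1 * real A2) + (\<Sum>a2<A2. (\<Sum>b1<M1. \<Sum>b2<M2. ?b (st a2) b1 b2) / (real M1 * real M2)) / real A2"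
    using pos by (simp add: add_divide_distrib sum_divide_distrib[symmetric])
  also have "\<dots> \<le> \<delta> + \<epsilon>"
  proof (rule add_mono)
    show "(\<Sum>a1<A1. \<Sum>a2<A2. ?e a1 a2) / (real A1 * real A2) \<le> \<delta>" using err by (simp add: st_def)
    show "(\<Sum>a2<A2. (\<Sum>b1<M1. \<Sum>b2<M2. ?b (st a2) b1 b2) / (real M1 * real M2)) / real A2 \<le> \<epsilon>"
      using berr unfolding \<pi>_def integral_map_pmf integral_pmf_of_set[OF A2s(2) A2s(1)] card_lessThan .
  qed
  finally have fin: "(\<Sum>m1<A1 * M1. \<Sum>m2<A2 * M2. ?E m1 m2) / (real (A1 * M1) * real (A2 * M2)) \<le> \<delta> + \<epsilon>" .
  have "\<kappa>' (zword F2 (n + N) m) < K" if m: "m < A2 * M2" for m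
  proof -
    have "m div M2 < A2" using m by (simp add: less_mult_imp_div_less)
    then show ?thesis unfolding zw[OF m] \<kappa>'_def using lenz hash[OF stK] pos by (simp add: st_def)
  qed
  then show ?thesis unfolding partial_code_def using fin
    by (intro exI[of _ F1] exI[of _ F2] exI[of _ \<kappa>'] exI[of _ G1] exI[of _ G2]) blast
qed

lemma partial_code_iterate:
  assumes pos: "0 < M1" "0 < M2" "0 < K"
    and block: "\<And>\<pi>. set_pmf \<pi> \<subseteq> {..<K} \<Longrightarrow> block_for \<pi> N M1 M2 K \<epsilon>"
  shows "partial_code (B * N) (M1 ^ B) (M2 ^ B) K (real B * \<epsilon>)"
proof (induction B)
  case 0
  show ?case using partial_code_0[OF pos(3)] by simp
next
  case (Suc B)
  have "partial_code (B * N + N) (M1 ^ B * M1) (M2 ^ B * M2) K (real B * \<epsilon> + \<epsilon>)"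
    by (rule partial_code_append[OF Suc.IH _ _ pos(1,2) block]) (use pos in auto)
  then show ?case by (simp add: algebra_simps)
qed

text \<open>After the last block both encoders know the value of \<open>\<kappa>\<close> and transmit it uncoded, using two
  pairs of inputs that receiver 2 can distinguish.\<close>

lemma partial_code_terminate:
  assumes pc: "partial_code n0 A1 A2 K \<delta>" and K: "K \<le> 2 ^ T" and n: "n0 + T \<le> n"
    and dist: "y2 b (t1 a) \<noteq> y2 b' (t1 a')"
  shows "\<exists>f1 f2 g1 g2. (\<Sum>m1<A1. \<Sum>m2<A2. if g1 (output1 y1 z2 f1 f2 n (m1, m2)) = m1 \<and>
       g2 (output2 t1 y2 z2 f1 f2 n (m1, m2)) = m2 then 0 else 1) / (real A1 * real A2) \<le> \<delta>"
proof -
  obtain f1 f2 \<kappa> g1 g2 where \<kappa>: "\<forall>m<A2. \<kappa> (zword f2 n0 m) < K"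
    and err: "(\<Sum>m1<A1. \<Sum>m2<A2. if g1 (output1 y1 z2 f1 f2 n0 (m1, m2)) = m1 \<and>
       g2 (\<kappa> (zword f2 n0 m2)) (output2 t1 y2 z2 f1 f2 n0 (m1, m2)) = m2 then 0 else 1) / (real A1 * real A2) \<le> \<delta>"
    using pc unfolding partial_code_def by blast
  let ?BL = "{xs :: bool list. length xs = T}"
  have "card ?BL = 2 ^ T" using card_lists_length_eq[of "UNIV :: bool set" T] by simp
  moreover have "finite ?BL" using finite_lists_length_eq[of "UNIV :: bool set" T] by simp
  ultimately obtain enc where enc: "enc ` {..<K} \<subseteq> ?BL" "inj_on enc {..<K}"
    using card_le_inj[of "{..<K}" ?BL] K by auto
  define N where "N = n - n0"
  have nN: "n = n0 + N" "T \<le> N" using n by (auto simp: N_def)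
  \<comment> \<open>Beyond the \<open>T\<close> bits the pair for a zero bit is repeated, so every
    length from \<open>n0 + T\<close> on is reached.\<close>
  define bt where "bt = (\<lambda>k j. j < T \<and> enc k ! j)"
  define F1 where "F1 = (\<lambda>i m past. if i \<le> n0 then f1 i m past else if bt (\<kappa> (take n0 past)) (i - n0 - 1) then a' else a)"
  define F2 where "F2 = (\<lambda>i m. if i \<le> n0 then f2 i m else if bt (\<kappa> (zword f2 n0 m)) (i - n0 - 1) then b' else b)"
  define G1 where "G1 = (\<lambda>ys :: 'y1 list. g1 (take n0 ys))"
  define G2 where "G2 = (\<lambda>ys. g2 (inv_into {..<K} enc (map (\<lambda>y. y = y2 b' (t1 a')) (take T (drop n0 ys)))) (take n0 ys))"
  have lenz: "length (zword f2 n0 m) = n0" for m by (simp add: zword_def del: upt_Suc)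
  have z_split: "map (\<lambda>j. z2 (F2 j m)) [1..<Suc (n0 + j)] = zword f2 n0 m @ map (\<lambda>j. if bt (\<kappa> (zword f2 n0 m)) j then z2 b' else z2 b) [0..<j]" for m j
    unfolding zword_def by (rule map_upt_split) (auto simp: F2_def zword_def)
  have in1: "input1 z2 F1 F2 (m1, m2) i = input1 z2 f1 f2 (m1, m2) i" if "1 \<le> i" "i \<le> n0" for m1 m2 i
  proof -
    have "map (\<lambda>j. z2 (F2 j m2)) [1..<i] = map (\<lambda>j. z2 (f2 j m2)) [1..<i]"
      using that by (auto simp: F2_def)
    then show ?thesis using that(2) unfolding input1_def F1_def fst_conv snd_conv by (simp only: simp_thms if_True)
  qed
  have in2: "input1 z2 F1 F2 (m1, m2) (n0 + 1 + j) = (if bt (\<kappa> (zword f2 n0 m2)) j then a' else a)" for m1 m2 j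
    using z_split[of m2 j] lenz[of m2] by (simp add: input1_def F1_def del: upt_Suc)
  have o1: "output1 y1 z2 F1 F2 n (m1, m2) = output1 y1 z2 f1 f2 n0 (m1, m2) @ map (\<lambda>j. y1 (if bt (\<kappa> (zword f2 n0 m2)) j then a' else a)) [0..<N]" for m1 m2
    unfolding output1_def nN(1) by (rule map_upt_split) (simp_all only: in1 in2)
  have o2: "output2 t1 y2 z2 F1 F2 n (m1, m2) = output2 t1 y2 z2 f1 f2 n0 (m1, m2)
     @ map (\<lambda>j. if bt (\<kappa> (zword f2 n0 m2)) j then y2 b' (t1 a') else y2 b (t1 a)) [0..<N]" for m1 m2
    unfolding output2_def nN(1) by (rule map_upt_split) (simp_all only: in1 in2 snd_conv, simp_all add: F2_def)
  have leno: "length (output1 y1 z2 f1 f2 n0 m) = n0" "length (output2 t1 y2 z2 f1 f2 n0 m) = n0" for m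
    by (simp_all add: output1_def output2_def del: upt_Suc)
  have G1: "G1 (output1 y1 z2 F1 F2 n (m1, m2)) = g1 (output1 y1 z2 f1 f2 n0 (m1, m2))" for m1 m2
    unfolding G1_def o1 using leno by simp
  have G2: "G2 (output2 t1 y2 z2 F1 F2 n (m1, m2)) = g2 (\<kappa> (zword f2 n0 m2)) (output2 t1 y2 z2 f1 f2 n0 (m1, m2))"
    if m2: "m2 < A2" for m1 m2
  proof -
    let ?k = "\<kappa> (zword f2 n0 m2)"
    have k: "?k \<in> {..<K}" using \<kappa> m2 by simp
    then have l: "length (enc ?k) = T" using enc by auto
    have "map (\<lambda>y. y = y2 b' (t1 a')) (take T (map (\<lambda>j. if bt ?k j then y2 b' (t1 a') else y2 b (t1 a)) [0..<N])) = enc ?k"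
      using l nN(2) dist by (intro nth_equalityI) (auto simp: bt_def)
    then show ?thesis unfolding G2_def o2 using leno enc(2) k by simp
  qed
  have "(\<Sum>m1<A1. \<Sum>m2<A2. if G1 (output1 y1 z2 F1 F2 n (m1, m2)) = m1 \<and> G2 (output2 t1 y2 z2 F1 F2 n (m1, m2)) = m2 then 0 else 1)
    = (\<Sum>m1<A1. \<Sum>m2<A2. if g1 (output1 y1 z2 f1 f2 n0 (m1, m2)) = m1 \<and>
       g2 (\<kappa> (zword f2 n0 m2)) (output2 t1 y2 z2 f1 f2 n0 (m1, m2)) = m2 then 0 else 1 :: real)"
    by (intro sum.cong refl) (simp add: G1 G2)
  then show ?thesis using err by (intro exI[of _ F1] exI[of _ F2] exI[of _ G1] exI[of _ G2]) simp
qed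

text \<open>The message sets are cut to the sizes prescribed by the rates, for one sender after the
  other, each time keeping messages whose average error is no larger. The joint error then bounds
  the error of either receiver.\<close>

lemma code_restrict:
  assumes code: "(\<Sum>m1<A1. \<Sum>m2<A2. if g1 (output1 y1 z2 f1 f2 n (m1, m2)) = m1 \<and>
       g2 (output2 t1 y2 z2 f1 f2 n (m1, m2)) = m2 then 0 else 1) / (real A1 * real A2) \<le> \<delta>"
    and c: "card (messages n R1) \<le> A1" "card (messages n R2) \<le> A2"
  shows "\<exists>f1 f2 g1 g2. is_code y1 t1 y2 z2 n R1 R2 \<delta> f1 f2 g1 g2"
proof -
  have fin: "finite (messages n R)" "messages n R \<noteq> {}" for R by (auto simp: messages_def Suc_le_eq)
  have cpos: "0 < card (messages n R)" for R using fin by (simp add: card_gt_0_iff)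
  let ?c1 = "card (messages n R1)" and ?c2 = "card (messages n R2)"
  define e where "e = (\<lambda>m1 m2. if g1 (output1 y1 z2 f1 f2 n (m1, m2)) = m1 \<and>
       g2 (output2 t1 y2 z2 f1 f2 n (m1, m2)) = m2 then 0 else 1 :: real)"
  obtain S1 where S1: "S1 \<subseteq> {..<A1}" "card S1 = ?c1"
    "(\<Sum>m1\<in>S1. \<Sum>m2<A2. e m1 m2) / ?c1 \<le> (\<Sum>m1<A1. \<Sum>m2<A2. e m1 m2) / A1"
    using subset_average[of "{..<A1}" ?c1 "\<lambda>m1. \<Sum>m2<A2. e m1 m2"] c(1) cpos[of R1] by auto
  obtain S2 where S2: "S2 \<subseteq> {..<A2}" "card S2 = ?c2"
    "(\<Sum>m2\<in>S2. \<Sum>m1\<in>S1. e m1 m2) / ?c2 \<le> (\<Sum>m2<A2. \<Sum>m1\<in>S1. e m1 m2) / A2"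
    using subset_average[of "{..<A2}" ?c2 "\<lambda>m2. \<Sum>m1\<in>S1. e m1 m2"] c(2) cpos[of R2] by auto
  have fS: "finite S1" "finite S2" using S1(1) S2(1) finite_subset by blast+
  obtain \<phi>1 where \<phi>1: "bij_betw \<phi>1 (messages n R1) S1"
    using finite_same_card_bij[OF fin(1) fS(1)] S1(2) by metis
  obtain \<phi>2 where \<phi>2: "bij_betw \<phi>2 (messages n R2) S2"
    using finite_same_card_bij[OF fin(1) fS(2)] S2(2) by metis
  define F1 where "F1 = (\<lambda>i m past. f1 i (\<phi>1 m) past)"
  define F2 where "F2 = (\<lambda>i m. f2 i (\<phi>2 m))"
  define G1 where "G1 = (\<lambda>ys. if g1 ys \<in> S1 then inv_into (messages n R1) \<phi>1 (g1 ys) else 1)"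
  define G2 where "G2 = (\<lambda>ys. if g2 ys \<in> S2 then inv_into (messages n R2) \<phi>2 (g2 ys) else 1)"
  have one: "1 \<in> messages n R" for R by (simp add: messages_def Suc_le_eq)
  have in1: "input1 z2 F1 F2 m i = input1 z2 f1 f2 (\<phi>1 (fst m), \<phi>2 (snd m)) i" for m i
    by (simp add: input1_def F1_def F2_def)
  have o1: "output1 y1 z2 F1 F2 n m = output1 y1 z2 f1 f2 n (\<phi>1 (fst m), \<phi>2 (snd m))" for m
    by (simp add: output1_def in1 del: upt_Suc)
  have o2: "output2 t1 y2 z2 F1 F2 n m = output2 t1 y2 z2 f1 f2 n (\<phi>1 (fst m), \<phi>2 (snd m))" for m
    unfolding output2_def in1 by (simp add: F2_def del: upt_Suc)
  have fm: "finite (set_pmf (pmf_of_set (messages n R)))" for R using fin by simp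
  have E: "EV (message_pmf n R1 R2) (\<lambda>m. e (\<phi>1 (fst m)) (\<phi>2 (snd m))) \<le> \<delta>"
  proof -
    have "EV (message_pmf n R1 R2) (\<lambda>m. e (\<phi>1 (fst m)) (\<phi>2 (snd m)))
      = (\<Sum>m1\<in>messages n R1. (\<Sum>m2\<in>messages n R2. e (\<phi>1 m1) (\<phi>2 m2)) / ?c2) / ?c1"
      unfolding message_pmf_def EV_pair[OF fm fm] fst_conv snd_conv integral_pmf_of_set[OF fin(2) fin(1)] ..
    also have "\<dots> = (\<Sum>m1\<in>S1. (\<Sum>m2\<in>S2. e m1 m2) / ?c2) / ?c1"
    proof -
      have r2: "(\<Sum>m2\<in>messages n R2. e a (\<phi>2 m2)) = (\<Sum>m2\<in>S2. e a m2)" for a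
        by (rule sum.reindex_bij_betw[OF \<phi>2])
      have r1: "(\<Sum>m1\<in>messages n R1. (\<Sum>m2\<in>S2. e (\<phi>1 m1) m2) / ?c2) = (\<Sum>m1\<in>S1. (\<Sum>m2\<in>S2. e m1 m2) / ?c2)"
        by (rule sum.reindex_bij_betw[OF \<phi>1])
      show ?thesis unfolding r2 r1 ..
    qed
    also have "\<dots> = (\<Sum>m2\<in>S2. \<Sum>m1\<in>S1. e m1 m2) / ?c2 / ?c1"
      by (subst sum.swap) (simp add: sum_divide_distrib)
    also have "\<dots> \<le> (\<Sum>m2<A2. \<Sum>m1\<in>S1. e m1 m2) / A2 / ?c1"
      using S2(3) by (intro divide_right_mono) auto
    also have "\<dots> = (\<Sum>m1\<in>S1. \<Sum>m2<A2. e m1 m2) / ?c1 / A2"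
      by (subst sum.swap) simp
    also have "\<dots> \<le> (\<Sum>m1<A1. \<Sum>m2<A2. e m1 m2) / A1 / A2"
      using S1(3) by (intro divide_right_mono) auto
    also have "\<dots> \<le> \<delta>" using code by (simp add: e_def)
    finally show ?thesis .
  qed
  have mem: "m \<in> set_pmf (message_pmf n R1 R2) \<Longrightarrow> fst m \<in> messages n R1 \<and> snd m \<in> messages n R2" for m
    unfolding message_pmf_def using fin by auto
  have fM: "finite (set_pmf (message_pmf n R1 R2))" unfolding message_pmf_def using fm by auto
  have good: "G1 (output1 y1 z2 F1 F2 n m) = fst m" "G2 (output2 t1 y2 z2 F1 F2 n m) = snd m"
    if m: "m \<in> set_pmf (message_pmf n R1 R2)" and e0: "e (\<phi>1 (fst m)) (\<phi>2 (snd m)) = 0" for m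
  proof -
    have g: "g1 (output1 y1 z2 f1 f2 n (\<phi>1 (fst m), \<phi>2 (snd m))) = \<phi>1 (fst m)"
      "g2 (output2 t1 y2 z2 f1 f2 n (\<phi>1 (fst m), \<phi>2 (snd m))) = \<phi>2 (snd m)"
      using e0 by (auto simp: e_def split: if_splits)
    show "G1 (output1 y1 z2 F1 F2 n m) = fst m"
      unfolding G1_def o1 g using mem[OF m] \<phi>1 by (auto simp: bij_betw_def)
    show "G2 (output2 t1 y2 z2 F1 F2 n m) = snd m"
      unfolding G2_def o2 g using mem[OF m] \<phi>2 by (auto simp: bij_betw_def)
  qed
  have e01: "e a b = 0 \<or> e a b = 1" for a b by (simp add: e_def)
  have "PR (message_pmf n R1 R2) {m. G1 (output1 y1 z2 F1 F2 n m) \<noteq> fst m} \<le> \<delta>"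
  proof -
    have "PR (message_pmf n R1 R2) {m. G1 (output1 y1 z2 F1 F2 n m) \<noteq> fst m}
      \<le> EV (message_pmf n R1 R2) (\<lambda>m. e (\<phi>1 (fst m)) (\<phi>2 (snd m)))"
      unfolding PR_eq_EV
    proof (rule EV_mono[OF fM])
      fix m assume m: "m \<in> set_pmf (message_pmf n R1 R2)"
      show "(if G1 (output1 y1 z2 F1 F2 n m) \<noteq> fst m then 1 else 0) \<le> e (\<phi>1 (fst m)) (\<phi>2 (snd m))"
        using good(1)[OF m] e01[of "\<phi>1 (fst m)" "\<phi>2 (snd m)"] by auto
    qed
    then show ?thesis using E by linarith
  qed
  moreover have "PR (message_pmf n R1 R2) {m. G2 (output2 t1 y2 z2 F1 F2 n m) \<noteq> snd m} \<le> \<delta>"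
  proof -
    have "PR (message_pmf n R1 R2) {m. G2 (output2 t1 y2 z2 F1 F2 n m) \<noteq> snd m}
      \<le> EV (message_pmf n R1 R2) (\<lambda>m. e (\<phi>1 (fst m)) (\<phi>2 (snd m)))"
      unfolding PR_eq_EV
    proof (rule EV_mono[OF fM])
      fix m assume m: "m \<in> set_pmf (message_pmf n R1 R2)"
      show "(if G2 (output2 t1 y2 z2 F1 F2 n m) \<noteq> snd m then 1 else 0) \<le> e (\<phi>1 (fst m)) (\<phi>2 (snd m))"
        using good(2)[OF m] e01[of "\<phi>1 (fst m)" "\<phi>2 (snd m)"] by auto
    qed
    then show ?thesis using E by linarith
  qed
  moreover have "G1 ys \<in> messages n R1" "G2 ys' \<in> messages n R2" for ys ys'
    unfolding G1_def G2_def using one \<phi>1 \<phi>2 by (auto simp: bij_betw_def inv_into_into)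
  ultimately show ?thesis unfolding is_code_def
    by (intro exI[of _ F1] exI[of _ F2] exI[of _ G1] exI[of _ G2]) simp
qed

section \<open>Achievability\<close>

text \<open>Conditioning reduces entropy. Hence \<open>R2\<close> below \<open>H(Y2,Z2|T1,W)\<close>
  is also below \<open>H(Y2,Z2|W)\<close>, which leaves room for a positive list rate.\<close>

lemma hB_le_hD: "hB r \<le> hD r"
proof -
  have f: "finite (set_pmf r)" by (rule finite_supp)
  have "entropy_pmf r (\<lambda>s. (YZ s, T1 s)) - entropy_pmf r T1 \<le> entropy_pmf r (\<lambda>s. (YZ s, ())) - entropy_pmf r (\<lambda>s. ())"
    by (rule cond_entropy_reduces[OF f]) (simp add: determines_def)
  moreover have "entropy_pmf r (\<lambda>s. (YZ s, ())) = entropy_pmf r YZ"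
    by (rule entropy_eq[OF f]) (simp_all add: determines_def)
  ultimately show ?thesis unfolding hB_def hD_def using entropy_pmf_nonneg[OF f, of "\<lambda>s. ()"] by linarith
qed

text \<open>Rounding in \<open>n div D\<close> loses fewer than \<open>D\<close> channel uses, which
  the strict inequality covers once \<open>n\<close> is large.\<close>

lemma rate_fits:
  assumes R: "0 \<le> R" "0 \<le> R'" and D: "0 < D" and less: "R = 0 \<or> real D * R < real B * R'"
  shows "\<forall>\<^sub>F n in sequentially. card (messages n R) \<le> size_of_rate (n div D) R' ^ B"
proof (cases "R = 0")
  case True
  have "1 \<le> size_of_rate N R' ^ B" for N
    using size_of_rate_bounds(3)[OF R(2), of N] by (simp add: Suc_le_eq)
  then show ?thesis using True by (auto simp: messages_def)
next
  case False
  then have gap: "0 < real B * R' - real D * R" using less by simp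
  obtain N0 :: nat where N0: "real D * R / (real B * R' - real D * R) < real N0" using reals_Archimedean2 by blast
  show ?thesis unfolding eventually_sequentially
  proof (intro exI[of _ "N0 * D"] allI impI)
    fix n assume n: "N0 * D \<le> n"
    let ?N = "n div D"
    have "N0 \<le> ?N" using n D by (simp add: less_eq_div_iff_mult_less_eq)
    then have "real D * R / (real B * R' - real D * R) \<le> real ?N" using N0 by linarith
    then have "real D * R \<le> real ?N * (real B * R' - real D * R)" using gap by (simp add: pos_divide_le_eq)
    then have 1: "real (?N + 1) * real D * R \<le> real ?N * real B * R'" by (simp add: algebra_simps)
    have "n < (?N + 1) * D" using D by (metis Suc_eq_plus1 div_less_iff_less_mult lessI)
    then have "real n \<le> real (?N + 1) * real D" by (metis less_imp_le of_nat_le_iff of_nat_mult)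
    then have "real n * R \<le> real (?N + 1) * real D * R" using R by (intro mult_right_mono)
    with 1 have le: "real n * R \<le> real ?N * real B * R'" by linarith
    have "2 powr (real n * R) \<le> 2 powr (real ?N * R' * real B)" using le by (simp add: mult_ac)
    also have "\<dots> = (2 powr (real ?N * R')) ^ B" by (simp add: powr_powr[symmetric] powr_realpow)
    also have "\<dots> \<le> real (size_of_rate ?N R') ^ B"
      using size_of_rate_bounds(1)[OF R(2)] by (intro power_mono) auto
    finally have "2 powr (real n * R) \<le> real (size_of_rate ?N R' ^ B)" by simp
    then show "card (messages n R) \<le> size_of_rate ?N R' ^ B"
      by (simp add: messages_def ceiling_le_iff nat_le_iff)
  qed
qed

text \<open>Of \<open>B + c\<close> portions of equal length, \<open>B\<close> carry blocks and
  \<open>c\<close> carry the final index. For large \<open>B\<close> the gap between the rates with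
  and without prime pays for the extra portions.\<close>

lemma achievable_with_slack:
  assumes fin: "finite (set_pmf pW)" and R: "0 \<le> R1" "0 \<le> R2" "R1 = 0 \<and> R1' = 0 \<or> R1 < R1'" "R2 < R2'" and Rt: "0 < Rt"
    and HY: "R2' + Rt < H2 pW p1 p2"
    and HD: "R2' + Rt < mean hD pW p1 p2"
    and HB: "R2' < mean hB pW p1 p2"
    and R1: "R1' = 0 \<or> R1' < mean hA pW p1 p2 \<and>
       R1' - Rt < mean hC pW p1 p2"
  shows "achievable y1 t1 y2 z2 (R1, R2)"
proof -
  have R': "0 \<le> R1'" "0 \<le> R2'" using R by auto
  \<comment> \<open>If the output of receiver 2 were constant, \<open>H(Y2)\<close> would be zero,
    against \<open>HY\<close>.\<close>
  obtain a b a' b' where dist: "y2 b (t1 a) \<noteq> y2 b' (t1 a')"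
  proof (rule ccontr)
    assume "\<not> thesis"
    then have const: "y2 b (t1 a) = y2 b' (t1 a')" for a b a' b' using that by blast
    let ?r = "bind_pmf pW (law p1 p2)"
    have "Y2 ` set_pmf ?r \<subseteq> {y2 undefined (t1 undefined)}" using const by (auto simp: Y2_def)
    then have "entropy_pmf ?r Y2 \<le> log 2 (card {y2 undefined (t1 undefined)})"
      by (intro entropy_le_log_card finite_supp) auto
    then show False using HY R' Rt by simp
  qed
  \<comment> \<open>Makes \<open>K \<le> 2 ^ (N * c)\<close>: \<open>\<lceil>R2'\<rceil>\<close>
    bits per letter for \<open>M2\<close>, and one more for the factor \<open>2 ^ N\<close>.\<close>
  define c where "c = nat \<lceil>R2'\<rceil> + 1"
  obtain B :: nat where B: "0 < B" "R1 = 0 \<or> real (B + c) * R1 < real B * R1'" "real (B + c) * R2 < real B * R2'"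
  proof -
    obtain b1 :: nat where b1: "real c * R1 / (R1' - R1) < real b1" using reals_Archimedean2 by blast
    obtain b2 :: nat where b2: "real c * R2 / (R2' - R2) < real b2" using reals_Archimedean2 by blast
    define B where "B = b1 + b2 + 1"
    have "real (B + c) * R2 < real B * R2'"
    proof -
      have "real c * R2 / (R2' - R2) < real B" using b2 by (simp add: B_def)
      then have "real c * R2 < real B * (R2' - R2)" using R(4) by (simp add: pos_divide_less_eq)
      then show ?thesis by (simp add: algebra_simps)
    qed
    moreover have "R1 = 0 \<or> real (B + c) * R1 < real B * R1'"
    proof (cases "R1 < R1'")
      case True
      have "real c * R1 / (R1' - R1) < real B" using b1 by (simp add: B_def)
      then have "real c * R1 < real B * (R1' - R1)" using True by (simp add: pos_divide_less_eq)
      then show ?thesis by (simp add: algebra_simps)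
    qed (use R(3) in auto)
    ultimately show thesis using that[of B] by (simp add: B_def)
  qed
  have code: "\<forall>\<^sub>F n in sequentially. \<exists>f1 f2 g1 g2. is_code y1 t1 y2 z2 n R1 R2 \<epsilon> f1 f2 g1 g2" if \<epsilon>: "0 < \<epsilon>" for \<epsilon>
  proof -
    have \<delta>: "0 < \<epsilon> / real B" using \<epsilon> B(1) by simp
    have D: "0 < B + c" using B(1) by simp
    have div_top: "filterlim (\<lambda>n. n div (B + c)) sequentially sequentially"
      unfolding filterlim_at_top
    proof
      fix Z
      show "\<forall>\<^sub>F n in sequentially. Z \<le> n div (B + c)"
        unfolding eventually_sequentially using D by (intro exI[of _ "Z * (B + c)"]) (simp add: less_eq_div_iff_mult_less_eq)
    qed
    note ev = filterlim_iff[THEN iffD1, OF div_top, rule_format, OF block_eventually[OF fin R' Rt HY HD HB R1 \<delta>]]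
    note fit1 = rate_fits[OF R(1) R'(1) D B(2)] and fit2 = rate_fits[OF R(2) R'(2) D disjI2[OF B(3)]]
    show ?thesis
    proof (rule eventually_mono[OF eventually_conj[OF ev eventually_conj[OF fit1 fit2]]], elim conjE)
      fix n
      let ?N = "n div (B + c)"
      let ?M1 = "size_of_rate ?N R1'" and ?M2 = "size_of_rate ?N R2'" and ?K = "size_of_rate ?N R2' * 2 ^ ?N"
      assume blk: "\<forall>\<pi>. set_pmf \<pi> \<subseteq> {..<?K} \<longrightarrow> block_for \<pi> ?N ?M1 ?M2 ?K (\<epsilon> / real B)"
      assume fits: "card (messages n R1) \<le> ?M1 ^ B" "card (messages n R2) \<le> ?M2 ^ B"
      have "partial_code (B * ?N) (?M1 ^ B) (?M2 ^ B) ?K (real B * (\<epsilon> / real B))"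
        by (rule partial_code_iterate) (use blk size_of_rate_bounds(3) R' in auto)
      then have pc: "partial_code (B * ?N) (?M1 ^ B) (?M2 ^ B) ?K \<epsilon>" using B(1) by simp
      have K: "?K \<le> 2 ^ (?N * c)"
      proof -
        have "real ?N * R2' \<le> real (?N * (c - 1))" using R' by (simp add: c_def mult_left_mono)
        then have "2 powr (real ?N * R2') \<le> 2 powr real (?N * (c - 1))" by simp
        also have "\<dots> = real (2 ^ (?N * (c - 1)))" by (subst powr_realpow) auto
        finally have "?M2 \<le> 2 ^ (?N * (c - 1))" unfolding size_of_rate_def by (simp add: ceiling_le_iff nat_le_iff)
        then have "?K \<le> 2 ^ (?N * (c - 1)) * 2 ^ ?N" by (rule mult_le_mono1)
        also have "\<dots> = 2 ^ (?N * c)" by (simp add: c_def flip: power_add)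
        finally show ?thesis .
      qed
      have "B * ?N + ?N * c = ?N * (B + c)" by (simp add: algebra_simps)
      also have "\<dots> \<le> n" by (rule div_times_less_eq_dividend)
      finally have len: "B * ?N + ?N * c \<le> n" .
      obtain f1 f2 g1 g2 where "(\<Sum>m1<?M1 ^ B. \<Sum>m2<?M2 ^ B. if g1 (output1 y1 z2 f1 f2 n (m1, m2)) = m1 \<and>
         g2 (output2 t1 y2 z2 f1 f2 n (m1, m2)) = m2 then 0 else 1) / (real (?M1 ^ B) * real (?M2 ^ B)) \<le> \<epsilon>"
        using partial_code_terminate[OF pc K len dist] by blast
      from code_restrict[OF this fits]
      show "\<exists>f1 f2 g1 g2. is_code y1 t1 y2 z2 n R1 R2 \<epsilon> f1 f2 g1 g2" .
    qed
  qed
  then show ?thesis unfolding achievable_def using R by auto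
qed

lemma achievable_strict:
  assumes fin: "finite (set_pmf pW)" and R: "0 \<le> R1" "0 \<le> R2"
    and R2: "R2 < H2 pW p1 p2"
      "R2 < mean hB pW p1 p2"
    and R1: "R1 = 0 \<or> R1 < mean hA pW p1 p2"
    and sum: "R1 = 0 \<or> R1 + R2 < mean hC pW p1 p2 + H2 pW p1 p2"
      "R1 = 0 \<or> R1 + R2 < mean hC pW p1 p2 + mean hD pW p1 p2"
  shows "achievable y1 t1 y2 z2 (R1, R2)"
proof -
  define a where "a = mean hA pW p1 p2"
  define b where "b = mean hB pW p1 p2"
  define c where "c = mean hC pW p1 p2"
  define d where "d = mean hD pW p1 p2"
  define y where "y = H2 pW p1 p2"
  have "b \<le> d" unfolding b_def d_def by (intro EV_mono fin hB_le_hD)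
  define m where "m = min y d"
  have m: "R2 < m" "m \<le> y" "m \<le> d" using R2 \<open>b \<le> d\<close> by (auto simp: m_def y_def b_def)
  have b: "R2 < b" using R2 by (simp add: b_def)
  note slack = achievable_with_slack[OF fin R, where ?p1.0=p1 and ?p2.0=p2, folded a_def b_def c_def d_def y_def]
  show ?thesis
  proof (cases "R1 = 0")
    case True
    define \<gamma> where "\<gamma> = min (m - R2) (b - R2) / 3"
    have g: "0 < \<gamma>" "3 * \<gamma> \<le> m - R2" "3 * \<gamma> \<le> b - R2" using m b by (auto simp: \<gamma>_def)
    show ?thesis by (rule slack[of 0 "R2 + \<gamma>" \<gamma>]) (use True g m in auto)
  next
    case False
    then have R1a: "R1 < a" and s: "R1 + R2 < c + m" using R1 sum by (auto simp: a_def c_def d_def y_def m_def)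
    \<comment> \<open>A third of the smallest slack: raising both rates by \<open>\<gamma>\<close>
      uses two thirds in the sum bound, and the rest keeps the interval for \<open>Rt\<close>
      nonempty.\<close>
    define \<gamma> where "\<gamma> = min (min (m - R2) (b - R2)) (min (a - R1) (c + m - R1 - R2)) / 3"
    have g: "0 < \<gamma>" "3 * \<gamma> \<le> m - R2" "3 * \<gamma> \<le> b - R2" "3 * \<gamma> \<le> a - R1" "3 * \<gamma> \<le> c + m - R1 - R2"
      using m b R1a s by (auto simp: \<gamma>_def)
    have "max 0 (R1 + \<gamma> - c) < m - (R2 + \<gamma>)" using g by auto
    then obtain Rt where Rt: "max 0 (R1 + \<gamma> - c) < Rt" "Rt < m - (R2 + \<gamma>)" using dense by blast
    show ?thesis by (rule slack[of "R1 + \<gamma>" "R2 + \<gamma>" Rt]) (use False g m Rt in auto)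
  qed
qed

text \<open>Sender 2 sends a constant, and receiver 1 observes a noiseless function of
  \<open>X1\<close>, so every word over \<open>range y1\<close> can carry a message without error.
  The block scheme cannot serve here, as it needs \<open>H(Y2)\<close> to be positive.\<close>

lemma achievable_silent:
  assumes R: "0 \<le> R1" and le: "R1 \<le> log 2 (card (range y1))"
  shows "achievable y1 t1 y2 z2 (R1, 0)"
proof -
  have code: "\<exists>f1 f2 g1 g2. is_code y1 t1 y2 z2 n R1 0 \<epsilon> f1 f2 g1 g2" if \<epsilon>: "0 < \<epsilon>" for n \<epsilon>
  proof -
    let ?S = "{xs. set xs \<subseteq> range y1 \<and> length xs = n}"
    have cp: "0 < card (range y1)" by (simp add: card_gt_0_iff)
    have "2 powr (real n * R1) \<le> 2 powr (real n * log 2 (card (range y1)))"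
      using le by (simp add: mult_left_mono)
    also have "\<dots> = (2 powr log 2 (card (range y1))) ^ n" by (simp add: powr_power mult.commute)
    also have "\<dots> = real (card (range y1) ^ n)" using cp by simp
    finally have "card (messages n R1) \<le> card ?S"
      by (simp add: messages_def card_lists_length_eq ceiling_le_iff nat_le_iff)
    moreover have "finite ?S" by (rule finite_lists_length_eq) simp
    moreover have fin: "finite (messages n R1)" by (simp add: messages_def)
    ultimately obtain \<psi> where \<psi>: "\<psi> ` messages n R1 \<subseteq> ?S" "inj_on \<psi> (messages n R1)"
      using card_le_inj[of "messages n R1" ?S] by blast
    define f1 where "f1 = (\<lambda>i m (past :: 'z2 list). inv y1 (\<psi> m ! (i - 1)))"
    define g1 where "g1 = (\<lambda>ys. if ys \<in> \<psi> ` messages n R1 then inv_into (messages n R1) \<psi> ys else 1)"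
    have out: "output1 y1 z2 f1 (\<lambda>_ _. undefined) n m = \<psi> (fst m)" if m: "fst m \<in> messages n R1" for m
    proof (rule nth_equalityI)
      have S: "\<psi> (fst m) \<in> ?S" using \<psi> m by blast
      show "length (output1 y1 z2 f1 (\<lambda>_ _. undefined) n m) = length (\<psi> (fst m))"
        using S by (simp add: output1_def del: upt_Suc)
      fix i assume "i < length (output1 y1 z2 f1 (\<lambda>_ _. undefined) n m)"
      then have i: "i < n" by (simp add: output1_def del: upt_Suc)
      then have "\<psi> (fst m) ! i \<in> set (\<psi> (fst m))" using S by simp
      then have "\<psi> (fst m) ! i \<in> range y1" using S by blast
      then have "y1 (inv y1 (\<psi> (fst m) ! i)) = \<psi> (fst m) ! i" by (rule f_inv_into_f)
      then show "output1 y1 z2 f1 (\<lambda>_ _. undefined) n m ! i = \<psi> (fst m) ! i"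
        using i by (simp add: output1_def input1_def f1_def del: upt_Suc)
    qed
    have one: "1 \<in> messages n R" for R by (simp add: messages_def Suc_le_eq)
    have m0: "messages n 0 = {1}" by (auto simp: messages_def)
    have sup: "fst m \<in> messages n R1 \<and> snd m = 1" if "m \<in> set_pmf (message_pmf n R1 0)" for m
    proof -
      have "set_pmf (pmf_of_set (messages n R1)) = messages n R1" using fin one by (intro set_pmf_of_set) auto
      moreover have "m \<in> set_pmf (pmf_of_set (messages n R1)) \<times> {1}"
        using that unfolding message_pmf_def m0 pmf_of_set_singleton set_pair_pmf set_return_pmf .
      ultimately show ?thesis by (simp add: mem_Times_iff)
    qed
    have z: "PR (message_pmf n R1 0) {m. Q m} = 0" if "\<And>m. m \<in> set_pmf (message_pmf n R1 0) \<Longrightarrow> \<not> Q m" for Q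
      using that by (auto simp: measure_pmf_zero_iff)
    have "PR (message_pmf n R1 0) {m. g1 (output1 y1 z2 f1 (\<lambda>_ _. undefined) n m) \<noteq> fst m} = 0"
    proof (rule z)
      fix m assume "m \<in> set_pmf (message_pmf n R1 0)"
      then have m: "fst m \<in> messages n R1" using sup by blast
      then show "\<not> g1 (output1 y1 z2 f1 (\<lambda>_ _. undefined) n m) \<noteq> fst m"
        using \<psi>(2) by (simp add: out g1_def)
    qed
    moreover have "PR (message_pmf n R1 0) {m. (\<lambda>_. 1) (output2 t1 y2 z2 f1 (\<lambda>_ _. undefined) n m) \<noteq> snd m} = 0"
      by (rule z) (use sup in auto)
    moreover have "g1 ys \<in> messages n R1" for ys
      unfolding g1_def using one by (auto intro: inv_into_into)
    ultimately show ?thesis unfolding is_code_def using \<epsilon> one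
      by (intro exI[of _ f1] exI[of _ "\<lambda>_ _. undefined"] exI[of _ g1] exI[of _ "\<lambda>_. 1"]) simp
  qed
  then show ?thesis unfolding achievable_def using R by auto
qed

text \<open>Scaling by a factor below one makes the bounds on positive rates strict, and the factor
  tends to one. \<open>R2 = 0\<close> stands apart because the bounds on it may be zero as
  well.\<close>

theorem direct:
  assumes "(R1, R2) \<in> region"
  shows "(R1, R2) \<in> closure {R. achievable y1 t1 y2 z2 R}"
proof -
  obtain pW p1 p2 where fin: "finite (set_pmf (pW :: nat pmf))"
    and bd: "in_bounds pW (law p1 p2) R1 R2" and R: "0 \<le> R1" "0 \<le> R2"
    using assms unfolding region_iff by blast
  note b = bd[unfolded in_bounds_iff]
  show ?thesis
  proof (cases "R2 = 0")
    case True
    have "mean hA pW p1 p2 \<le> log 2 (card (range y1))"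
      unfolding hA_def
    proof (rule EV_le_const[OF fin])
      fix w
      have "Y1 ` set_pmf (pair_pmf (p1 w) (p2 w)) \<subseteq> range y1" by (auto simp: Y1_def)
      then show "entropy_pmf (pair_pmf (p1 w) (p2 w)) Y1 \<le> log 2 (card (range y1))"
        by (intro entropy_le_log_card finite_supp) simp_all
    qed
    then have "achievable y1 t1 y2 z2 (R1, 0)" using b by (intro achievable_silent[OF R(1)]) linarith
    then show ?thesis using True closure_subset by blast
  next
    case False
    then have R2: "0 < R2" using R by simp
    have ach: "achievable y1 t1 y2 z2 (\<theta> * R1, \<theta> * R2)" if \<theta>: "0 < \<theta>" "\<theta> < 1" for \<theta>
    proof -
      have less: "\<theta> * r < x" if "0 < r" "r \<le> x" for r x
      proof -
        have "\<theta> * r < 1 * r" using \<theta> that by (intro mult_strict_right_mono) auto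
        then show ?thesis using that by linarith
      qed
      have "0 < R1 + R2" using R R2 by simp
      then have s: "\<theta> * R1 + \<theta> * R2 < x" if "R1 + R2 \<le> x" for x
        using less[of "R1 + R2" x] that by (simp add: distrib_left)
      have r1: "\<theta> * R1 = 0 \<or> \<theta> * R1 < mean hA pW p1 p2"
        using less[of R1] R b by (cases "R1 = 0") auto
      show ?thesis
        by (rule achievable_strict[OF fin, where ?p1.0=p1 and ?p2.0=p2])
           (use R \<theta> b less[OF R2] s r1 in auto)
    qed
    define f where "f = (\<lambda>k::nat. (real k + 1) / (real k + 2))"
    have "(\<lambda>k. (f k * R1, f k * R2)) \<longlonglongrightarrow> (1 * R1, 1 * R2)"
    proof -
      have "f \<longlonglongrightarrow> 1" unfolding f_def by real_asymp
      then show ?thesis by (intro tendsto_Pair tendsto_mult tendsto_const)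
    qed
    moreover have "(f k * R1, f k * R2) \<in> {R. achievable y1 t1 y2 z2 R}" for k
      unfolding mem_Collect_eq by (rule ach) (auto simp: f_def)
    ultimately show ?thesis unfolding closure_sequential mult_1 by (intro exI[of _ "\<lambda>k. (f k * R1, f k * R2)"]) simp
  qed
qed

end

theorem theorem5:
  fixes y1 :: "'x1::finite \<Rightarrow> 'y1::finite"
    and t1 :: "'x1 \<Rightarrow> 't1::finite"
    and y2 :: "'x2::finite \<Rightarrow> 't1 \<Rightarrow> 'y2::finite"
    and z2 :: "'x2 \<Rightarrow> 'z2::finite"
  assumes injective: "\<And>x2. inj (y2 x2)"
  shows "capacity_region y1 t1 y2 z2 =
           closure (convex hull (\<Union>k. rate_region y1 t1 y2 z2 {..<k})) \<and>
         capacity_region y1 t1 y2 z2 =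
           closure (convex hull (rate_region y1 t1 y2 z2 {..<CARD('y2) + 3}))"
proof -
  interpret z_channel y1 t1 y2 z2 .
  have "{R. achievable y1 t1 y2 z2 R} \<subseteq> closure region"
    using converse[OF injective] by auto
  moreover have "region \<subseteq> closure {R. achievable y1 t1 y2 z2 R}"
    using direct by auto
  ultimately have "capacity_region y1 t1 y2 z2 = closure region"
    unfolding capacity_region_def by (intro equalityI closure_minimal closed_closure)
  moreover have "convex hull region = region"
    using convex_region by (simp add: convex_hull_eq)
  ultimately have "capacity_region y1 t1 y2 z2 = closure (convex hull region)" by simp
  then show ?thesis using region_eq_bounded region_def by simp
qed

end
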